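(* Let $a=(h-\lambda_1)\cdots(h-\lambda_n)$ and $b=(h-\mu_1)\cdots(h-\mu_n)$ in $k[h]$ be two polynomials of degree $n$ such that $\lambda_i-\lambda_j\notin\mathbb{Z}$ and $\mu_i-\mu_j\notin\mathbb{Z}$ for all $i\neq j$. Define the column vectors $\Lambda=(\lambda_n-\lambda_1,\ldots,\lambda_n-\lambda_{n-1})^t\in k^{n-1}$ and $\Omega=(\mu_n-\mu_1,\ldots,\mu_n-\mu_{n-1})^t\in k^{n-1}$. Assume that the algebras $A(a)$ and $A(b)$ are ($k$-linearly) Morita equivalent. Then there exist a matrix $N\in GL_{n-1}(\mathbb{Z})$ and a column vector of integers $M=(m_1,\ldots,m_{n-1})^t\in\mathbb{Z}^{n-1}$ such that $$N\cdot\Lambda=\Omega+M .$$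
   Context: $k$ is an algebraically closed field of characteristic zero. For $a\in k[h]$, $A(a)$ denotes the (classical) generalized Weyl algebra: the $k$-algebra generated over $k[h]$ by two generators $x,y$ subject to the relations $xh=(h-1)x$, $yh=(h+1)y$, $yx=a(h)$, $xy=a(h-1)$. Morita equivalence is understood as $k$-linear equivalence of categories of left modules. $\mathbb{Z}$ is viewed inside $k$. *)

theory Defs
  imports
    "HOL-Library.Poly_Mapping"
    "HOL-Library.FuncSet"
    "HOL-Algebra.QuotRing"
    "HOL-Algebra.Module"
    "HOL-Computational_Algebra.Polynomial"
    "Jordan_Normal_Form.Matrix"
begin

section \<open>Algebras over a field and their left modules\<close>

text \<open>
  A type of class \<open>ring_1\<close> as a ring record. The constant \<open>ring_of_type_algebra\<close> of the
  library theory on algebraic closures is the same, but that theory reserves the name \<open>X\<close>.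
\<close>

definition type_ring :: "'a::ring_1 ring" where
  "type_ring = \<lparr>carrier = UNIV, monoid.mult = (*), one = 1, zero = 0, add = (+)\<rparr>"

lemma ring_type_ring: "ring (type_ring :: 'a::ring_1 ring)"
proof -
  have "\<exists>y. y + x = 0" for x :: 'a
    using add.left_inverse by blast
  then show ?thesis
    by (auto intro!: ringI abelian_groupI monoidI
        simp: type_ring_def algebra_simps)
qed

lemma cring_type_ring: "cring (type_ring :: 'a::comm_ring_1 ring)"
proof -
  interpret ring "type_ring :: 'a ring" by (rule ring_type_ring)
  show ?thesis by unfold_locales (simp add: type_ring_def mult.commute)
qed

text \<open>
  An algebra over the field (given as a type) \<open>'k\<close> is a ring record extended by a scalar
  multiplication; it need not be commutative, so the library locale \<open>algebra\<close> does not apply.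
\<close>

locale k_algebra = ring A for A :: "('k::field, 'a) module" (structure) +
  assumes scale_closed: "x \<in> carrier A \<Longrightarrow> c \<odot> x \<in> carrier A"
    and scale_add_left: "x \<in> carrier A \<Longrightarrow> (c + d) \<odot> x = (c \<odot> x) \<oplus> (d \<odot> x)"
    and scale_add_right:
      "x \<in> carrier A \<Longrightarrow> y \<in> carrier A \<Longrightarrow> c \<odot> (x \<oplus> y) = (c \<odot> x) \<oplus> (c \<odot> y)"
    and scale_scale: "x \<in> carrier A \<Longrightarrow> c \<odot> (d \<odot> x) = (c * d) \<odot> x"
    and scale_one: "x \<in> carrier A \<Longrightarrow> 1 \<odot> x = x"
    and scale_mult_left:
      "x \<in> carrier A \<Longrightarrow> y \<in> carrier A \<Longrightarrow> c \<odot> (x \<otimes> y) = (c \<odot> x) \<otimes> y"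
    and scale_mult_right:
      "x \<in> carrier A \<Longrightarrow> y \<in> carrier A \<Longrightarrow> c \<odot> (x \<otimes> y) = x \<otimes> (c \<odot> y)"

text \<open>
  The library locale \<open>module\<close> requires a commutative base ring. As there, the fields
  \<open>mult\<close> and \<open>one\<close> of the record \<open>M\<close> play no role.
\<close>

locale left_module = R?: ring R + M?: abelian_group M
  for R :: "('a, 'r) ring_scheme" (structure) and M :: "('a, 'u) module" (structure) +
  assumes lsmult_closed: "r \<in> carrier R \<Longrightarrow> x \<in> carrier M \<Longrightarrow> r \<odot>\<^bsub>M\<^esub> x \<in> carrier M"
    and lsmult_l_distr: "r \<in> carrier R \<Longrightarrow> s \<in> carrier R \<Longrightarrow> x \<in> carrier M \<Longrightarrow>
      (r \<oplus> s) \<odot>\<^bsub>M\<^esub> x = (r \<odot>\<^bsub>M\<^esub> x) \<oplus>\<^bsub>M\<^esub> (s \<odot>\<^bsub>M\<^esub> x)"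
    and lsmult_r_distr: "r \<in> carrier R \<Longrightarrow> x \<in> carrier M \<Longrightarrow> y \<in> carrier M \<Longrightarrow>
      r \<odot>\<^bsub>M\<^esub> (x \<oplus>\<^bsub>M\<^esub> y) = (r \<odot>\<^bsub>M\<^esub> x) \<oplus>\<^bsub>M\<^esub> (r \<odot>\<^bsub>M\<^esub> y)"
    and lsmult_assoc: "r \<in> carrier R \<Longrightarrow> s \<in> carrier R \<Longrightarrow> x \<in> carrier M \<Longrightarrow>
      (r \<otimes> s) \<odot>\<^bsub>M\<^esub> x = r \<odot>\<^bsub>M\<^esub> (s \<odot>\<^bsub>M\<^esub> x)"
    and lsmult_one: "x \<in> carrier M \<Longrightarrow> \<one> \<odot>\<^bsub>M\<^esub> x = x"

text \<open>
  Homomorphisms are extensional, so that equality of morphisms is equality in HOL.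
\<close>

definition left_module_hom ::
    "('a, 'r) ring_scheme \<Rightarrow> ('a, 'u) module \<Rightarrow> ('a, 'u) module \<Rightarrow> ('u \<Rightarrow> 'u) set" where
  "left_module_hom R M N = {f \<in> carrier M \<rightarrow>\<^sub>E carrier N.
     (\<forall>x\<in>carrier M. \<forall>y\<in>carrier M. f (x \<oplus>\<^bsub>M\<^esub> y) = f x \<oplus>\<^bsub>N\<^esub> f y) \<and>
     (\<forall>r\<in>carrier R. \<forall>x\<in>carrier M. f (r \<odot>\<^bsub>M\<^esub> x) = r \<odot>\<^bsub>N\<^esub> f x)}"


section \<open>Linear categories and their equivalence\<close>

text \<open>
  Composition, addition and scaling of morphisms take the objects involved as additional
  arguments, because morphisms need not determine their source and target:
  \<open>lc_comp C X Y Z g f\<close> is the composite of \<open>f : X \<rightarrow> Y\<close> and \<open>g : Y \<rightarrow> Z\<close>.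
\<close>

record ('o, 'm, 'k) lin_cat =
  lc_obj :: "'o set"
  lc_hom :: "'o \<Rightarrow> 'o \<Rightarrow> 'm set"
  lc_id :: "'o \<Rightarrow> 'm"
  lc_comp :: "'o \<Rightarrow> 'o \<Rightarrow> 'o \<Rightarrow> 'm \<Rightarrow> 'm \<Rightarrow> 'm"
  lc_add :: "'o \<Rightarrow> 'o \<Rightarrow> 'm \<Rightarrow> 'm \<Rightarrow> 'm"
  lc_scale :: "'o \<Rightarrow> 'o \<Rightarrow> 'k \<Rightarrow> 'm \<Rightarrow> 'm"

locale linear_category =
  fixes C :: "('o, 'm, 'k::field) lin_cat"
  assumes id_hom: "X \<in> lc_obj C \<Longrightarrow> lc_id C X \<in> lc_hom C X X"
    and comp_hom: "X \<in> lc_obj C \<Longrightarrow> Y \<in> lc_obj C \<Longrightarrow> Z \<in> lc_obj C \<Longrightarrow>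
      f \<in> lc_hom C X Y \<Longrightarrow> g \<in> lc_hom C Y Z \<Longrightarrow> lc_comp C X Y Z g f \<in> lc_hom C X Z"
    and comp_id: "X \<in> lc_obj C \<Longrightarrow> Y \<in> lc_obj C \<Longrightarrow> f \<in> lc_hom C X Y \<Longrightarrow>
      lc_comp C X X Y f (lc_id C X) = f"
    and id_comp: "X \<in> lc_obj C \<Longrightarrow> Y \<in> lc_obj C \<Longrightarrow> f \<in> lc_hom C X Y \<Longrightarrow>
      lc_comp C X Y Y (lc_id C Y) f = f"
    and comp_assoc: "W \<in> lc_obj C \<Longrightarrow> X \<in> lc_obj C \<Longrightarrow> Y \<in> lc_obj C \<Longrightarrow> Z \<in> lc_obj C \<Longrightarrow>
      f \<in> lc_hom C W X \<Longrightarrow> g \<in> lc_hom C X Y \<Longrightarrow> h \<in> lc_hom C Y Z \<Longrightarrow>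
      lc_comp C W Y Z h (lc_comp C W X Y g f) = lc_comp C W X Z (lc_comp C X Y Z h g) f"
    and hom_module: "X \<in> lc_obj C \<Longrightarrow> Y \<in> lc_obj C \<Longrightarrow> \<exists>z.
      module (type_ring :: 'k ring)
        \<lparr>carrier = lc_hom C X Y, monoid.mult = undefined, one = undefined, zero = z,
         add = lc_add C X Y, smult = lc_scale C X Y\<rparr>"
    and comp_add_left: "X \<in> lc_obj C \<Longrightarrow> Y \<in> lc_obj C \<Longrightarrow> Z \<in> lc_obj C \<Longrightarrow>
      f \<in> lc_hom C X Y \<Longrightarrow> g \<in> lc_hom C Y Z \<Longrightarrow> g' \<in> lc_hom C Y Z \<Longrightarrow>
      lc_comp C X Y Z (lc_add C Y Z g g') f =
      lc_add C X Z (lc_comp C X Y Z g f) (lc_comp C X Y Z g' f)"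
    and comp_add_right: "X \<in> lc_obj C \<Longrightarrow> Y \<in> lc_obj C \<Longrightarrow> Z \<in> lc_obj C \<Longrightarrow>
      f \<in> lc_hom C X Y \<Longrightarrow> f' \<in> lc_hom C X Y \<Longrightarrow> g \<in> lc_hom C Y Z \<Longrightarrow>
      lc_comp C X Y Z g (lc_add C X Y f f') =
      lc_add C X Z (lc_comp C X Y Z g f) (lc_comp C X Y Z g f')"
    and comp_scale_left: "X \<in> lc_obj C \<Longrightarrow> Y \<in> lc_obj C \<Longrightarrow> Z \<in> lc_obj C \<Longrightarrow>
      f \<in> lc_hom C X Y \<Longrightarrow> g \<in> lc_hom C Y Z \<Longrightarrow>
      lc_comp C X Y Z (lc_scale C Y Z c g) f = lc_scale C X Z c (lc_comp C X Y Z g f)"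
    and comp_scale_right: "X \<in> lc_obj C \<Longrightarrow> Y \<in> lc_obj C \<Longrightarrow> Z \<in> lc_obj C \<Longrightarrow>
      f \<in> lc_hom C X Y \<Longrightarrow> g \<in> lc_hom C Y Z \<Longrightarrow>
      lc_comp C X Y Z g (lc_scale C X Y c f) = lc_scale C X Z c (lc_comp C X Y Z g f)"

definition lc_iso :: "('o, 'm, 'k) lin_cat \<Rightarrow> 'o \<Rightarrow> 'o \<Rightarrow> 'm \<Rightarrow> bool" where
  "lc_iso C X Y f \<longleftrightarrow> f \<in> lc_hom C X Y \<and>
     (\<exists>g\<in>lc_hom C Y X. lc_comp C X Y X g f = lc_id C X \<and> lc_comp C Y X Y f g = lc_id C Y)"

definition lin_functor ::
    "('o, 'm, 'k) lin_cat \<Rightarrow> ('p, 'n, 'k) lin_cat \<Rightarrow>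
     ('o \<Rightarrow> 'p) \<Rightarrow> ('o \<Rightarrow> 'o \<Rightarrow> 'm \<Rightarrow> 'n) \<Rightarrow> bool" where
  "lin_functor C D Fo Fm \<longleftrightarrow>
     (\<forall>X\<in>lc_obj C. Fo X \<in> lc_obj D) \<and>
     (\<forall>X\<in>lc_obj C. \<forall>Y\<in>lc_obj C. \<forall>f\<in>lc_hom C X Y. Fm X Y f \<in> lc_hom D (Fo X) (Fo Y)) \<and>
     (\<forall>X\<in>lc_obj C. Fm X X (lc_id C X) = lc_id D (Fo X)) \<and>
     (\<forall>X\<in>lc_obj C. \<forall>Y\<in>lc_obj C. \<forall>Z\<in>lc_obj C. \<forall>f\<in>lc_hom C X Y. \<forall>g\<in>lc_hom C Y Z.
        Fm X Z (lc_comp C X Y Z g f) = lc_comp D (Fo X) (Fo Y) (Fo Z) (Fm Y Z g) (Fm X Y f)) \<and>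
     (\<forall>X\<in>lc_obj C. \<forall>Y\<in>lc_obj C. \<forall>f\<in>lc_hom C X Y. \<forall>g\<in>lc_hom C X Y.
        Fm X Y (lc_add C X Y f g) = lc_add D (Fo X) (Fo Y) (Fm X Y f) (Fm X Y g)) \<and>
     (\<forall>X\<in>lc_obj C. \<forall>Y\<in>lc_obj C. \<forall>c. \<forall>f\<in>lc_hom C X Y.
        Fm X Y (lc_scale C X Y c f) = lc_scale D (Fo X) (Fo Y) c (Fm X Y f))"

definition naturally_isomorphic ::
    "('o, 'm, 'k) lin_cat \<Rightarrow> ('p, 'n, 'k) lin_cat \<Rightarrow>
     ('o \<Rightarrow> 'p) \<Rightarrow> ('o \<Rightarrow> 'o \<Rightarrow> 'm \<Rightarrow> 'n) \<Rightarrow> ('o \<Rightarrow> 'p) \<Rightarrow> ('o \<Rightarrow> 'o \<Rightarrow> 'm \<Rightarrow> 'n) \<Rightarrow> bool" where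
  "naturally_isomorphic C D Fo Fm Go Gm \<longleftrightarrow> (\<exists>\<eta>.
     (\<forall>X\<in>lc_obj C. lc_iso D (Fo X) (Go X) (\<eta> X)) \<and>
     (\<forall>X\<in>lc_obj C. \<forall>Y\<in>lc_obj C. \<forall>f\<in>lc_hom C X Y.
        lc_comp D (Fo X) (Fo Y) (Go Y) (\<eta> Y) (Fm X Y f) =
        lc_comp D (Fo X) (Go X) (Go Y) (Gm X Y f) (\<eta> X)))"

definition lin_equivalent ::
    "('o, 'm, 'k) lin_cat \<Rightarrow> ('p, 'n, 'k) lin_cat \<Rightarrow> bool" where
  "lin_equivalent C D \<longleftrightarrow> (\<exists>Fo Fm Go Gm.
     lin_functor C D Fo Fm \<and> lin_functor D C Go Gm \<and>
     naturally_isomorphic C C (\<lambda>X. X) (\<lambda>X Y f. f)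
       (\<lambda>X. Go (Fo X)) (\<lambda>X Y f. Gm (Fo X) (Fo Y) (Fm X Y f)) \<and>
     naturally_isomorphic D D (\<lambda>X. Fo (Go X)) (\<lambda>X Y f. Fm (Go X) (Go Y) (Gm X Y f))
       (\<lambda>X. X) (\<lambda>X Y f. f))"


section \<open>Morita equivalence\<close>

text \<open>
  The linear category of all left modules over \<open>A\<close> whose underlying set is contained in the
  type \<open>'u\<close>. As there is no type of all modules, \<open>'u\<close> plays the role of the universe of sets.
\<close>

definition left_modules ::
    "'u itself \<Rightarrow> ('k, 'a) module \<Rightarrow> (('a, 'u) module, 'u \<Rightarrow> 'u, 'k) lin_cat" where
  "left_modules U A = \<lparr>
     lc_obj = {M. left_module A M},
     lc_hom = left_module_hom A,
     lc_id = (\<lambda>M. \<lambda>x\<in>carrier M. x),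
     lc_comp = (\<lambda>M N P g f. compose (carrier M) g f),
     lc_add = (\<lambda>M N f g. \<lambda>x\<in>carrier M. f x \<oplus>\<^bsub>N\<^esub> g x),
     lc_scale = (\<lambda>M N c f. \<lambda>x\<in>carrier M. (c \<odot>\<^bsub>A\<^esub> \<one>\<^bsub>A\<^esub>) \<odot>\<^bsub>N\<^esub> f x) \<rparr>"

text \<open>
  The universe \<open>'u\<close> has to be large enough to contain the modules of interest. For nonzero
  algebras of at most countable dimension over an infinite field \<open>'k\<close>, an injection
  \<open>'k \<Rightarrow> 'u\<close> suffices: \<open>'u\<close> then contains copies of all countably generated modules, in
  particular of the regular module and of all finitely generated ones.
\<close>

definition morita_equivalent ::
    "'u itself \<Rightarrow> ('k, 'a) module \<Rightarrow> ('k, 'b) module \<Rightarrow> bool" where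
  "morita_equivalent U A B \<longleftrightarrow> lin_equivalent (left_modules U A) (left_modules U B)"


section \<open>Generalized Weyl algebras\<close>

datatype gwa_gen = Gen_h | Gen_x | Gen_y

text \<open>
  A separate type of words, since a finitely supported function on it then carries the
  convolution product of the library once words form an additively written monoid.
\<close>

datatype gwa_word = Word "gwa_gen list"

instantiation gwa_word :: monoid_add
begin

definition zero_gwa_word :: gwa_word where
  "0 = Word []"

fun plus_gwa_word :: "gwa_word \<Rightarrow> gwa_word \<Rightarrow> gwa_word" where
  "Word u + Word v = Word (u @ v)"

instance
proof
  fix a b c :: gwa_word
  show "a + b + c = a + (b + c)"
    by (cases a; cases b; cases c) simp
  show "0 + a = a" "a + 0 = a"
    by (cases a; simp add: zero_gwa_word_def)+
qed

end

text \<open>The free associative algebra on the three generators.\<close>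

type_synonym 'k gwa_free = "gwa_word \<Rightarrow>\<^sub>0 'k"

definition gwa_gen :: "gwa_gen \<Rightarrow> 'k::field gwa_free" where
  "gwa_gen g = Poly_Mapping.single (Word [g]) 1"

definition gwa_scalar :: "'k::field \<Rightarrow> 'k gwa_free" where
  "gwa_scalar c = Poly_Mapping.single 0 c"

definition gwa_poly :: "'k::field poly \<Rightarrow> 'k gwa_free" where
  "gwa_poly p = (\<Sum>i\<le>degree p. gwa_scalar (coeff p i) * gwa_gen Gen_h ^ i)"

definition gwa_relations :: "'k::field poly \<Rightarrow> 'k gwa_free set" where
  "gwa_relations a = (let h = gwa_gen Gen_h; x = gwa_gen Gen_x; y = gwa_gen Gen_y in
     {x * h - (h - 1) * x,
      y * h - (h + 1) * y,
      y * x - gwa_poly a,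
      x * y - gwa_poly (pcompose a [:-1, 1:])})"

definition gwa_ideal :: "'k::field poly \<Rightarrow> 'k gwa_free set" where
  "gwa_ideal a = genideal type_ring (gwa_relations a)"

definition gwa :: "'k::field poly \<Rightarrow> ('k, 'k gwa_free set) module" where
  "gwa a = (let F = type_ring; I = gwa_ideal a in
     ring.extend (F Quot I)
       (module.fields (\<lambda>c u. (I +>\<^bsub>F\<^esub> gwa_scalar c) \<otimes>\<^bsub>F Quot I\<^esub> u)))"

section \<open>Well-formedness of the definitions\<close>

lemma (in k_algebra) central_scalar:
  assumes "r \<in> carrier A"
  shows "(c \<odot> \<one>) \<otimes> r = c \<odot> r" "r \<otimes> (c \<odot> \<one>) = c \<odot> r"
  using assms scale_mult_left[of \<one> r c] scale_mult_right[of r \<one> c] by simp_all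

lemma (in left_module) lsmult_zero:
  assumes "r \<in> carrier R" shows "r \<odot>\<^bsub>M\<^esub> \<zero>\<^bsub>M\<^esub> = \<zero>\<^bsub>M\<^esub>"
proof -
  have z: "r \<odot>\<^bsub>M\<^esub> \<zero>\<^bsub>M\<^esub> \<in> carrier M" using assms lsmult_closed by simp
  have "r \<odot>\<^bsub>M\<^esub> \<zero>\<^bsub>M\<^esub> \<oplus>\<^bsub>M\<^esub> r \<odot>\<^bsub>M\<^esub> \<zero>\<^bsub>M\<^esub> = r \<odot>\<^bsub>M\<^esub> \<zero>\<^bsub>M\<^esub>"
    using lsmult_r_distr[of r "\<zero>\<^bsub>M\<^esub>" "\<zero>\<^bsub>M\<^esub>"] assms by simp
  then show ?thesis using z by (metis M.add.r_cancel_one')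
qed

lemma (in left_module) lsmult_neg:
  assumes "r \<in> carrier R" "x \<in> carrier M"
  shows "r \<odot>\<^bsub>M\<^esub> (\<ominus>\<^bsub>M\<^esub> x) = \<ominus>\<^bsub>M\<^esub> (r \<odot>\<^bsub>M\<^esub> x)"
proof -
  have "r \<odot>\<^bsub>M\<^esub> (\<ominus>\<^bsub>M\<^esub> x) \<oplus>\<^bsub>M\<^esub> r \<odot>\<^bsub>M\<^esub> x = \<zero>\<^bsub>M\<^esub>"
    using assms lsmult_r_distr[of r "\<ominus>\<^bsub>M\<^esub> x" x] by (simp add: M.l_neg lsmult_zero)
  then show ?thesis using assms lsmult_closed by (metis M.a_inv_closed M.minus_equality)
qed

lemma left_module_homD:
  assumes "f \<in> left_module_hom R M N"
  shows "f \<in> extensional (carrier M)" "x \<in> carrier M \<Longrightarrow> f x \<in> carrier N"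
    "x \<in> carrier M \<Longrightarrow> y \<in> carrier M \<Longrightarrow> f (x \<oplus>\<^bsub>M\<^esub> y) = f x \<oplus>\<^bsub>N\<^esub> f y"
    "r \<in> carrier R \<Longrightarrow> x \<in> carrier M \<Longrightarrow> f (r \<odot>\<^bsub>M\<^esub> x) = r \<odot>\<^bsub>N\<^esub> f x"
  using assms by (auto simp: left_module_hom_def PiE_def)

lemma left_modules_hom_module:
  fixes A :: "('k::field, 'a) module" and M N :: "('a, 'u) module"
  assumes A: "k_algebra A" and M: "left_module A M" and N: "left_module A N"
  shows "module (type_ring :: 'k ring)
    \<lparr>carrier = left_module_hom A M N, monoid.mult = undefined, one = undefined,
     zero = (\<lambda>x\<in>carrier M. \<zero>\<^bsub>N\<^esub>),
     add = (\<lambda>f g. \<lambda>x\<in>carrier M. f x \<oplus>\<^bsub>N\<^esub> g x),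
     smult = (\<lambda>c f. \<lambda>x\<in>carrier M. (c \<odot>\<^bsub>A\<^esub> \<one>\<^bsub>A\<^esub>) \<odot>\<^bsub>N\<^esub> f x)\<rparr>"
proof -
  interpret A: k_algebra A by fact
  interpret M: left_module A M by fact
  interpret N: left_module A N by fact
  have sc: "c \<odot>\<^bsub>A\<^esub> \<one>\<^bsub>A\<^esub> \<in> carrier A" for c using A.scale_closed by simp
  have swap: "(c \<odot>\<^bsub>A\<^esub> \<one>\<^bsub>A\<^esub>) \<odot>\<^bsub>N\<^esub> (r \<odot>\<^bsub>N\<^esub> x) = r \<odot>\<^bsub>N\<^esub> ((c \<odot>\<^bsub>A\<^esub> \<one>\<^bsub>A\<^esub>) \<odot>\<^bsub>N\<^esub> x)"
    if "r \<in> carrier A" "x \<in> carrier N" for c r x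
    using that N.lsmult_assoc[symmetric] sc A.central_scalar by simp
  show ?thesis
  proof (rule moduleI, goal_cases)
    case 1 show ?case by (rule cring_type_ring)
  next
    case 2 show ?case
    proof (rule abelian_groupI, goal_cases)
      case (6 f)
      show ?case
        apply (rule bexI[of _ "\<lambda>x\<in>carrier M. \<ominus>\<^bsub>N\<^esub> f x"])
        using 6 by (auto simp: left_module_hom_def PiE_iff N.M.l_neg N.M.minus_add N.lsmult_neg
            M.lsmult_closed N.lsmult_closed restrict_def fun_eq_iff extensional_def)
    qed (auto simp: left_module_hom_def PiE_iff N.M.a_ac M.lsmult_closed N.lsmult_closed
        N.lsmult_zero N.lsmult_r_distr restrict_def fun_eq_iff extensional_def)
  next
    case (3 c f) then show ?case
      using swap sc by (auto simp: left_module_hom_def PiE_iff M.lsmult_closed N.lsmult_closed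
          N.lsmult_r_distr)
  next
    case (4 c d f) then show ?case
      using N.lsmult_l_distr[OF sc[of c] sc[of d]]
      by (auto simp: type_ring_def A.scale_add_left fun_eq_iff left_module_hom_def PiE_iff)
  next
    case (5 c f g) then show ?case
      using N.lsmult_r_distr[OF sc[of c]]
      by (auto simp: type_ring_def fun_eq_iff left_module_hom_def PiE_iff)
  next
    case (6 c d f)
    have "(c * d) \<odot>\<^bsub>A\<^esub> \<one>\<^bsub>A\<^esub> = (c \<odot>\<^bsub>A\<^esub> \<one>\<^bsub>A\<^esub>) \<otimes>\<^bsub>A\<^esub> (d \<odot>\<^bsub>A\<^esub> \<one>\<^bsub>A\<^esub>)"
      using A.central_scalar(1)[OF sc] by (simp add: A.scale_scale)
    with 6 show ?case
      using N.lsmult_assoc[OF sc[of c] sc[of d]]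
      by (auto simp: type_ring_def fun_eq_iff left_module_hom_def PiE_iff)
  next
    case (7 f) then show ?case
      by (auto simp: type_ring_def A.scale_one N.lsmult_one fun_eq_iff
          left_module_hom_def PiE_iff extensional_def)
  qed
qed

lemma linear_category_left_modules:
  fixes A :: "('k::field, 'a) module"
  assumes "k_algebra A"
  shows "linear_category (left_modules TYPE('u) A)"
proof -
  interpret A: k_algebra A by fact
  have sc: "c \<odot>\<^bsub>A\<^esub> \<one>\<^bsub>A\<^esub> \<in> carrier A" for c using A.scale_closed by simp
  note clo = abelian_monoid.a_closed[OF abelian_group.axioms(1)[OF left_module.axioms(2)]]
    left_module.lsmult_closed
  show ?thesis
  proof (unfold_locales, goal_cases)
    case (6 M N) then show ?case
      using left_modules_hom_module[OF assms, of M N] by (auto simp: left_modules_def)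
  qed (auto simp: left_modules_def left_module_hom_def PiE_iff compose_def fun_eq_iff clo sc
      extensional_def)
qed

lemma k_algebra_gwa: "k_algebra (gwa a)"
proof -
  define F :: "'a gwa_free ring" where "F = type_ring"
  interpret F: ring F unfolding F_def by (rule ring_type_ring)
  have F: "carrier F = UNIV" "monoid.mult F = (*)" "ring.add F = (+)" "monoid.one F = 1" "ring.zero F = 0"
    by (auto simp: F_def type_ring_def)
  interpret I: ideal "gwa_ideal a" F
    unfolding gwa_ideal_def F_def[symmetric] by (rule F.genideal_ideal) (simp add: F)
  define Q where "Q = F Quot gwa_ideal a"
  interpret Q: ring Q unfolding Q_def by (rule I.quotient_is_ring)
  define q where "q = (+>\<^bsub>F\<^esub>) (gwa_ideal a)"
  have hom: "q \<in> Ring.ring_hom F Q" unfolding q_def Q_def by (rule I.rcos_ring_hom)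
  have surj: "\<exists>u. x = q u" if "x \<in> carrier Q" for x
    using that by (auto simp: Q_def q_def FactRing_def A_RCOSETS_def' )
  have qc: "q u \<in> carrier Q" for u using ring_hom_closed[OF hom] by (simp add: F)
  have qm: "q u \<otimes>\<^bsub>Q\<^esub> q v = q (u * v)" and qa: "q u \<oplus>\<^bsub>Q\<^esub> q v = q (u + v)" for u v
    using ring_hom_mult[OF hom, of u v] ring_hom_add[OF hom, of u v] by (simp_all add: F)
  have q1: "\<one>\<^bsub>Q\<^esub> = q 1" using ring_hom_one[OF hom] by (simp add: F)
  have central: "gwa_scalar c * u = u * gwa_scalar c" for c :: 'a and u
  proof (induction u rule: update_induct)
    case const then show ?case by simp
  next
    case (update f w d)
    have "Poly_Mapping.update w d f = Poly_Mapping.single w d + f"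
      using update.hyps by (intro poly_mapping_eqI)
        (auto simp: lookup_update lookup_add lookup_single in_keys_iff when_def)
    then show ?case
      using update.IH by (simp add: distrib_left distrib_right gwa_scalar_def mult_single mult.commute)
  qed
  have sc: "gwa_scalar (c + d) = gwa_scalar c + gwa_scalar d"
    "gwa_scalar (c * d) = gwa_scalar c * gwa_scalar d" "gwa_scalar 1 = 1" for c d :: 'a
    by (simp_all add: gwa_scalar_def single_add mult_single)
  have "gwa a = ring.extend Q (module.fields (\<lambda>c u. q (gwa_scalar c) \<otimes>\<^bsub>Q\<^esub> u))"
    by (simp add: gwa_def Q_def q_def F_def Let_def)
  then have G: "carrier (gwa a) = carrier Q" "monoid.mult (gwa a) = monoid.mult Q"
    "ring.add (gwa a) = ring.add Q" "monoid.one (gwa a) = monoid.one Q"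
    "ring.zero (gwa a) = ring.zero Q"
    "module.smult (gwa a) = (\<lambda>c u. q (gwa_scalar c) \<otimes>\<^bsub>Q\<^esub> u)"
    by (simp_all add: ring.defs module.defs)
  interpret R: ring "gwa a"
  proof (intro ringI abelian_groupI monoidI, goal_cases)
    case (6 x)
    then show ?case using Q.l_neg[of x] Q.a_inv_closed[of x] by (auto simp: G)
  qed (simp_all add: G Q.m_assoc Q.l_distr Q.r_distr Q.a_ac)
  show ?thesis
  proof (unfold_locales, goal_cases)
    case (1 x c)
    then show ?case by (simp add: G qc)
  next
    case (2 x c d)
    then show ?case using Q.l_distr[OF qc qc, of x "gwa_scalar c" "gwa_scalar d"]
      by (simp add: G sc qa)
  next
    case (3 x y c)
    then show ?case by (simp add: G Q.r_distr qc)
  next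
    case (4 x c d)
    then show ?case using Q.m_assoc[OF qc qc, of x "gwa_scalar c" "gwa_scalar d"]
      by (simp add: G sc qm)
  next
    case (5 x)
    then show ?case by (simp add: G sc q1[symmetric])
  next
    case (6 x y c)
    then show ?case by (simp add: G Q.m_assoc qc)
  next
    case (7 x y c)
    then obtain u where "x = q u" using surj by (auto simp: G)
    with 7 have "q (gwa_scalar c) \<otimes>\<^bsub>Q\<^esub> x = x \<otimes>\<^bsub>Q\<^esub> q (gwa_scalar c)" "x \<in> carrier Q" "y \<in> carrier Q"
      by (simp_all add: qm G central)
    then show ?case by (simp add: G Q.m_assoc[symmetric] qc)
  qed
qed

end

(*
  The Hattori-Stallings trace of a finitely generated projective A-module is a class in
  HH_0(A) = A/[A, A], and a Morita equivalence induces an isomorphism of HH_0(A(a)) with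
  HH_0(A(b)) compatible with the traces of corresponding modules. (HH_0 enters below through
  its dual, the trace functionals.) Inverting q(h) |-> q(h) - q(h - 1) identifies HH_0(A(a))
  with k[h]/(k + a k[h]), hence with k^(n-1) by means of q |-> (q(lambda_n) - q(lambda_i))_i.
  Here A(a) itself has trace Lambda, and the projective left ideal A x + A (h - lambda_j) has
  trace Lambda + e_j.

  An equivalence preserves uniform modules, so it sends these modules to projective left ideals
  of A(b), up to isomorphism. The trace of every projective left ideal of A(b) lies in
  Omega + Z^(n-1): its idempotent matrix acts on the functions on mu_i + 1, mu_i + 2, ...; far
  from the boundary this action agrees with that of an idempotent of rank one over the skew field
  of fractions, so the difference of the two is an idempotent of finite rank and has integral
  trace, while the contribution of the far end is one rational function for all i. Hence the
  isomorphism k^(n-1) -> k^(n-1) and its inverse have integral matrices, and it maps Lambda into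
  Omega + Z^(n-1).
*)
theory Submission
  imports Defs
begin

section \<open>Traces in linear categories\<close>

definition lc_zero :: "('o, 'm, 'k::field) lin_cat \<Rightarrow> 'o \<Rightarrow> 'o \<Rightarrow> 'm" where
  "lc_zero C X Y = lc_scale C X Y 0 (SOME f. f \<in> lc_hom C X Y)"

definition lc_sum :: "('o, 'm, 'k::field) lin_cat \<Rightarrow> 'o \<Rightarrow> 'o \<Rightarrow> 'm list \<Rightarrow> 'm" where
  "lc_sum C X Y fs = foldr (lc_add C X Y) fs (lc_zero C X Y)"

definition lc_functional :: "('o, 'm, 'k::field) lin_cat \<Rightarrow> 'o \<Rightarrow> ('m \<Rightarrow> 'k) \<Rightarrow> bool" where
  "lc_functional C P \<phi> \<longleftrightarrow>
     (\<forall>f\<in>lc_hom C P P. \<forall>g\<in>lc_hom C P P. \<phi> (lc_add C P P f g) = \<phi> f + \<phi> g) \<and>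
     (\<forall>c. \<forall>f\<in>lc_hom C P P. \<phi> (lc_scale C P P c f) = c * \<phi> f)"

definition trace_functional :: "('o, 'm, 'k::field) lin_cat \<Rightarrow> 'o \<Rightarrow> ('m \<Rightarrow> 'k) \<Rightarrow> bool" where
  "trace_functional C P \<phi> \<longleftrightarrow> lc_functional C P \<phi> \<and>
     (\<forall>f\<in>lc_hom C P P. \<forall>g\<in>lc_hom C P P.
        \<phi> (lc_comp C P P P f g) = \<phi> (lc_comp C P P P g f))"

text \<open>
  A decomposition of the identity of \<open>X\<close> exhibits \<open>X\<close> as a retract of a finite power of \<open>P\<close>.
\<close>

definition decomposition ::
    "('o, 'm, 'k::field) lin_cat \<Rightarrow> 'o \<Rightarrow> 'o \<Rightarrow> ('m \<times> 'm) list \<Rightarrow> bool" where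
  "decomposition C P X ps \<longleftrightarrow> set ps \<subseteq> lc_hom C P X \<times> lc_hom C X P \<and>
     lc_sum C X X (map (\<lambda>(u, v). lc_comp C X P X u v) ps) = lc_id C X"

text \<open>The Hattori--Stallings trace of an endomorphism \<open>f\<close> of \<open>X\<close>, seen through \<open>\<phi>\<close>.\<close>

definition hs_trace ::
    "('o, 'm, 'k::field) lin_cat \<Rightarrow> 'o \<Rightarrow> 'o \<Rightarrow> ('m \<times> 'm) list \<Rightarrow> ('m \<Rightarrow> 'k) \<Rightarrow> 'm \<Rightarrow> 'k" where
  "hs_trace C P X ps \<phi> f =
     (\<Sum>(u, v)\<leftarrow>ps. \<phi> (lc_comp C P X P v (lc_comp C P X X f u)))"

definition separating :: "('o, 'm, 'k::field) lin_cat \<Rightarrow> 'o \<Rightarrow> bool" where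
  "separating C P \<longleftrightarrow> (\<forall>X\<in>lc_obj C. \<forall>Y\<in>lc_obj C. \<forall>f\<in>lc_hom C X Y. \<forall>g\<in>lc_hom C X Y.
     (\<forall>h\<in>lc_hom C P X. lc_comp C P X Y f h = lc_comp C P X Y g h) \<longrightarrow> f = g)"

definition uniform :: "('o, 'm, 'k::field) lin_cat \<Rightarrow> 'o \<Rightarrow> 'o \<Rightarrow> bool" where
  "uniform C P X \<longleftrightarrow> lc_id C X \<noteq> lc_zero C X X \<and>
     (\<forall>f\<in>lc_hom C P X. \<forall>g\<in>lc_hom C P X. f \<noteq> lc_zero C P X \<longrightarrow> g \<noteq> lc_zero C P X \<longrightarrow>
       (\<exists>f'\<in>lc_hom C P P. \<exists>g'\<in>lc_hom C P P.
          lc_comp C P P X f f' = lc_comp C P P X g g' \<and> lc_comp C P P X f f' \<noteq> lc_zero C P X))"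

context linear_category
begin

abbreviation "Ob \<equiv> lc_obj C"
abbreviation "Hom \<equiv> lc_hom C"

lemma hom_module_zero:
  assumes "X \<in> Ob" "Y \<in> Ob"
  shows "module (type_ring :: 'k ring)
    \<lparr>carrier = Hom X Y, monoid.mult = undefined, one = undefined, zero = lc_zero C X Y,
     add = lc_add C X Y, smult = lc_scale C X Y\<rparr>"
proof -
  obtain z where z: "module (type_ring :: 'k ring)
    \<lparr>carrier = Hom X Y, monoid.mult = undefined, one = undefined, zero = z,
     add = lc_add C X Y, smult = lc_scale C X Y\<rparr>"
    using hom_module[OF assms] by blast
  interpret M: module "type_ring :: 'k ring"
    "\<lparr>carrier = Hom X Y, monoid.mult = undefined, one = undefined, zero = z,
     add = lc_add C X Y, smult = lc_scale C X Y\<rparr>" by (rule z)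
  have "z \<in> Hom X Y" using M.M.zero_closed by simp
  then have "(SOME f. f \<in> Hom X Y) \<in> Hom X Y" by (rule someI)
  then have "lc_zero C X Y = z"
    using M.smult_l_null by (simp add: lc_zero_def type_ring_def)
  with z show ?thesis by simp
qed

context
  fixes X Y assumes X: "X \<in> Ob" and Y: "Y \<in> Ob"
begin

interpretation M: module "type_ring :: 'k ring"
    "\<lparr>carrier = Hom X Y, monoid.mult = undefined, one = undefined, zero = lc_zero C X Y,
     add = lc_add C X Y, smult = lc_scale C X Y\<rparr>" by (rule hom_module_zero[OF X Y])

lemma zero_hom: "lc_zero C X Y \<in> Hom X Y"
  using M.M.zero_closed by simp

lemma add_hom: "f \<in> Hom X Y \<Longrightarrow> g \<in> Hom X Y \<Longrightarrow> lc_add C X Y f g \<in> Hom X Y"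
  using M.M.a_closed by simp

lemma scale_hom: "f \<in> Hom X Y \<Longrightarrow> lc_scale C X Y c f \<in> Hom X Y"
  using M.smult_closed by (simp add: type_ring_def)

lemma add_assoc: "f \<in> Hom X Y \<Longrightarrow> g \<in> Hom X Y \<Longrightarrow> h \<in> Hom X Y \<Longrightarrow>
    lc_add C X Y (lc_add C X Y f g) h = lc_add C X Y f (lc_add C X Y g h)"
  using M.M.a_assoc by simp

lemma zero_add: "f \<in> Hom X Y \<Longrightarrow> lc_add C X Y (lc_zero C X Y) f = f"
  using M.M.l_zero by simp

lemma add_zero: "f \<in> Hom X Y \<Longrightarrow> lc_add C X Y f (lc_zero C X Y) = f"
  using M.M.r_zero by simp

lemma scale_zero: "f \<in> Hom X Y \<Longrightarrow> lc_scale C X Y 0 f = lc_zero C X Y"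
  using M.smult_l_null by (simp add: type_ring_def)

lemma add_self_zero: "f \<in> Hom X Y \<Longrightarrow> lc_add C X Y f f = f \<Longrightarrow> f = lc_zero C X Y"
  using M.M.add.r_cancel_one' by fastforce

lemma lc_sum_hom: "set fs \<subseteq> Hom X Y \<Longrightarrow> lc_sum C X Y fs \<in> Hom X Y"
  unfolding lc_sum_def by (induction fs) (auto simp: zero_hom add_hom)

lemma lc_sum_Nil: "lc_sum C X Y [] = lc_zero C X Y"
  and lc_sum_Cons: "lc_sum C X Y (f # fs) = lc_add C X Y f (lc_sum C X Y fs)"
  by (simp_all add: lc_sum_def)

lemma lc_sum_append: "set fs \<subseteq> Hom X Y \<Longrightarrow> set gs \<subseteq> Hom X Y \<Longrightarrow>
    lc_sum C X Y (fs @ gs) = lc_add C X Y (lc_sum C X Y fs) (lc_sum C X Y gs)"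
  by (induction fs) (auto simp: lc_sum_Nil lc_sum_Cons zero_add add_assoc lc_sum_hom)

end

lemma comp_zero:
  assumes "X \<in> Ob" "Y \<in> Ob" "Z \<in> Ob" "g \<in> Hom Y Z"
  shows "lc_comp C X Y Z g (lc_zero C X Y) = lc_zero C X Z"
  using comp_scale_right[OF assms(1-3) zero_hom[OF assms(1,2)] assms(4), of 0] assms
  by (simp add: scale_zero zero_hom comp_hom)

lemma zero_comp:
  assumes "X \<in> Ob" "Y \<in> Ob" "Z \<in> Ob" "f \<in> Hom X Y"
  shows "lc_comp C X Y Z (lc_zero C Y Z) f = lc_zero C X Z"
  using comp_scale_left[OF assms(1-3) assms(4) zero_hom[OF assms(2,3)], of 0] assms
  by (simp add: scale_zero zero_hom comp_hom)

lemma comp_lc_sum: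
  assumes "X \<in> Ob" "Y \<in> Ob" "Z \<in> Ob" "g \<in> Hom Y Z" "set fs \<subseteq> Hom X Y"
  shows "lc_comp C X Y Z g (lc_sum C X Y fs) = lc_sum C X Z (map (lc_comp C X Y Z g) fs)"
  using assms(5) by (induction fs)
    (simp_all add: assms(1-4) lc_sum_Nil lc_sum_Cons comp_zero comp_add_right lc_sum_hom)

lemma lc_sum_comp:
  assumes "X \<in> Ob" "Y \<in> Ob" "Z \<in> Ob" "f \<in> Hom X Y" "set gs \<subseteq> Hom Y Z"
  shows "lc_comp C X Y Z (lc_sum C Y Z gs) f = lc_sum C X Z (map (\<lambda>g. lc_comp C X Y Z g f) gs)"
  using assms(5) by (induction gs)
    (simp_all add: assms(1-4) lc_sum_Nil lc_sum_Cons zero_comp comp_add_left lc_sum_hom)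

lemma functional_zero:
  assumes "lc_functional C P \<phi>" "P \<in> Ob"
  shows "\<phi> (lc_zero C P P) = 0"
  using assms zero_hom[of P P] scale_zero[of P P "lc_zero C P P"]
  unfolding lc_functional_def by (metis mult_zero_left)

lemma functional_lc_sum:
  assumes "lc_functional C P \<phi>" "P \<in> Ob" "set fs \<subseteq> Hom P P"
  shows "\<phi> (lc_sum C P P fs) = (\<Sum>f\<leftarrow>fs. \<phi> f)"
  using assms(3) assms(1,2) by (induction fs)
    (simp_all add: lc_sum_Nil lc_sum_Cons functional_zero lc_functional_def lc_sum_hom)

lemma sum_list_swap:
  "(\<Sum>x\<leftarrow>xs. \<Sum>y\<leftarrow>ys. f x y) = (\<Sum>y\<leftarrow>ys. \<Sum>x\<leftarrow>xs. f x y :: 'z :: comm_monoid_add)"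
  by (induction xs) (simp_all add: sum_list_addf)

lemma functional_insert_decomposition:
  assumes "lc_functional C P \<phi>" "P \<in> Ob" "X \<in> Ob" "Q \<in> Ob" "decomposition C Q X ps"
    "f \<in> Hom P X" "g \<in> Hom X P"
  shows "\<phi> (lc_comp C P X P g f) =
    (\<Sum>(u, v)\<leftarrow>ps. \<phi> (lc_comp C P Q P (lc_comp C Q X P g u) (lc_comp C P X Q v f)))"
proof -
  have ps: "(u, v) \<in> set ps \<Longrightarrow> u \<in> Hom Q X \<and> v \<in> Hom X Q" for u v
    using assms(5) by (auto simp: decomposition_def)
  let ?cs = "map (\<lambda>(u, v). lc_comp C X Q X u v) ps"
  have cs: "set ?cs \<subseteq> Hom X X" using ps assms by (auto intro: comp_hom)
  have "f = lc_comp C P X X (lc_sum C X X ?cs) f"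
    using assms by (simp add: decomposition_def id_comp)
  then have "f = lc_sum C P X (map (\<lambda>g. lc_comp C P X X g f) ?cs)"
    using lc_sum_comp[of P X X f ?cs] cs assms by simp
  moreover have "set (map (\<lambda>g. lc_comp C P X X g f) ?cs) \<subseteq> Hom P X"
    using cs assms by (auto intro: comp_hom)
  ultimately have 1: "lc_comp C P X P g f = lc_sum C P P
      (map (lc_comp C P X P g) (map (\<lambda>g. lc_comp C P X X g f) ?cs))"
    using comp_lc_sum[of P X P g] assms by metis
  have 2: "\<phi> (lc_sum C P P (map (lc_comp C P X P g) (map (\<lambda>g. lc_comp C P X X g f) ?cs))) =
      (\<Sum>h\<leftarrow>map (lc_comp C P X P g) (map (\<lambda>g. lc_comp C P X X g f) ?cs). \<phi> h)"
    using cs assms by (intro functional_lc_sum) (auto dest!: ps intro!: comp_hom)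
  have 3: "(\<Sum>h\<leftarrow>map (lc_comp C P X P g) (map (\<lambda>g. lc_comp C P X X g f) ?cs). \<phi> h) =
      (\<Sum>(u, v)\<leftarrow>ps. \<phi> (lc_comp C P Q P (lc_comp C Q X P g u) (lc_comp C P X Q v f)))"
    unfolding map_map
  proof (rule arg_cong[where f = sum_list], rule map_cong[OF refl], clarsimp)
    fix u v assume "(u, v) \<in> set ps"
    with ps have "u \<in> Hom Q X" "v \<in> Hom X Q" by auto
    with assms show "\<phi> (lc_comp C P X P g (lc_comp C P X X (lc_comp C X Q X u v) f)) =
      \<phi> (lc_comp C P Q P (lc_comp C Q X P g u) (lc_comp C P X Q v f))"
      by (simp add: comp_assoc[symmetric] comp_hom)
  qed
  show ?thesis unfolding 1 by (rule trans[OF 2 3])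
qed

lemma hs_trace_commute:
  assumes "trace_functional C P \<phi>" "P \<in> Ob" "X \<in> Ob" "Y \<in> Ob"
    "decomposition C P X ps" "decomposition C P Y qs" "f \<in> Hom X Y" "g \<in> Hom Y X"
  shows "hs_trace C P Y qs \<phi> (lc_comp C Y X Y f g) = hs_trace C P X ps \<phi> (lc_comp C X Y X g f)"
proof -
  have ps: "u \<in> Hom P X \<and> v \<in> Hom X P" if "(u, v) \<in> set ps" for u v
    using assms(5) that by (auto simp: decomposition_def)
  have qs: "u \<in> Hom P Y \<and> v \<in> Hom Y P" if "(u, v) \<in> set qs" for u v
    using assms(6) that by (auto simp: decomposition_def)
  have fn: "lc_functional C P \<phi>" using assms(1) by (simp add: trace_functional_def)
  let ?t = "\<lambda>(u, v) (u', v'). \<phi> (lc_comp C P P P (lc_comp C P X P (lc_comp C X Y P v' f) u)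
              (lc_comp C P X P v (lc_comp C P Y X g u')))"
  let ?t' = "\<lambda>(u, v) (u', v'). \<phi> (lc_comp C P P P (lc_comp C P Y P (lc_comp C Y X P v g) u')
              (lc_comp C P Y P v' (lc_comp C P X Y f u)))"
  have 1: "hs_trace C P Y qs \<phi> (lc_comp C Y X Y f g) = (\<Sum>q\<leftarrow>qs. \<Sum>p\<leftarrow>ps. ?t p q)"
    unfolding hs_trace_def
  proof (rule arg_cong[where f = sum_list], rule map_cong[OF refl], clarify)
    fix u' v' assume "(u', v') \<in> set qs"
    with qs have q: "u' \<in> Hom P Y" "v' \<in> Hom Y P" by auto
    then have "lc_comp C P Y P v' (lc_comp C P Y Y (lc_comp C Y X Y f g) u') =
      lc_comp C P X P (lc_comp C X Y P v' f) (lc_comp C P Y X g u')"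
      using assms by (simp add: comp_assoc[symmetric] comp_hom)
    then show "\<phi> (lc_comp C P Y P v' (lc_comp C P Y Y (lc_comp C Y X Y f g) u')) =
        (\<Sum>p\<leftarrow>ps. ?t p (u', v'))"
      using functional_insert_decomposition[OF fn, of X P ps "lc_comp C P Y X g u'"
          "lc_comp C X Y P v' f"] q assms by (simp add: comp_hom case_prod_unfold)
  qed
  have 2: "(\<Sum>q\<leftarrow>qs. \<Sum>p\<leftarrow>ps. ?t p q) = (\<Sum>q\<leftarrow>qs. \<Sum>p\<leftarrow>ps. ?t' p q)"
  proof (intro arg_cong[where f = sum_list] map_cong refl)
    fix p q assume "p \<in> set ps" "q \<in> set qs"
    moreover obtain u v u' v' where pq: "p = (u, v)" "q = (u', v')" by (cases p; cases q)
    ultimately have m: "u \<in> Hom P X" "v \<in> Hom X P" "u' \<in> Hom P Y" "v' \<in> Hom Y P"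
      using ps qs by auto
    then have "?t (u, v) (u', v') = \<phi> (lc_comp C P P P (lc_comp C P X P v (lc_comp C P Y X g u'))
        (lc_comp C P X P (lc_comp C X Y P v' f) u))"
      using assms unfolding trace_functional_def by (auto simp: comp_hom)
    also have "\<dots> = ?t' (u, v) (u', v')"
      using assms m by (simp add: comp_assoc[symmetric] comp_hom)
    finally show "?t p q = ?t' p q" by (simp add: pq)
  qed
  have 3: "(\<Sum>q\<leftarrow>qs. \<Sum>p\<leftarrow>ps. ?t' p q) = (\<Sum>p\<leftarrow>ps. \<Sum>q\<leftarrow>qs. ?t' p q)"
    by (rule sum_list_swap)
  have 4: "(\<Sum>p\<leftarrow>ps. \<Sum>q\<leftarrow>qs. ?t' p q) = hs_trace C P X ps \<phi> (lc_comp C X Y X g f)"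
    unfolding hs_trace_def
  proof (rule arg_cong[where f = sum_list], rule map_cong[OF refl])
    fix p assume "p \<in> set ps"
    moreover obtain u v where p: "p = (u, v)" by (cases p)
    ultimately have q: "u \<in> Hom P X" "v \<in> Hom X P" using ps by auto
    then have "lc_comp C P X P v (lc_comp C P X X (lc_comp C X Y X g f) u) =
      lc_comp C P Y P (lc_comp C Y X P v g) (lc_comp C P X Y f u)"
      using assms by (simp add: comp_assoc[symmetric] comp_hom)
    then show "(\<Sum>q\<leftarrow>qs. ?t' p q) =
      (case p of (u, v) \<Rightarrow> \<phi> (lc_comp C P X P v (lc_comp C P X X (lc_comp C X Y X g f) u)))"
      using functional_insert_decomposition[OF fn, of Y P qs "lc_comp C P X Y f u"
          "lc_comp C Y X P v g"] q assms by (simp add: p comp_hom case_prod_unfold)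
  qed
  show ?thesis by (rule trans[OF 1 trans[OF 2 trans[OF 3 4]]])
qed

lemma decomposition_self:
  assumes "P \<in> Ob" shows "decomposition C P P [(lc_id C P, lc_id C P)]"
  using assms by (simp add: decomposition_def id_hom lc_sum_Cons lc_sum_Nil comp_id add_zero)

lemma hs_trace_self:
  assumes "P \<in> Ob" "f \<in> Hom P P"
  shows "hs_trace C P P [(lc_id C P, lc_id C P)] \<phi> f = \<phi> f"
  using assms by (simp add: hs_trace_def id_comp comp_id)

definition decomposition_comp :: "'o \<Rightarrow> 'o \<Rightarrow> 'o \<Rightarrow> ('m \<times> 'm) list \<Rightarrow> ('m \<times> 'm) list \<Rightarrow> ('m \<times> 'm) list" where
  "decomposition_comp P Q X qs ps =
     concat (map (\<lambda>(u', v'). map (\<lambda>(u, v). (lc_comp C P Q X u' u, lc_comp C X Q P v v')) ps) qs)"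

lemma decomposition_trans:
  assumes "P \<in> Ob" "Q \<in> Ob" "X \<in> Ob" "decomposition C P Q ps" "decomposition C Q X qs"
  shows "decomposition C P X (decomposition_comp P Q X qs ps)"
proof -
  have ps: "u \<in> Hom P Q \<and> v \<in> Hom Q P" if "(u, v) \<in> set ps" for u v
    using assms(4) that by (auto simp: decomposition_def)
  have qs: "set qs \<subseteq> Hom Q X \<times> Hom X Q"
    using assms(5) by (auto simp: decomposition_def)
  define c where "c = (\<lambda>(u, v). lc_comp C X P X u v)"
  define d where "d = (\<lambda>(u, v). lc_comp C X Q X u v)"
  let ?r = "\<lambda>(u', v'). map (\<lambda>(u, v). (lc_comp C P Q X u' u, lc_comp C X Q P v v')) ps"
  have r: "lc_sum C X X (map c (?r q)) = d q" "set (map c (?r q)) \<subseteq> Hom X X"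
    if q: "q \<in> Hom Q X \<times> Hom X Q" for q
  proof -
    obtain u' v' where q': "q = (u', v')" "u' \<in> Hom Q X" "v' \<in> Hom X Q" using q by auto
    let ?cs = "map (\<lambda>(u, v). lc_comp C Q P Q u v) ps"
    have cs: "set ?cs \<subseteq> Hom Q Q" using ps assms by (auto intro: comp_hom)
    have 1: "map c (?r q) = map (\<lambda>g. lc_comp C X Q X g v') (map (lc_comp C Q Q X u') ?cs)"
      using ps q' assms by (auto simp: c_def comp_assoc[symmetric] comp_hom)
    show "set (map c (?r q)) \<subseteq> Hom X X"
      unfolding 1 using cs q' assms by (auto dest!: ps intro!: comp_hom)
    have "lc_sum C X X (map c (?r q)) = lc_comp C X Q X (lc_sum C Q X (map (lc_comp C Q Q X u') ?cs)) v'"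
      unfolding 1 using cs q' assms by (intro lc_sum_comp[symmetric]) (auto dest!: ps intro!: comp_hom)
    also have "lc_sum C Q X (map (lc_comp C Q Q X u') ?cs) = lc_comp C Q Q X u' (lc_sum C Q Q ?cs)"
      using cs q' assms by (intro comp_lc_sum[symmetric]) auto
    also have "\<dots> = u'" using assms q' by (simp add: decomposition_def comp_id)
    finally show "lc_sum C X X (map c (?r q)) = d q" by (simp add: d_def q')
  qed
  have dX: "set (map d xs) \<subseteq> Hom X X" if "set xs \<subseteq> Hom Q X \<times> Hom X Q" for xs
    using that assms by (auto simp: d_def intro!: comp_hom)
  have cX: "set (map c (concat (map ?r xs))) \<subseteq> Hom X X" if "set xs \<subseteq> Hom Q X \<times> Hom X Q" for xs
    using that by (induction xs) (use r(2) in auto)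
  have "lc_sum C X X (map c (concat (map ?r xs))) = lc_sum C X X (map d xs)"
    if "set xs \<subseteq> Hom Q X \<times> Hom X Q" for xs
    using that
  proof (induction xs)
    case (Cons q xs)
    then show ?case
      using r[of q] cX[of xs] assms
      by (simp add: lc_sum_append lc_sum_Cons del: set_map map_concat)
  qed simp
  then have "lc_sum C X X (map c (decomposition_comp P Q X qs ps)) = lc_id C X"
    using qs assms unfolding decomposition_comp_def d_def by (simp add: decomposition_def)
  moreover have "set (decomposition_comp P Q X qs ps) \<subseteq> Hom P X \<times> Hom X P"
    using ps qs assms by (auto simp: decomposition_comp_def intro!: comp_hom)
  ultimately show ?thesis by (simp add: decomposition_def c_def)
qed

lemma hs_trace_conj:
  assumes "trace_functional C P \<phi>" "P \<in> Ob" "X \<in> Ob" "Y \<in> Ob"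
    "decomposition C P X ps" "decomposition C P Y qs"
    "u \<in> Hom X Y" "v \<in> Hom Y X" "lc_comp C X Y X v u = lc_id C X"
    "f \<in> Hom X X" "g \<in> Hom Y Y" "lc_comp C X Y Y g u = lc_comp C X X Y u f"
    "lc_comp C Y X Y u v = lc_id C Y"
  shows "hs_trace C P Y qs \<phi> g = hs_trace C P X ps \<phi> f"
proof -
  have 1: "lc_comp C Y X Y (lc_comp C X Y Y g u) v = g"
    using comp_assoc[of Y X Y Y v u g] assms(2-4,7,8,11,13) by (simp add: comp_id)
  have 2: "lc_comp C X Y X v (lc_comp C X Y Y g u) = f"
    unfolding assms(12) using comp_assoc[of X X Y X f u v] assms(2-4,7-10) by (simp add: id_comp)
  have "lc_comp C X Y Y g u \<in> Hom X Y" using assms(3,4,7,11) by (simp add: comp_hom)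
  from hs_trace_commute[OF assms(1-6) this assms(8)] show ?thesis unfolding 1 2 .
qed

end

section \<open>Transport of traces along linear equivalences\<close>

locale linear_equivalence = C: linear_category C + D: linear_category D
  for C :: "('o, 'm, 'k::field) lin_cat" and D :: "('p, 'n, 'k) lin_cat"
    and Fo Fm Go Gm \<eta> \<epsilon> +
  assumes F: "lin_functor C D Fo Fm" and G: "lin_functor D C Go Gm"
    and \<eta>_iso: "\<And>X. X \<in> lc_obj C \<Longrightarrow> lc_iso C X (Go (Fo X)) (\<eta> X)"
    and \<eta>_nat: "\<And>X Y f. X \<in> lc_obj C \<Longrightarrow> Y \<in> lc_obj C \<Longrightarrow> f \<in> lc_hom C X Y \<Longrightarrow>
      lc_comp C X Y (Go (Fo Y)) (\<eta> Y) f =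
      lc_comp C X (Go (Fo X)) (Go (Fo Y)) (Gm (Fo X) (Fo Y) (Fm X Y f)) (\<eta> X)"
    and \<epsilon>_iso: "\<And>Y. Y \<in> lc_obj D \<Longrightarrow> lc_iso D Y (Fo (Go Y)) (\<epsilon> Y)"
    and \<epsilon>_nat: "\<And>X Y f. X \<in> lc_obj D \<Longrightarrow> Y \<in> lc_obj D \<Longrightarrow> f \<in> lc_hom D X Y \<Longrightarrow>
      lc_comp D X Y (Fo (Go Y)) (\<epsilon> Y) f =
      lc_comp D X (Fo (Go X)) (Fo (Go Y)) (Fm (Go X) (Go Y) (Gm X Y f)) (\<epsilon> X)"
begin

lemma swap: "linear_equivalence D C Go Gm Fo Fm \<epsilon> \<eta>"
  by (intro linear_equivalence.intro linear_equivalence_axioms.intro C.linear_category_axioms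
      D.linear_category_axioms F G \<eta>_iso \<eta>_nat \<epsilon>_iso \<epsilon>_nat)

lemma F_obj: "X \<in> lc_obj C \<Longrightarrow> Fo X \<in> lc_obj D"
  and F_hom: "X \<in> lc_obj C \<Longrightarrow> Y \<in> lc_obj C \<Longrightarrow> f \<in> lc_hom C X Y \<Longrightarrow>
    Fm X Y f \<in> lc_hom D (Fo X) (Fo Y)"
  and F_id: "X \<in> lc_obj C \<Longrightarrow> Fm X X (lc_id C X) = lc_id D (Fo X)"
  and F_comp: "X \<in> lc_obj C \<Longrightarrow> Y \<in> lc_obj C \<Longrightarrow> Z \<in> lc_obj C \<Longrightarrow> f \<in> lc_hom C X Y \<Longrightarrow>
    g \<in> lc_hom C Y Z \<Longrightarrow>
    Fm X Z (lc_comp C X Y Z g f) = lc_comp D (Fo X) (Fo Y) (Fo Z) (Fm Y Z g) (Fm X Y f)"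
  and F_add: "X \<in> lc_obj C \<Longrightarrow> Y \<in> lc_obj C \<Longrightarrow> f \<in> lc_hom C X Y \<Longrightarrow> g \<in> lc_hom C X Y \<Longrightarrow>
    Fm X Y (lc_add C X Y f g) = lc_add D (Fo X) (Fo Y) (Fm X Y f) (Fm X Y g)"
  and F_scale: "X \<in> lc_obj C \<Longrightarrow> Y \<in> lc_obj C \<Longrightarrow> f \<in> lc_hom C X Y \<Longrightarrow>
    Fm X Y (lc_scale C X Y c f) = lc_scale D (Fo X) (Fo Y) c (Fm X Y f)"
  using F unfolding lin_functor_def by auto

lemma F_zero: "X \<in> lc_obj C \<Longrightarrow> Y \<in> lc_obj C \<Longrightarrow> Fm X Y (lc_zero C X Y) = lc_zero D (Fo X) (Fo Y)"
  using F_scale[of X Y "lc_zero C X Y" 0]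
  by (simp add: C.scale_zero C.zero_hom D.scale_zero F_hom F_obj)

lemma F_lc_sum:
  assumes "X \<in> lc_obj C" "Y \<in> lc_obj C" "set fs \<subseteq> lc_hom C X Y"
  shows "Fm X Y (lc_sum C X Y fs) = lc_sum D (Fo X) (Fo Y) (map (Fm X Y) fs)"
  using assms(3) by (induction fs)
    (simp_all add: assms C.lc_sum_Nil C.lc_sum_Cons D.lc_sum_Nil D.lc_sum_Cons F_zero F_obj F_add
      C.lc_sum_hom)

lemma \<eta>_hom: "X \<in> lc_obj C \<Longrightarrow> \<eta> X \<in> lc_hom C X (Go (Fo X))"
  using \<eta>_iso unfolding lc_iso_def by blast

lemma GF_obj: "X \<in> lc_obj C \<Longrightarrow> Go (Fo X) \<in> lc_obj C"
  using F_obj G unfolding lin_functor_def by blast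

lemma GF_hom: "X \<in> lc_obj C \<Longrightarrow> Y \<in> lc_obj C \<Longrightarrow> f \<in> lc_hom C X Y \<Longrightarrow>
   Gm (Fo X) (Fo Y) (Fm X Y f) \<in> lc_hom C (Go (Fo X)) (Go (Fo Y))"
  using F_obj[of X] F_obj[of Y] F_hom[of X Y f] G unfolding lin_functor_def by auto

lemma \<eta>_inverse:
  assumes "X \<in> lc_obj C"
  obtains g where "g \<in> lc_hom C (Go (Fo X)) X"
    "lc_comp C X (Go (Fo X)) X g (\<eta> X) = lc_id C X"
    "lc_comp C (Go (Fo X)) X (Go (Fo X)) (\<eta> X) g = lc_id C (Go (Fo X))"
  using \<eta>_iso[OF assms] unfolding lc_iso_def by blast

lemma \<eta>_cancel:
  assumes "X \<in> lc_obj C" "Y \<in> lc_obj C" "f \<in> lc_hom C X Y" "g \<in> lc_hom C X Y"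
    "lc_comp C X Y (Go (Fo Y)) (\<eta> Y) f = lc_comp C X Y (Go (Fo Y)) (\<eta> Y) g"
  shows "f = g"
proof -
  obtain r where r: "r \<in> lc_hom C (Go (Fo Y)) Y"
    "lc_comp C Y (Go (Fo Y)) Y r (\<eta> Y) = lc_id C Y" using \<eta>_inverse[OF assms(2)] by metis
  have "h = lc_comp C X (Go (Fo Y)) Y r (lc_comp C X Y (Go (Fo Y)) (\<eta> Y) h)"
    if "h \<in> lc_hom C X Y" for h
    using that assms r C.comp_assoc[of X Y "Go (Fo Y)" Y h "\<eta> Y" r]
    by (simp add: GF_obj \<eta>_hom C.id_comp)
  then show ?thesis using assms(3-5) by metis
qed

lemma F_faithful:
  assumes "X \<in> lc_obj C" "Y \<in> lc_obj C" "f \<in> lc_hom C X Y" "g \<in> lc_hom C X Y"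
    "Fm X Y f = Fm X Y g"
  shows "f = g"
  using \<eta>_cancel[OF assms(1-4)] \<eta>_nat[OF assms(1,2)] assms by simp

lemma F_full:
  assumes "X \<in> lc_obj C" "Y \<in> lc_obj C" "g \<in> lc_hom D (Fo X) (Fo Y)"
  obtains f where "f \<in> lc_hom C X Y" "Fm X Y f = g"
proof -
  interpret S: linear_equivalence D C Go Gm Fo Fm \<epsilon> \<eta> by (rule swap)
  have Gg: "Gm (Fo X) (Fo Y) g \<in> lc_hom C (Go (Fo X)) (Go (Fo Y))"
    using assms S.F_hom F_obj by blast
  obtain r where r: "r \<in> lc_hom C (Go (Fo Y)) Y"
    "lc_comp C (Go (Fo Y)) Y (Go (Fo Y)) (\<eta> Y) r = lc_id C (Go (Fo Y))"
    using \<eta>_inverse[OF assms(2)] by metis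
  obtain l where l: "l \<in> lc_hom C (Go (Fo X)) X"
    "lc_comp C (Go (Fo X)) X (Go (Fo X)) (\<eta> X) l = lc_id C (Go (Fo X))"
    using \<eta>_inverse[OF assms(1)] by metis
  define m where "m = lc_comp C X (Go (Fo X)) (Go (Fo Y)) (Gm (Fo X) (Fo Y) g) (\<eta> X)"
  define f where "f = lc_comp C X (Go (Fo Y)) Y r m"
  have m: "m \<in> lc_hom C X (Go (Fo Y))"
    using assms Gg by (auto simp: m_def intro!: C.comp_hom GF_obj \<eta>_hom)
  have f: "f \<in> lc_hom C X Y" using assms m r by (auto simp: f_def intro!: C.comp_hom GF_obj)
  have "lc_comp C X Y (Go (Fo Y)) (\<eta> Y) f = m"
    using assms m r C.comp_assoc[of X "Go (Fo Y)" Y "Go (Fo Y)" m r "\<eta> Y"]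
    by (simp add: f_def GF_obj \<eta>_hom C.id_comp)
  then have e: "lc_comp C X (Go (Fo X)) (Go (Fo Y)) (Gm (Fo X) (Fo Y) (Fm X Y f)) (\<eta> X) = m"
    using \<eta>_nat[OF assms(1,2) f] by simp
  have can: "k = lc_comp C (Go (Fo X)) X (Go (Fo Y)) (lc_comp C X (Go (Fo X)) (Go (Fo Y)) k (\<eta> X)) l"
    if "k \<in> lc_hom C (Go (Fo X)) (Go (Fo Y))" for k
    using that assms l C.comp_assoc[of "Go (Fo X)" X "Go (Fo X)" "Go (Fo Y)" l "\<eta> X" k]
    by (simp add: GF_obj \<eta>_hom C.comp_id)
  have "Gm (Fo X) (Fo Y) (Fm X Y f) = Gm (Fo X) (Fo Y) g"
    using can[OF Gg] can[OF GF_hom[OF assms(1,2) f]] e m_def by simp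
  then have "Fm X Y f = g"
    using S.F_faithful[of "Fo X" "Fo Y" "Fm X Y f" g] assms f F_obj F_hom by blast
  with f that show ?thesis by blast
qed

lemma separating_F:
  assumes P: "P \<in> lc_obj C" and sep: "separating C P"
  shows "separating D (Fo P)"
  unfolding separating_def
proof (intro ballI impI)
  interpret S: linear_equivalence D C Go Gm Fo Fm \<epsilon> \<eta> by (rule swap)
  fix X Y f g
  assume X: "X \<in> lc_obj D" and Y: "Y \<in> lc_obj D" and f: "f \<in> lc_hom D X Y" and g: "g \<in> lc_hom D X Y"
    and eq: "\<forall>h\<in>lc_hom D (Fo P) X. lc_comp D (Fo P) X Y f h = lc_comp D (Fo P) X Y g h"
  obtain l where l: "l \<in> lc_hom D (Fo (Go X)) X"
    "lc_comp D X (Fo (Go X)) X l (\<epsilon> X) = lc_id D X"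
    "lc_comp D (Fo (Go X)) X (Fo (Go X)) (\<epsilon> X) l = lc_id D (Fo (Go X))"
    using S.\<eta>_inverse[OF X] by metis
  have "lc_comp C P (Go X) (Go Y) (Gm X Y f) h = lc_comp C P (Go X) (Go Y) (Gm X Y g) h"
    if h: "h \<in> lc_hom C P (Go X)" for h
  proof -
    define h' where "h' = lc_comp D (Fo P) (Fo (Go X)) X l (Fm P (Go X) h)"
    have Fh: "Fm P (Go X) h \<in> lc_hom D (Fo P) (Fo (Go X))"
      using P h X S.F_obj F_hom by simp
    have h': "h' \<in> lc_hom D (Fo P) X"
      using Fh l X P F_obj by (auto simp: h'_def S.GF_obj intro!: D.comp_hom)
    have eh: "lc_comp D (Fo P) X (Fo (Go X)) (\<epsilon> X) h' = Fm P (Go X) h"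
      using D.comp_assoc[of "Fo P" "Fo (Go X)" X "Fo (Go X)" "Fm P (Go X) h" l "\<epsilon> X"] Fh l X P
      by (simp add: h'_def S.GF_obj F_obj S.\<eta>_hom D.id_comp)
    have *: "lc_comp D (Fo P) (Fo (Go X)) (Fo (Go Y)) (Fm (Go X) (Go Y) (Gm X Y k)) (Fm P (Go X) h)
      = lc_comp D (Fo P) Y (Fo (Go Y)) (\<epsilon> Y) (lc_comp D (Fo P) X Y k h')"
      if k: "k \<in> lc_hom D X Y" for k
      using D.comp_assoc[of "Fo P" X "Fo (Go X)" "Fo (Go Y)" h' "\<epsilon> X" "Fm (Go X) (Go Y) (Gm X Y k)"]
        D.comp_assoc[of "Fo P" X Y "Fo (Go Y)" h' k "\<epsilon> Y"] S.\<eta>_nat[OF X Y k] eh k X Y P h' l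
      by (simp add: S.GF_obj F_obj S.\<eta>_hom S.GF_hom)
    have "lc_comp D (Fo P) (Fo (Go X)) (Fo (Go Y)) (Fm (Go X) (Go Y) (Gm X Y f)) (Fm P (Go X) h) =
      lc_comp D (Fo P) (Fo (Go X)) (Fo (Go Y)) (Fm (Go X) (Go Y) (Gm X Y g)) (Fm P (Go X) h)"
      using *[OF f] *[OF g] eq h' by simp
    then have "Fm P (Go Y) (lc_comp C P (Go X) (Go Y) (Gm X Y f) h) =
      Fm P (Go Y) (lc_comp C P (Go X) (Go Y) (Gm X Y g) h)"
      using P X Y f g h by (simp add: F_comp S.F_obj S.F_hom)
    then show ?thesis
      using F_faithful P X Y f g h C.comp_hom S.F_obj S.F_hom by metis
  qed
  then have "Gm X Y f = Gm X Y g"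
    using sep S.F_obj[OF X] S.F_obj[OF Y] S.F_hom[OF X Y f] S.F_hom[OF X Y g]
    unfolding separating_def by blast
  then show "f = g" using S.F_faithful X Y f g by blast
qed

lemma decomposition_F:
  assumes "P \<in> lc_obj C" "X \<in> lc_obj C" "decomposition C P X ps"
  shows "decomposition D (Fo P) (Fo X) (map (\<lambda>(u, v). (Fm P X u, Fm X P v)) ps)"
proof -
  have ps: "u \<in> lc_hom C P X \<and> v \<in> lc_hom C X P" if "(u, v) \<in> set ps" for u v
    using assms(3) that by (auto simp: decomposition_def)
  have "lc_id D (Fo X) = Fm X X (lc_sum C X X (map (\<lambda>(u, v). lc_comp C X P X u v) ps))"
    using assms by (simp add: decomposition_def F_id)
  also have "\<dots> = lc_sum D (Fo X) (Fo X) (map (Fm X X) (map (\<lambda>(u, v). lc_comp C X P X u v) ps))"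
    using assms ps by (intro F_lc_sum) (auto intro!: C.comp_hom dest!: ps)
  also have "map (Fm X X) (map (\<lambda>(u, v). lc_comp C X P X u v) ps) =
     map (\<lambda>(u, v). lc_comp D (Fo X) (Fo P) (Fo X) u v) (map (\<lambda>(u, v). (Fm P X u, Fm X P v)) ps)"
    using assms by (auto simp: F_comp dest!: ps)
  finally have *: "lc_sum D (Fo X) (Fo X) (map (\<lambda>(u, v). lc_comp D (Fo X) (Fo P) (Fo X) u v)
      (map (\<lambda>(u, v). (Fm P X u, Fm X P v)) ps)) = lc_id D (Fo X)" by simp
  then show ?thesis unfolding decomposition_def using ps assms by (auto intro!: F_hom dest!: ps)
qed

lemma uniform_F:
  assumes P: "P \<in> lc_obj C" "separating C P" and Q: "Q \<in> lc_obj D" "separating D Q"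
    and X: "X \<in> lc_obj C" "uniform C P X"
  shows "uniform D Q (Fo X)"
  unfolding uniform_def
proof (intro conjI ballI impI)
  have "Fm X X (lc_id C X) \<noteq> Fm X X (lc_zero C X X)"
    using F_faithful[of X X "lc_id C X" "lc_zero C X X"] X C.id_hom C.zero_hom
    unfolding uniform_def by blast
  then show "lc_id D (Fo X) \<noteq> lc_zero D (Fo X) (Fo X)" using X by (simp add: F_id F_zero)
  have lift: "\<exists>h f1. h \<in> lc_hom D (Fo P) Q \<and> f1 \<in> lc_hom C P X \<and> f1 \<noteq> lc_zero C P X \<and>
      Fm P X f1 = lc_comp D (Fo P) Q (Fo X) f h"
    if f: "f \<in> lc_hom D Q (Fo X)" "f \<noteq> lc_zero D Q (Fo X)" for f
  proof -
    have "\<exists>h\<in>lc_hom D (Fo P) Q. lc_comp D (Fo P) Q (Fo X) f h \<noteq>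
        lc_comp D (Fo P) Q (Fo X) (lc_zero D Q (Fo X)) h"
      using separating_F[OF P] f Q X F_obj D.zero_hom unfolding separating_def by metis
    then obtain h where h: "h \<in> lc_hom D (Fo P) Q"
      "lc_comp D (Fo P) Q (Fo X) f h \<noteq> lc_zero D (Fo P) (Fo X)"
      using P Q X F_obj by (metis D.zero_comp)
    have "lc_comp D (Fo P) Q (Fo X) f h \<in> lc_hom D (Fo P) (Fo X)"
      using h f P Q X F_obj D.comp_hom by blast
    then obtain f1 where "f1 \<in> lc_hom C P X" "Fm P X f1 = lc_comp D (Fo P) Q (Fo X) f h"
      using F_full[of P X] P X by blast
    moreover then have "f1 \<noteq> lc_zero C P X" using h F_zero P X by auto
    ultimately show ?thesis using h by blast
  qed
  fix f g assume f: "f \<in> lc_hom D Q (Fo X)" "f \<noteq> lc_zero D Q (Fo X)"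
    and g: "g \<in> lc_hom D Q (Fo X)" "g \<noteq> lc_zero D Q (Fo X)"
  obtain h f1 where h: "h \<in> lc_hom D (Fo P) Q" "f1 \<in> lc_hom C P X" "f1 \<noteq> lc_zero C P X"
      "Fm P X f1 = lc_comp D (Fo P) Q (Fo X) f h" using lift[OF f] by blast
  obtain k g1 where k: "k \<in> lc_hom D (Fo P) Q" "g1 \<in> lc_hom C P X" "g1 \<noteq> lc_zero C P X"
      "Fm P X g1 = lc_comp D (Fo P) Q (Fo X) g k" using lift[OF g] by blast
  obtain a b where a: "a \<in> lc_hom C P P" and b: "b \<in> lc_hom C P P"
    and ab: "lc_comp C P P X f1 a = lc_comp C P P X g1 b" "lc_comp C P P X f1 a \<noteq> lc_zero C P X"
    using X h k unfolding uniform_def by blast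
  define m where "m = Fm P X (lc_comp C P P X f1 a)"
  have m: "m \<in> lc_hom D (Fo P) (Fo X)" using P X h a by (simp add: m_def F_hom C.comp_hom)
  have "m \<noteq> lc_zero D (Fo P) (Fo X)"
    using F_faithful[of P X "lc_comp C P P X f1 a" "lc_zero C P X"] ab(2) P(1) X(1)
      C.zero_hom[of P X] C.comp_hom[OF P(1) P(1) X(1) a h(2)]
    unfolding m_def F_zero[OF P(1) X(1), symmetric] by blast
  then have "\<exists>r\<in>lc_hom D Q (Fo P). lc_comp D Q (Fo P) (Fo X) m r \<noteq>
        lc_comp D Q (Fo P) (Fo X) (lc_zero D (Fo P) (Fo X)) r"
    using Q m P X F_obj D.zero_hom unfolding separating_def by metis
  then obtain r where r: "r \<in> lc_hom D Q (Fo P)"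
      "lc_comp D Q (Fo P) (Fo X) m r \<noteq> lc_zero D Q (Fo X)"
    using P Q X F_obj by (metis D.zero_comp)
  define f' where "f' = lc_comp D Q (Fo P) Q (lc_comp D (Fo P) (Fo P) Q h (Fm P P a)) r"
  define g' where "g' = lc_comp D Q (Fo P) Q (lc_comp D (Fo P) (Fo P) Q k (Fm P P b)) r"
  have Fa: "Fm P P a \<in> lc_hom D (Fo P) (Fo P)" "Fm P P b \<in> lc_hom D (Fo P) (Fo P)"
    using a b P F_hom by auto
  have ff: "lc_comp D Q Q (Fo X) f f' = lc_comp D Q (Fo P) (Fo X) m r"
    using Fa P Q X h r f a unfolding f'_def m_def by (simp add: D.comp_assoc F_obj D.comp_hom F_comp)
  have gg: "lc_comp D Q Q (Fo X) g g' = lc_comp D Q (Fo P) (Fo X) m r"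
    using Fa P Q X k r g b unfolding g'_def m_def ab(1) by (simp add: D.comp_assoc F_obj D.comp_hom F_comp)
  have "f' \<in> lc_hom D Q Q" "g' \<in> lc_hom D Q Q"
    using Fa P Q h k r by (auto simp: f'_def g'_def F_obj intro!: D.comp_hom)
  then show "\<exists>f'\<in>lc_hom D Q Q. \<exists>g'\<in>lc_hom D Q Q.
      lc_comp D Q Q (Fo X) f f' = lc_comp D Q Q (Fo X) g g' \<and>
      lc_comp D Q Q (Fo X) f f' \<noteq> lc_zero D Q (Fo X)"
    using ff gg r by metis
qed

definition trace_pullback :: "'o \<Rightarrow> 'p \<Rightarrow> ('n \<times> 'n) list \<Rightarrow> ('n \<Rightarrow> 'k) \<Rightarrow> 'm \<Rightarrow> 'k" where
  "trace_pullback P Q ps \<phi> f = hs_trace D Q (Fo P) ps \<phi> (Fm P P f)"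

lemma hs_trace_functional:
  assumes "lc_functional D Q \<phi>" "Q \<in> lc_obj D" "X \<in> lc_obj D" "decomposition D Q X ps"
  shows "lc_functional D X (hs_trace D Q X ps \<phi>)"
proof -
  have ps: "set ps \<subseteq> lc_hom D Q X \<times> lc_hom D X Q"
    using assms(4) by (auto simp: decomposition_def)
  have "hs_trace D Q X ps \<phi> (lc_add D X X f g) = hs_trace D Q X ps \<phi> f + hs_trace D Q X ps \<phi> g"
    if fg: "f \<in> lc_hom D X X" "g \<in> lc_hom D X X" for f g
    using ps unfolding hs_trace_def
  proof (induction ps)
    case (Cons p ps)
    then show ?case using fg assms(1-3)
      by (auto simp: D.comp_add_left D.comp_add_right D.comp_hom lc_functional_def algebra_simps)
  qed simp
  moreover have "hs_trace D Q X ps \<phi> (lc_scale D X X c f) = c * hs_trace D Q X ps \<phi> f"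
    if fg: "f \<in> lc_hom D X X" for f c
    using ps unfolding hs_trace_def
  proof (induction ps)
    case (Cons p ps)
    then show ?case using fg assms(1-3)
      by (auto simp: D.comp_scale_left D.comp_scale_right D.comp_hom lc_functional_def algebra_simps)
  qed simp
  ultimately show ?thesis by (simp add: lc_functional_def)
qed

lemma trace_pullback_functional:
  assumes P: "P \<in> lc_obj C" and Q: "Q \<in> lc_obj D" and ps: "decomposition D Q (Fo P) ps"
    and \<phi>: "trace_functional D Q \<phi>"
  shows "trace_functional C P (trace_pullback P Q ps \<phi>)"
proof -
  have "lc_functional D (Fo P) (hs_trace D Q (Fo P) ps \<phi>)"
    using hs_trace_functional \<phi> Q P F_obj ps by (simp add: trace_functional_def)
  then have "lc_functional C P (trace_pullback P Q ps \<phi>)"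
    using P unfolding lc_functional_def trace_pullback_def by (simp add: F_add F_scale F_hom)
  moreover have "trace_pullback P Q ps \<phi> (lc_comp C P P P f g) =
      trace_pullback P Q ps \<phi> (lc_comp C P P P g f)"
    if "f \<in> lc_hom C P P" "g \<in> lc_hom C P P" for f g
    unfolding trace_pullback_def
    using D.hs_trace_commute[OF \<phi> Q _ _ ps ps, of "Fm P P f" "Fm P P g"] P that
    by (simp add: F_comp F_obj F_hom)
  ultimately show ?thesis by (simp add: trace_functional_def)
qed

lemma trace_pullback_hs_trace:
  assumes P: "P \<in> lc_obj C" and Q: "Q \<in> lc_obj D" and X: "X \<in> lc_obj C"
    and ps: "decomposition D Q (Fo P) ps" and qs: "decomposition C P X qs"
    and f: "f \<in> lc_hom C X X"
  defines "rs \<equiv> D.decomposition_comp Q (Fo P) (Fo X) (map (\<lambda>(u, v). (Fm P X u, Fm X P v)) qs) ps"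
  shows "decomposition D Q (Fo X) rs"
    and "hs_trace C P X qs (trace_pullback P Q ps \<phi>) f = hs_trace D Q (Fo X) rs \<phi> (Fm X X f)"
proof -
  show "decomposition D Q (Fo X) rs"
    unfolding rs_def using D.decomposition_trans decomposition_F assms F_obj by metis
  have qs': "set qs \<subseteq> lc_hom C P X \<times> lc_hom C X P"
    using qs by (auto simp: decomposition_def)
  have ps': "set ps \<subseteq> lc_hom D Q (Fo P) \<times> lc_hom D (Fo P) Q"
    using ps by (auto simp: decomposition_def)
  show "hs_trace C P X qs (trace_pullback P Q ps \<phi>) f = hs_trace D Q (Fo X) rs \<phi> (Fm X X f)"
    using qs' unfolding rs_def D.decomposition_comp_def
  proof (induction qs)
    case (Cons q qs)
    obtain u v where q: "q = (u, v)" "u \<in> lc_hom C P X" "v \<in> lc_hom C X P" using Cons.prems by auto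
    have "trace_pullback P Q ps \<phi> (lc_comp C P X P v (lc_comp C P X X f u)) =
      (\<Sum>(a, b)\<leftarrow>map (\<lambda>(a, b). (lc_comp D Q (Fo P) (Fo X) (Fm P X u) a,
           lc_comp D (Fo X) (Fo P) Q b (Fm X P v))) ps.
         \<phi> (lc_comp D Q (Fo X) Q b (lc_comp D Q (Fo X) (Fo X) (Fm X X f) a)))"
      unfolding trace_pullback_def hs_trace_def using ps'
    proof (induction ps)
      case (Cons p ps)
      then show ?case using q P Q X f
        by (auto simp: F_comp F_obj F_hom C.comp_hom D.comp_hom D.comp_assoc[symmetric])
    qed simp
    then show ?case using Cons q by (simp add: hs_trace_def)
  qed (simp add: hs_trace_def)
qed

lemma trace_pullback_inverse:
  assumes P: "P \<in> lc_obj C" and Q: "Q \<in> lc_obj D"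
    and ps: "decomposition D Q (Fo P) ps" and qs: "decomposition C P (Go Q) qs"
    and \<phi>: "trace_functional C P \<phi>" and f: "f \<in> lc_hom C P P"
  shows "trace_pullback P Q ps (linear_equivalence.trace_pullback C Go Gm Q P qs \<phi>) f = \<phi> f"
proof -
  interpret S: linear_equivalence D C Go Gm Fo Fm \<epsilon> \<eta> by (rule swap)
  obtain r where r: "r \<in> lc_hom C (Go (Fo P)) P"
    "lc_comp C P (Go (Fo P)) P r (\<eta> P) = lc_id C P"
    "lc_comp C (Go (Fo P)) P (Go (Fo P)) (\<eta> P) r = lc_id C (Go (Fo P))"
    using \<eta>_inverse[OF P] by metis
  define rs where
    "rs = C.decomposition_comp P (Go Q) (Go (Fo P)) (map (\<lambda>(u, v). (Gm Q (Fo P) u, Gm (Fo P) Q v)) ps) qs"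
  have rs: "decomposition C P (Go (Fo P)) rs"
    and *: "trace_pullback P Q ps (S.trace_pullback Q P qs \<phi>) f =
      hs_trace C P (Go (Fo P)) rs \<phi> (Gm (Fo P) (Fo P) (Fm P P f))"
    using S.trace_pullback_hs_trace[OF Q P F_obj[OF P] qs ps, of "Fm P P f"] P f F_hom
    by (simp_all add: rs_def trace_pullback_def)
  have "hs_trace C P (Go (Fo P)) rs \<phi> (Gm (Fo P) (Fo P) (Fm P P f)) =
    hs_trace C P P [(lc_id C P, lc_id C P)] \<phi> f"
    by (rule C.hs_trace_conj[OF \<phi> P P GF_obj[OF P] C.decomposition_self[OF P] rs \<eta>_hom[OF P] r(1,2) f])
      (use P f r \<eta>_nat in \<open>auto simp: GF_hom\<close>)
  with * show ?thesis using P f by (simp add: C.hs_trace_self)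
qed

end

lemma lc_iso_inverse:
  assumes "lc_iso C X Y f"
  obtains g where "lc_iso C Y X g" "g \<in> lc_hom C Y X" "lc_comp C X Y X g f = lc_id C X"
    "lc_comp C Y X Y f g = lc_id C Y"
  using assms unfolding lc_iso_def by blast

lemma (in linear_category) naturally_isomorphic_sym:
  assumes "naturally_isomorphic B C Fo Fm Go Gm" "lin_functor B C Fo Fm" "lin_functor B C Go Gm"
  shows "naturally_isomorphic B C Go Gm Fo Fm"
proof -
  obtain \<eta> where iso: "\<And>X. X \<in> lc_obj B \<Longrightarrow> lc_iso C (Fo X) (Go X) (\<eta> X)"
    and nat: "\<And>X Y f. X \<in> lc_obj B \<Longrightarrow> Y \<in> lc_obj B \<Longrightarrow> f \<in> lc_hom B X Y \<Longrightarrow>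
        lc_comp C (Fo X) (Fo Y) (Go Y) (\<eta> Y) (Fm X Y f) =
        lc_comp C (Fo X) (Go X) (Go Y) (Gm X Y f) (\<eta> X)"
    using assms(1) unfolding naturally_isomorphic_def by blast
  have "\<exists>g. \<forall>X\<in>lc_obj B. lc_iso C (Go X) (Fo X) (g X) \<and> g X \<in> Hom (Go X) (Fo X) \<and>
      lc_comp C (Fo X) (Go X) (Fo X) (g X) (\<eta> X) = lc_id C (Fo X) \<and>
      lc_comp C (Go X) (Fo X) (Go X) (\<eta> X) (g X) = lc_id C (Go X)"
    by (intro bchoice ballI) (meson iso lc_iso_inverse)
  then obtain g where g: "\<And>X. X \<in> lc_obj B \<Longrightarrow> lc_iso C (Go X) (Fo X) (g X)"
      "\<And>X. X \<in> lc_obj B \<Longrightarrow> g X \<in> Hom (Go X) (Fo X)"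
      "\<And>X. X \<in> lc_obj B \<Longrightarrow> lc_comp C (Fo X) (Go X) (Fo X) (g X) (\<eta> X) = lc_id C (Fo X)"
      "\<And>X. X \<in> lc_obj B \<Longrightarrow> lc_comp C (Go X) (Fo X) (Go X) (\<eta> X) (g X) = lc_id C (Go X)"
    by blast
  have "lc_comp C (Go X) (Go Y) (Fo Y) (g Y) (Gm X Y f) =
        lc_comp C (Go X) (Fo X) (Fo Y) (Fm X Y f) (g X)"
    if X: "X \<in> lc_obj B" and Y: "Y \<in> lc_obj B" and f: "f \<in> lc_hom B X Y" for X Y f
  proof -
    have o: "Fo X \<in> Ob" "Fo Y \<in> Ob" "Go X \<in> Ob" "Go Y \<in> Ob"
      and h: "Fm X Y f \<in> Hom (Fo X) (Fo Y)" "Gm X Y f \<in> Hom (Go X) (Go Y)"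
        "\<eta> X \<in> Hom (Fo X) (Go X)" "\<eta> Y \<in> Hom (Fo Y) (Go Y)"
      using X Y f assms(2,3) iso unfolding lin_functor_def lc_iso_def by auto
    have "lc_comp C (Go X) (Go Y) (Fo Y) (g Y) (Gm X Y f) = lc_comp C (Go X) (Go Y) (Fo Y) (g Y)
       (lc_comp C (Go X) (Go X) (Go Y) (Gm X Y f) (lc_comp C (Go X) (Fo X) (Go X) (\<eta> X) (g X)))"
      using o h X by (simp add: g comp_id)
    also have "\<dots> = lc_comp C (Go X) (Go Y) (Fo Y) (g Y) (lc_comp C (Go X) (Fo X) (Go Y)
       (lc_comp C (Fo X) (Fo Y) (Go Y) (\<eta> Y) (Fm X Y f)) (g X))"
      using o h X comp_assoc[of "Go X" "Fo X" "Go X" "Go Y" "g X" "\<eta> X" "Gm X Y f"]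
      by (simp add: nat[OF X Y f] g(2))
    also have "\<dots> = lc_comp C (Go X) (Fo X) (Fo Y) (lc_comp C (Fo X) (Fo Y) (Fo Y)
       (lc_comp C (Fo Y) (Go Y) (Fo Y) (g Y) (\<eta> Y)) (Fm X Y f)) (g X)"
      using o h X Y f g(2) by (simp add: comp_assoc comp_hom)
    also have "\<dots> = lc_comp C (Go X) (Fo X) (Fo Y) (Fm X Y f) (g X)"
      using o h X Y f by (simp add: g id_comp)
    finally show ?thesis .
  qed
  with g(1) show ?thesis unfolding naturally_isomorphic_def by blast
qed

lemma lin_equivalent_linear_equivalence:
  assumes "linear_category C" "linear_category D" "lin_equivalent C D"
  obtains Fo Fm Go Gm \<eta> \<epsilon> where "linear_equivalence C D Fo Fm Go Gm \<eta> \<epsilon>"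
proof -
  interpret C: linear_category C by fact
  interpret D: linear_category D by fact
  obtain Fo Fm Go Gm where F: "lin_functor C D Fo Fm" and G: "lin_functor D C Go Gm"
    and 1: "naturally_isomorphic C C (\<lambda>X. X) (\<lambda>X Y f. f)
       (\<lambda>X. Go (Fo X)) (\<lambda>X Y f. Gm (Fo X) (Fo Y) (Fm X Y f))"
    and 2: "naturally_isomorphic D D (\<lambda>X. Fo (Go X)) (\<lambda>X Y f. Fm (Go X) (Go Y) (Gm X Y f))
       (\<lambda>X. X) (\<lambda>X Y f. f)"
    using assms(3) unfolding lin_equivalent_def by blast
  have 3: "naturally_isomorphic D D (\<lambda>X. X) (\<lambda>X Y f. f)
      (\<lambda>X. Fo (Go X)) (\<lambda>X Y f. Fm (Go X) (Go Y) (Gm X Y f))"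
    by (rule D.naturally_isomorphic_sym[OF 2]) (use F G in \<open>auto simp: lin_functor_def\<close>)
  obtain \<eta> where \<eta>: "\<forall>X\<in>lc_obj C. lc_iso C X (Go (Fo X)) (\<eta> X)"
     "\<forall>X\<in>lc_obj C. \<forall>Y\<in>lc_obj C. \<forall>f\<in>lc_hom C X Y.
        lc_comp C X Y (Go (Fo Y)) (\<eta> Y) f =
        lc_comp C X (Go (Fo X)) (Go (Fo Y)) (Gm (Fo X) (Fo Y) (Fm X Y f)) (\<eta> X)"
    using 1 unfolding naturally_isomorphic_def by blast
  obtain \<epsilon> where \<epsilon>: "\<forall>X\<in>lc_obj D. lc_iso D X (Fo (Go X)) (\<epsilon> X)"
     "\<forall>X\<in>lc_obj D. \<forall>Y\<in>lc_obj D. \<forall>f\<in>lc_hom D X Y.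
        lc_comp D X Y (Fo (Go Y)) (\<epsilon> Y) f =
        lc_comp D X (Fo (Go X)) (Fo (Go Y)) (Fm (Go X) (Go Y) (Gm X Y f)) (\<epsilon> X)"
    using 3 unfolding naturally_isomorphic_def by blast
  have "linear_equivalence C D Fo Fm Go Gm \<eta> \<epsilon>"
    by unfold_locales (use F G \<eta> \<epsilon> in auto)
  then show ?thesis by (rule that)
qed

section \<open>The regular module in a universe\<close>

text \<open>
  \<open>\<psi>\<close> embeds the algebra into a ring given as a type, and \<open>\<kappa>\<close> embeds that type into the
  universe of the modules, so that left ideals have isomorphic copies in this universe.
\<close>

locale embedded_algebra = k_algebra A for A :: "('k::field, 'a) module" (structure) +
  fixes \<psi> :: "'a \<Rightarrow> 's::ring_1" and \<kappa> :: "'s \<Rightarrow> 'u"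
  assumes inj_psi: "inj_on \<psi> (carrier A)"
    and psi_add: "x \<in> carrier A \<Longrightarrow> y \<in> carrier A \<Longrightarrow> \<psi> (x \<oplus> y) = \<psi> x + \<psi> y"
    and psi_mult: "x \<in> carrier A \<Longrightarrow> y \<in> carrier A \<Longrightarrow> \<psi> (x \<otimes> y) = \<psi> x * \<psi> y"
    and psi_one: "\<psi> \<one> = 1"
    and inj_kappa: "inj \<kappa>"
begin

definition S :: "'s set" where "S = \<psi> ` carrier A"

definition kinv :: "'u \<Rightarrow> 's" where "kinv = inv_into UNIV \<kappa>"

definition act :: "('a, 'u) module \<Rightarrow> 's \<Rightarrow> 'u \<Rightarrow> 'u" where
  "act X s x = the_inv_into (carrier A) \<psi> s \<odot>\<^bsub>X\<^esub> x"

definition submod :: "'s set \<Rightarrow> bool" where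
  "submod L \<longleftrightarrow> 0 \<in> L \<and> (\<forall>x\<in>L. \<forall>y\<in>L. x + y \<in> L) \<and> (\<forall>s\<in>S. \<forall>x\<in>L. s * x \<in> L)"

definition lid :: "'s set \<Rightarrow> ('a, 'u) module" where
  "lid L = \<lparr>carrier = \<kappa> ` L, monoid.mult = undefined, one = undefined, zero = \<kappa> 0,
     add = (\<lambda>u v. \<kappa> (kinv u + kinv v)), smult = (\<lambda>r u. \<kappa> (\<psi> r * kinv u))\<rparr>"

abbreviation lmod :: "(('a, 'u) module, 'u \<Rightarrow> 'u, 'k) lin_cat" where
  "lmod \<equiv> left_modules TYPE('u) A"

abbreviation reg :: "('a, 'u) module" where "reg \<equiv> lid S"

definition rmap :: "('a, 'u) module \<Rightarrow> 'u \<Rightarrow> 'u \<Rightarrow> 'u" where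
  "rmap X x = (\<lambda>u\<in>carrier reg. act X (kinv u) x)"

definition elt :: "('u \<Rightarrow> 'u) \<Rightarrow> 's" where "elt f = kinv (f (\<kappa> 1))"

sublocale lmod: linear_category lmod
  by (rule linear_category_left_modules) (rule k_algebra_axioms)

lemma kinv_kappa [simp]: "kinv (\<kappa> s) = s"
  using inj_kappa by (simp add: kinv_def)

lemma lmod_simps: "lc_obj lmod = {M. left_module A M}" "lc_hom lmod = left_module_hom A"
  "lc_id lmod = (\<lambda>M. \<lambda>x\<in>carrier M. x)" "lc_comp lmod M N X g f = compose (carrier M) g f"
  "lc_add lmod M N f g = (\<lambda>x\<in>carrier M. f x \<oplus>\<^bsub>N\<^esub> g x)"
  "lc_scale lmod M N c f = (\<lambda>x\<in>carrier M. (c \<odot>\<^bsub>A\<^esub> \<one>\<^bsub>A\<^esub>) \<odot>\<^bsub>N\<^esub> f x)"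
  by (simp_all add: left_modules_def)

lemma psi_zero: "\<psi> \<zero> = 0"
  using psi_add[of \<zero> \<zero>] by simp

lemma psi_minus: "x \<in> carrier A \<Longrightarrow> \<psi> (\<ominus> x) = - \<psi> x"
  using psi_add[of x "\<ominus> x"] by (simp add: r_neg psi_zero add_eq_0_iff)

lemma S_closed: "0 \<in> S" "1 \<in> S" "x \<in> S \<Longrightarrow> y \<in> S \<Longrightarrow> x + y \<in> S"
  "x \<in> S \<Longrightarrow> y \<in> S \<Longrightarrow> x * y \<in> S" "x \<in> S \<Longrightarrow> - x \<in> S"
proof -
  show "0 \<in> S" "1 \<in> S" unfolding S_def using psi_zero psi_one zero_closed one_closed by (metis imageI)+
  show "x \<in> S \<Longrightarrow> y \<in> S \<Longrightarrow> x + y \<in> S" "x \<in> S \<Longrightarrow> y \<in> S \<Longrightarrow> x * y \<in> S" "x \<in> S \<Longrightarrow> - x \<in> S"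
    unfolding S_def by (auto simp: psi_add[symmetric] psi_mult[symmetric] psi_minus[symmetric])
qed

lemma psi_S: "r \<in> carrier A \<Longrightarrow> \<psi> r \<in> S"
  by (simp add: S_def)

lemma submod_S: "submod S"
  by (simp add: submod_def S_closed)

lemma submod_minus: "submod L \<Longrightarrow> x \<in> L \<Longrightarrow> - x \<in> L"
  unfolding submod_def using S_closed(2,5) by (metis mult_1 mult_minus_left)

lemma submod_sum: "submod L \<Longrightarrow> (\<And>x. x \<in> set xs \<Longrightarrow> f x \<in> L) \<Longrightarrow> (\<Sum>x\<leftarrow>xs. f x) \<in> L"
  by (induction xs) (auto simp: submod_def)

lemma act_psi: "r \<in> carrier A \<Longrightarrow> act X (\<psi> r) x = r \<odot>\<^bsub>X\<^esub> x"
  using inj_psi by (simp add: act_def the_inv_into_f_f)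

lemma left_module_lid:
  assumes "submod L" shows "left_module A (lid L)"
proof -
  have L: "0 \<in> L" "x \<in> L \<Longrightarrow> y \<in> L \<Longrightarrow> x + y \<in> L" "r \<in> carrier A \<Longrightarrow> x \<in> L \<Longrightarrow> \<psi> r * x \<in> L"
    "x \<in> L \<Longrightarrow> - x \<in> L" for x y r
    using assms submod_minus[of L] by (auto simp: submod_def S_def)
  interpret M: abelian_group "lid L"
  proof (rule abelian_groupI, goal_cases)
    case (6 u)
    then obtain x where "x \<in> L" "u = \<kappa> x" by (auto simp: lid_def)
    then show ?case using L(4) by (intro bexI[of _ "\<kappa> (- x)"]) (auto simp: lid_def)
  qed (auto simp: lid_def L algebra_simps)
  show ?thesis
    by unfold_locales
      (auto simp: lid_def L psi_add psi_mult psi_one distrib_right distrib_left mult.assoc)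
qed

lemma lid_obj: "submod L \<Longrightarrow> lid L \<in> lc_obj lmod"
  by (simp add: lmod_simps left_module_lid)

lemma reg_obj: "reg \<in> lc_obj lmod"
  by (simp add: lid_obj submod_S)

lemma act_lid: "s \<in> S \<Longrightarrow> act (lid L) s (\<kappa> x) = \<kappa> (s * x)"
  by (auto simp: S_def act_psi) (simp add: lid_def)

context
  fixes X assumes X: "X \<in> lc_obj lmod"
begin

interpretation X: left_module A X using X by (simp add: lmod_simps)

lemma act_closed: "s \<in> S \<Longrightarrow> x \<in> carrier X \<Longrightarrow> act X s x \<in> carrier X"
  by (auto simp: S_def act_psi X.lsmult_closed)

lemma act_one: "x \<in> carrier X \<Longrightarrow> act X 1 x = x"
  using act_psi[of \<one> X x] by (simp add: psi_one X.lsmult_one)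

lemma act_add: "s \<in> S \<Longrightarrow> t \<in> S \<Longrightarrow> x \<in> carrier X \<Longrightarrow> act X (s + t) x = act X s x \<oplus>\<^bsub>X\<^esub> act X t x"
  by (auto simp: S_def psi_add[symmetric] act_psi X.lsmult_l_distr)

lemma act_mult: "s \<in> S \<Longrightarrow> t \<in> S \<Longrightarrow> x \<in> carrier X \<Longrightarrow> act X (s * t) x = act X s (act X t x)"
  by (auto simp: S_def psi_mult[symmetric] act_psi X.lsmult_assoc)

lemma hom_act:
  assumes "f \<in> lc_hom lmod X Y" "s \<in> S" "x \<in> carrier X"
  shows "f (act X s x) = act Y s (f x)"
  using assms left_module_homD(4) by (auto simp: S_def lmod_simps act_psi)

lemma rmap_hom: "x \<in> carrier X \<Longrightarrow> rmap X x \<in> lc_hom lmod reg X"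
  unfolding lmod_simps left_module_hom_def rmap_def
  by (auto simp: lid_def S_closed psi_S act_closed act_add act_mult act_psi)

lemma rmap_one: "x \<in> carrier X \<Longrightarrow> rmap X x (\<kappa> 1) = x"
  by (simp add: rmap_def lid_def S_closed act_one)

lemma hom_reg_ext:
  assumes "f \<in> lc_hom lmod reg X" "g \<in> lc_hom lmod reg X" "f (\<kappa> 1) = g (\<kappa> 1)"
  shows "f = g"
proof (rule extensionalityI[of _ "carrier reg"])
  show "f \<in> extensional (carrier reg)" "g \<in> extensional (carrier reg)"
    using assms by (auto simp: lmod_simps left_module_homD)
  fix u assume "u \<in> carrier reg"
  then obtain s where s: "u = \<kappa> s" "s \<in> S" by (auto simp: lid_def)
  have *: "h u = act X s (h (\<kappa> 1))" if "h \<in> lc_hom lmod reg X" for h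
  proof -
    have "h (act reg s (\<kappa> 1)) = act X s (h (\<kappa> 1))"
      using that s left_module_homD(4)[of h A reg X _ "\<kappa> 1"] S_closed(2)
      by (auto simp: S_def lmod_simps act_psi) (simp add: S_def lid_def)
    then show ?thesis using s by (simp add: act_lid)
  qed
  show "f u = g u" using *[OF assms(1)] *[OF assms(2)] assms(3) by simp
qed

lemma hom_carrier: "f \<in> lc_hom lmod Y X \<Longrightarrow> y \<in> carrier Y \<Longrightarrow> f y \<in> carrier X"
  by (simp add: lmod_simps left_module_homD)

lemma lc_zero_lmod: "Y \<in> lc_obj lmod \<Longrightarrow> lc_zero lmod Y X = (\<lambda>y\<in>carrier Y. \<zero>\<^bsub>X\<^esub>)"
proof -
  assume Y: "Y \<in> lc_obj lmod"
  then interpret Y: left_module A Y by (simp add: lmod_simps)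
  have "lc_add lmod Y X (\<lambda>y\<in>carrier Y. \<zero>\<^bsub>X\<^esub>) (\<lambda>y\<in>carrier Y. \<zero>\<^bsub>X\<^esub>) = (\<lambda>y\<in>carrier Y. \<zero>\<^bsub>X\<^esub>)"
    by (auto simp: lmod_simps(5) fun_eq_iff)
  moreover have "(\<lambda>y\<in>carrier Y. \<zero>\<^bsub>X\<^esub>) \<in> lc_hom lmod Y X"
    by (auto simp: lmod_simps left_module_hom_def Y.lsmult_closed X.lsmult_zero)
  ultimately show ?thesis using lmod.add_self_zero[OF Y X] by metis
qed

lemma lc_sum_lmod:
  assumes "Y \<in> lc_obj lmod" "y \<in> carrier Y"
  shows "lc_sum lmod Y X fs y = foldr (\<lambda>f z. f y \<oplus>\<^bsub>X\<^esub> z) fs \<zero>\<^bsub>X\<^esub>"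
  using assms by (induction fs) (simp_all add: lc_sum_def lc_zero_lmod lmod_simps(5))

lemma hom_zero: "Y \<in> lc_obj lmod \<Longrightarrow> f \<in> lc_hom lmod X Y \<Longrightarrow> f \<zero>\<^bsub>X\<^esub> = \<zero>\<^bsub>Y\<^esub>"
proof -
  assume Y: "Y \<in> lc_obj lmod" and f: "f \<in> lc_hom lmod X Y"
  then interpret Y: left_module A Y by (simp add: lmod_simps)
  have "f \<zero>\<^bsub>X\<^esub> \<oplus>\<^bsub>Y\<^esub> f \<zero>\<^bsub>X\<^esub> = f \<zero>\<^bsub>X\<^esub>" "f \<zero>\<^bsub>X\<^esub> \<in> carrier Y"
    using f left_module_homD(2,3)[of f A X Y "\<zero>\<^bsub>X\<^esub>"] by (force simp: lmod_simps)+
  then show ?thesis using Y.M.add.r_cancel_one' by metis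
qed

end

lemma separating_reg: "separating lmod reg"
  unfolding separating_def
proof (intro ballI impI)
  fix X Y f g
  assume X: "X \<in> lc_obj lmod" and Y: "Y \<in> lc_obj lmod" and f: "f \<in> lc_hom lmod X Y" and g: "g \<in> lc_hom lmod X Y"
    and *: "\<forall>h\<in>lc_hom lmod reg X. lc_comp lmod reg X Y f h = lc_comp lmod reg X Y g h"
  show "f = g"
  proof (rule extensionalityI[of _ "carrier X"])
    show "f \<in> extensional (carrier X)" "g \<in> extensional (carrier X)"
      using f g by (auto simp: lmod_simps left_module_homD)
    fix x assume x: "x \<in> carrier X"
    have "\<kappa> 1 \<in> carrier reg" by (simp add: lid_def S_closed)
    with * rmap_hom[OF X x] rmap_one[OF X x] show "f x = g x"
      by (metis (mono_tags, lifting) lmod_simps(4) compose_eq)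
  qed
qed

lemma foldr_lid:
  "foldr (\<lambda>f z. f u \<oplus>\<^bsub>lid L\<^esub> z) fs \<zero>\<^bsub>lid L\<^esub> = \<kappa> (\<Sum>f\<leftarrow>fs. kinv (f u))"
  by (induction fs) (simp_all add: lid_def)

lemma lc_sum_lid:
  assumes "submod L" "Y \<in> lc_obj lmod" "y \<in> carrier Y"
  shows "lc_sum lmod Y (lid L) fs y = \<kappa> (\<Sum>f\<leftarrow>fs. kinv (f y))"
  using lc_sum_lmod[OF lid_obj[OF assms(1)] assms(2,3)] by (simp add: foldr_lid)

text \<open>
  The trace ideal of a separating module \<open>Q\<close> is everything, because \<open>Q\<close> cannot distinguish
  the projection of \<open>A\<close> modulo the trace ideal from zero.
\<close>

lemma decomposition_reg:
  assumes Q: "Q \<in> lc_obj lmod" and sep: "separating lmod Q"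
  obtains ps where "decomposition lmod Q reg ps"
proof -
  define T where "T = {(\<Sum>(h, q)\<leftarrow>hs. kinv (h q)) | hs. set hs \<subseteq> lc_hom lmod Q reg \<times> carrier Q}"
  have hq: "kinv (h q) \<in> S" if "h \<in> lc_hom lmod Q reg" "q \<in> carrier Q" for h q
    using hom_carrier[OF reg_obj that] by (auto simp: lid_def)
  have T: "submod T"
    unfolding submod_def
  proof (intro conjI ballI)
    show "0 \<in> T" by (auto simp: T_def intro!: exI[of _ "[]"])
    fix x y assume "x \<in> T" "y \<in> T"
    then obtain hs ks where "x = (\<Sum>(h, q)\<leftarrow>hs. kinv (h q))" "y = (\<Sum>(h, q)\<leftarrow>ks. kinv (h q))"
      "set hs \<subseteq> lc_hom lmod Q reg \<times> carrier Q" "set ks \<subseteq> lc_hom lmod Q reg \<times> carrier Q"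
      unfolding T_def by auto
    then show "x + y \<in> T"
      unfolding T_def by (intro CollectI exI[of _ "hs @ ks"]) auto
  next
    fix s x assume s: "s \<in> S" and "x \<in> T"
    then obtain hs where x: "x = (\<Sum>(h, q)\<leftarrow>hs. kinv (h q))"
      "set hs \<subseteq> lc_hom lmod Q reg \<times> carrier Q" unfolding T_def by auto
    have "kinv (h (act Q s q)) = s * kinv (h q)" if "h \<in> lc_hom lmod Q reg" "q \<in> carrier Q" for h q
      using hom_act[OF Q that(1) s that(2)] act_lid[OF s] hom_carrier[OF reg_obj that]
      by (auto simp: lid_def)
    then have "s * x = (\<Sum>(h, q)\<leftarrow>map (\<lambda>(h, q). (h, act Q s q)) hs. kinv (h q))"
      using x by (fastforce simp: sum_list_const_mult[symmetric] intro!: arg_cong[where f = sum_list])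
    moreover have "set (map (\<lambda>(h, q). (h, act Q s q)) hs) \<subseteq> lc_hom lmod Q reg \<times> carrier Q"
      using x(2) s act_closed[OF Q] by auto
    ultimately show "s * x \<in> T" unfolding T_def by blast
  qed
  have T0: "0 \<in> T" and Tadd: "x \<in> T \<Longrightarrow> y \<in> T \<Longrightarrow> x + y \<in> T"
    and Tmult: "s \<in> S \<Longrightarrow> x \<in> T \<Longrightarrow> s * x \<in> T" and Tm: "x \<in> T \<Longrightarrow> - x \<in> T" for x y s
    using T submod_minus[OF T] by (auto simp: submod_def)
  have Tdiff: "x \<in> T \<Longrightarrow> y \<in> T \<Longrightarrow> x - y \<in> T" for x y
    using Tadd[of x "- y"] Tm by simp
  define \<rho> where "\<rho> x = (SOME y. y \<in> S \<and> y - x \<in> T)" for x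
  have \<rho>: "\<rho> x \<in> S" "\<rho> x - x \<in> T" if "x \<in> S" for x
  proof -
    have "x \<in> S \<and> x - x \<in> T" using that T0 by simp
    then have "\<rho> x \<in> S \<and> \<rho> x - x \<in> T" unfolding \<rho>_def by (rule someI)
    then show "\<rho> x \<in> S" "\<rho> x - x \<in> T" by auto
  qed
  have \<rho>_eq: "\<rho> x = \<rho> y" if "x - y \<in> T" for x y
  proof -
    have "z - x \<in> T \<longleftrightarrow> z - y \<in> T" for z
      using Tadd[of "z - x" "x - y"] Tdiff[of "z - y" "x - y"] that by auto
    then show ?thesis by (simp add: \<rho>_def)
  qed
  define N :: "('a, 'u) module" where
    "N = \<lparr>carrier = \<kappa> ` \<rho> ` S, monoid.mult = undefined, one = undefined, zero = \<kappa> (\<rho> 0),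
     add = (\<lambda>u v. \<kappa> (\<rho> (kinv u + kinv v))), smult = (\<lambda>r u. \<kappa> (\<rho> (\<psi> r * kinv u)))\<rparr>"
  have N_add: "\<kappa> (\<rho> x) \<oplus>\<^bsub>N\<^esub> \<kappa> (\<rho> y) = \<kappa> (\<rho> (x + y))" if "x \<in> S" "y \<in> S" for x y
  proof -
    have "\<rho> x + \<rho> y - (x + y) \<in> T"
      using Tadd[OF \<rho>(2)[OF that(1)] \<rho>(2)[OF that(2)]] by (simp add: algebra_simps)
    then show ?thesis using \<rho>_eq by (simp add: N_def)
  qed
  have N_smult: "r \<odot>\<^bsub>N\<^esub> \<kappa> (\<rho> x) = \<kappa> (\<rho> (\<psi> r * x))" if "r \<in> carrier A" "x \<in> S" for r x
  proof -
    have "\<psi> r * \<rho> x - \<psi> r * x \<in> T"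
      using Tmult[OF _ \<rho>(2)[OF that(2)], of "\<psi> r"] that by (simp add: algebra_simps S_def)
    then show ?thesis using \<rho>_eq by (simp add: N_def)
  qed
  have NC: "carrier N = \<kappa> ` \<rho> ` S" "\<zero>\<^bsub>N\<^esub> = \<kappa> (\<rho> 0)" by (simp_all add: N_def)
  have psiS: "\<psi> r \<in> S" if "r \<in> carrier A" for r using that by (simp add: S_def)
  have N: "N \<in> lc_obj lmod"
  proof -
    interpret N: abelian_group N
    proof (rule abelian_groupI, goal_cases)
      case (6 u)
      then obtain x where "x \<in> S" "u = \<kappa> (\<rho> x)" by (auto simp: NC)
      then show ?case using S_closed
        by (intro bexI[of _ "\<kappa> (\<rho> (- x))"]) (auto simp: NC N_add)
    qed (auto simp: NC N_add S_closed algebra_simps)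
    have "left_module A N"
      by unfold_locales
        (auto simp: NC N_add N_smult S_closed psiS psi_add psi_mult psi_one distrib_right distrib_left mult.assoc)
    then show ?thesis by (simp add: lmod_simps)
  qed
  define p where "p = (\<lambda>u\<in>carrier reg. \<kappa> (\<rho> (kinv u)))"
  define z where "z = (\<lambda>u\<in>carrier reg. \<kappa> (\<rho> 0))"
  have p: "p \<in> lc_hom lmod reg N"
    unfolding lmod_simps left_module_hom_def p_def
    by (auto simp: lid_def S_closed psiS) (auto simp: NC N_add N_smult)
  have z: "z \<in> lc_hom lmod reg N"
    using lmod.zero_hom[OF reg_obj N] lc_zero_lmod[OF N reg_obj] by (simp add: z_def NC)
  have "compose (carrier Q) p h = compose (carrier Q) z h" if h: "h \<in> lc_hom lmod Q reg" for h
  proof (rule extensionalityI[of _ "carrier Q"])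
    fix q assume q: "q \<in> carrier Q"
    then have "h q \<in> carrier reg" using hom_carrier[OF reg_obj h] by simp
    moreover have "kinv (h q) \<in> T" unfolding T_def
      using h q by (intro CollectI exI[of _ "[(h, q)]"]) simp
    ultimately show "compose (carrier Q) p h q = compose (carrier Q) z h q"
      using q \<rho>_eq[of "kinv (h q)" 0] by (simp add: compose_eq p_def z_def)
  qed (simp_all add: compose_def)
  then have "p = z"
    using sep reg_obj N p z unfolding separating_def by (simp add: lmod_simps(4))
  then have "p (\<kappa> 1) = z (\<kappa> 1)" by simp
  then have "\<rho> 1 = \<rho> 0" using inj_kappa by (simp add: p_def z_def lid_def S_closed inj_eq)
  then have "1 \<in> T" using Tdiff[OF \<rho>(2)[of 0] \<rho>(2)[of 1]] S_closed by simp
  then obtain hs where hs: "1 = (\<Sum>(h, q)\<leftarrow>hs. kinv (h q))"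
    "set hs \<subseteq> lc_hom lmod Q reg \<times> carrier Q" unfolding T_def by auto
  have one: "\<kappa> 1 \<in> carrier reg" by (simp add: lid_def S_closed)
  have "lc_sum lmod reg reg (map (\<lambda>(u, v). lc_comp lmod reg Q reg u v) (map (\<lambda>(h, q). (h, rmap Q q)) hs))
    = lc_id lmod reg"
  proof (rule hom_reg_ext[OF reg_obj])
    have cs: "lc_comp lmod reg Q reg h (rmap Q q) \<in> lc_hom lmod reg reg" if "(h, q) \<in> set hs" for h q
      using that hs(2) lmod.comp_hom[OF reg_obj Q reg_obj rmap_hom[OF Q]] by auto
    then show "lc_sum lmod reg reg (map (\<lambda>(u, v). lc_comp lmod reg Q reg u v) (map (\<lambda>(h, q). (h, rmap Q q)) hs))
      \<in> lc_hom lmod reg reg" by (intro lmod.lc_sum_hom reg_obj) auto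
    show "lc_id lmod reg \<in> lc_hom lmod reg reg" by (rule lmod.id_hom[OF reg_obj])
    have "map (\<lambda>f. kinv (f (\<kappa> 1))) (map (\<lambda>(u, v). lc_comp lmod reg Q reg u v) (map (\<lambda>(h, q). (h, rmap Q q)) hs))
      = map (\<lambda>(h, q). kinv (h q)) hs"
      using hs(2) one rmap_one[OF Q] by (auto simp: lmod_simps(4) compose_eq)
    then show "lc_sum lmod reg reg (map (\<lambda>(u, v). lc_comp lmod reg Q reg u v) (map (\<lambda>(h, q). (h, rmap Q q)) hs)) (\<kappa> 1)
      = lc_id lmod reg (\<kappa> 1)"
      using hs(1) one by (simp only: lc_sum_lid[OF submod_S reg_obj one] lmod_simps(3) restrict_apply')
  qed
  moreover have "set (map (\<lambda>(h, q). (h, rmap Q q)) hs) \<subseteq> lc_hom lmod Q reg \<times> lc_hom lmod reg Q"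
    using hs(2) rmap_hom[OF Q] by auto
  ultimately show ?thesis using that unfolding decomposition_def by blast
qed

lemma kappa_one_reg: "\<kappa> 1 \<in> carrier reg"
  by (simp add: lid_def S_closed)

lemma kinv_reg: "u \<in> carrier reg \<Longrightarrow> kinv u \<in> S" "u \<in> carrier (lid L) \<Longrightarrow> \<kappa> (kinv u) = u"
  by (auto simp: lid_def)

lemma rmap_apply: "s \<in> S \<Longrightarrow> rmap X x (\<kappa> s) = act X s x"
  by (simp add: rmap_def lid_def)

lemma hom_reg_apply:
  assumes "X \<in> lc_obj lmod" "f \<in> lc_hom lmod reg X" "s \<in> S"
  shows "f (\<kappa> s) = act X s (f (\<kappa> 1))"
  using hom_act[OF reg_obj assms(2,3) kappa_one_reg] act_lid[OF assms(3), of S 1] by simp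

lemma elt_S: "f \<in> lc_hom lmod reg reg \<Longrightarrow> elt f \<in> S"
  using hom_carrier[OF reg_obj _ kappa_one_reg] by (auto simp: elt_def kinv_reg)

lemma elt_apply: "f \<in> lc_hom lmod reg reg \<Longrightarrow> s \<in> S \<Longrightarrow> f (\<kappa> s) = \<kappa> (s * elt f)"
  using hom_reg_apply[OF reg_obj, of f s] act_lid[of s S "elt f"] kinv_reg(2)
    hom_carrier[OF reg_obj _ kappa_one_reg, of f] by (simp add: elt_def)

lemma elt_comp:
  assumes "f \<in> lc_hom lmod reg reg" "g \<in> lc_hom lmod reg reg"
  shows "elt (lc_comp lmod reg reg reg f g) = elt g * elt f"
proof -
  have "elt (lc_comp lmod reg reg reg f g) = kinv (f (g (\<kappa> 1)))"
    by (simp add: elt_def lmod_simps(4) compose_eq[OF kappa_one_reg])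
  also have "g (\<kappa> 1) = \<kappa> (elt g)" using elt_apply[OF assms(2) S_closed(2)] by simp
  finally show ?thesis using elt_apply[OF assms(1) elt_S[OF assms(2)]] by simp
qed

lemma elt_add: "elt (lc_add lmod reg reg f g) = elt f + elt g"
  by (simp add: elt_def lmod_simps(5) kappa_one_reg) (simp add: lid_def)

lemma elt_scale: "elt (lc_scale lmod reg reg c f) = \<psi> (c \<odot> \<one>) * elt f"
  by (simp add: elt_def lmod_simps(6) kappa_one_reg) (simp add: lid_def)

lemma elt_rmap: "s \<in> S \<Longrightarrow> elt (rmap reg (\<kappa> s)) = s"
  using rmap_one[OF reg_obj, of "\<kappa> s"] by (simp add: elt_def lid_def)

lemma rmap_reg_hom: "s \<in> S \<Longrightarrow> rmap reg (\<kappa> s) \<in> lc_hom lmod reg reg"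
  by (rule rmap_hom[OF reg_obj]) (simp add: lid_def)

lemma elt_inj:
  assumes "f \<in> lc_hom lmod reg reg" "g \<in> lc_hom lmod reg reg" "elt f = elt g"
  shows "f = g"
  using elt_apply[OF assms(1) S_closed(2)] elt_apply[OF assms(2) S_closed(2)] assms
  by (intro hom_reg_ext[OF reg_obj]) auto

lemma scalar_S: "\<psi> (c \<odot> \<one>) \<in> S"
  by (simp add: psi_S scale_closed)

definition trace_on :: "('s \<Rightarrow> 'k) \<Rightarrow> bool" where
  "trace_on \<phi> \<longleftrightarrow> (\<forall>x\<in>S. \<forall>y\<in>S. \<phi> (x + y) = \<phi> x + \<phi> y) \<and>
     (\<forall>c. \<forall>x\<in>S. \<phi> (\<psi> (c \<odot> \<one>) * x) = c * \<phi> x) \<and> (\<forall>x\<in>S. \<forall>y\<in>S. \<phi> (x * y) = \<phi> (y * x))"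

lemma trace_functional_elt:
  assumes "trace_on \<phi>"
  shows "trace_functional lmod reg (\<lambda>f. \<phi> (elt f))"
  using assms unfolding trace_functional_def lc_functional_def trace_on_def
  by (simp add: elt_comp elt_add elt_scale elt_S)

lemma trace_on_rmap:
  assumes "trace_functional lmod reg \<Phi>"
  shows "trace_on (\<lambda>s. \<Phi> (rmap reg (\<kappa> s)))"
proof -
  note h = rmap_reg_hom lmod.add_hom[OF reg_obj reg_obj] lmod.scale_hom[OF reg_obj reg_obj]
    lmod.comp_hom[OF reg_obj reg_obj reg_obj] S_closed scalar_S
  have "rmap reg (\<kappa> (x + y)) = lc_add lmod reg reg (rmap reg (\<kappa> x)) (rmap reg (\<kappa> y))"
    if "x \<in> S" "y \<in> S" for x y
    using that by (intro elt_inj h) (simp_all add: elt_add elt_rmap h)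
  moreover have "rmap reg (\<kappa> (\<psi> (c \<odot> \<one>) * x)) = lc_scale lmod reg reg c (rmap reg (\<kappa> x))"
    if "x \<in> S" for x c
    using that by (intro elt_inj h) (simp_all add: elt_scale elt_rmap h)
  moreover have "rmap reg (\<kappa> (x * y)) = lc_comp lmod reg reg reg (rmap reg (\<kappa> y)) (rmap reg (\<kappa> x))"
    if "x \<in> S" "y \<in> S" for x y
    using that by (intro elt_inj h) (simp_all add: elt_comp elt_rmap h)
  ultimately show ?thesis
    using assms unfolding trace_functional_def lc_functional_def trace_on_def
    by (simp add: rmap_reg_hom)
qed

definition dual_basis :: "'s set \<Rightarrow> ('s \<times> ('s \<Rightarrow> 's)) list \<Rightarrow> bool" where
  "dual_basis L gws \<longleftrightarrow> (\<forall>(g, w)\<in>set gws. g \<in> L \<and> (\<forall>z\<in>L. w z \<in> S) \<and>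
       (\<forall>y\<in>L. \<forall>z\<in>L. w (y + z) = w y + w z) \<and> (\<forall>s\<in>S. \<forall>z\<in>L. w (s * z) = s * w z)) \<and>
     (\<forall>z\<in>L. z = (\<Sum>(g, w)\<leftarrow>gws. w z * g))"

lemma trace_on_sum_list:
  assumes "trace_on \<phi>" "\<And>x. x \<in> set xs \<Longrightarrow> f x \<in> S"
  shows "\<phi> (\<Sum>x\<leftarrow>xs. f x) = (\<Sum>x\<leftarrow>xs. \<phi> (f x))"
proof -
  have "\<phi> 0 = \<phi> 0 + \<phi> 0"
    using assms(1) S_closed(1) unfolding trace_on_def by (metis add.right_neutral)
  then have "\<phi> 0 = 0" by (metis add_cancel_right_right)
  then show ?thesis
    using assms(2) assms(1) submod_sum[OF submod_S, of _ f] unfolding trace_on_def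
    by (induction xs) auto
qed

lemma act_zero:
  assumes "X \<in> lc_obj lmod" "x \<in> carrier X"
  shows "act X 0 x = \<zero>\<^bsub>X\<^esub>"
proof -
  interpret X: left_module A X using assms by (simp add: lmod_simps)
  have "act X 0 x = act X 0 x \<oplus>\<^bsub>X\<^esub> act X 0 x"
    using act_add[OF assms(1) S_closed(1) S_closed(1) assms(2)] by simp
  then show ?thesis
    using X.M.add.r_cancel_one'[OF act_closed[OF assms(1) S_closed(1) assms(2)] act_closed[OF assms(1) S_closed(1) assms(2)]]
    by simp
qed

lemma uniform_hom_reg_injective:
  assumes dom: "\<And>x y. x \<in> S \<Longrightarrow> y \<in> S \<Longrightarrow> x * y = 0 \<Longrightarrow> x = 0 \<or> y = 0"
    and X: "X \<in> lc_obj lmod" and uni: "uniform lmod reg X"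
    and v: "v \<in> lc_hom lmod X reg" and y: "y \<in> carrier X" "v y \<noteq> \<kappa> 0"
  shows "inj_on v (carrier X)"
proof -
  interpret X: left_module A X using X by (simp add: lmod_simps)
  have v_act: "v (act X s x) = \<kappa> (s * kinv (v x))" if "s \<in> S" "x \<in> carrier X" for s x
    using hom_act[OF X v that] act_lid[OF that(1), of S "kinv (v x)"] kinv_reg(2) hom_carrier[OF reg_obj v that(2)]
    by simp
  have rm: "rmap X x \<noteq> lc_zero lmod reg X" if "x \<in> carrier X" "x \<noteq> \<zero>\<^bsub>X\<^esub>" for x
    using rmap_one[OF X that(1)] that(2) by (auto simp: lc_zero_lmod[OF X reg_obj] kappa_one_reg)
  have v0: "v \<zero>\<^bsub>X\<^esub> = \<kappa> 0" using hom_zero[OF X reg_obj v] by (simp add: lid_def)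
  have ker: "x = \<zero>\<^bsub>X\<^esub>" if x: "x \<in> carrier X" "v x = \<kappa> 0" for x
  proof (rule ccontr)
    assume "x \<noteq> \<zero>\<^bsub>X\<^esub>"
    moreover have "y \<noteq> \<zero>\<^bsub>X\<^esub>" using y v0 by auto
    ultimately obtain f g where f: "f \<in> lc_hom lmod reg reg" and g: "g \<in> lc_hom lmod reg reg"
      and eq: "lc_comp lmod reg reg X (rmap X x) f = lc_comp lmod reg reg X (rmap X y) g"
      and ne: "lc_comp lmod reg reg X (rmap X x) f \<noteq> lc_zero lmod reg X"
      using uni rm x(1) y(1) rmap_hom[OF X] unfolding uniform_def by metis
    have val: "lc_comp lmod reg reg X (rmap X z) h (\<kappa> 1) = act X (elt h) z"
      if "h \<in> lc_hom lmod reg reg" for h z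
      using elt_apply[OF that S_closed(2)] elt_S[OF that]
      by (simp add: lmod_simps(4) compose_eq[OF kappa_one_reg] rmap_apply)
    have e: "act X (elt f) x = act X (elt g) y" using val[OF f, of x] val[OF g, of y] eq by simp
    have "v (act X (elt f) x) = \<kappa> 0" using v_act[OF elt_S[OF f] x(1)] x(2) by simp
    then have "elt g * kinv (v y) = 0"
      using v_act[OF elt_S[OF g] y(1)] e inj_kappa by (simp add: inj_eq)
    moreover have "kinv (v y) \<noteq> 0" using y kinv_reg(2) hom_carrier[OF reg_obj v y(1)] by metis
    moreover have "kinv (v y) \<in> S" using kinv_reg(1) hom_carrier[OF reg_obj v y(1)] by simp
    ultimately have "elt g = 0" using dom elt_S[OF g] by blast
    then have "lc_comp lmod reg reg X (rmap X y) g (\<kappa> 1) = \<zero>\<^bsub>X\<^esub>"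
      using val[OF g] act_zero[OF X y(1)] by simp
    then have "lc_comp lmod reg reg X (rmap X y) g = lc_zero lmod reg X"
      using lmod.comp_hom[OF reg_obj reg_obj X g rmap_hom[OF X y(1)]] lmod.zero_hom[OF reg_obj X]
      by (intro hom_reg_ext[OF X]) (simp_all add: lc_zero_lmod[OF X reg_obj] kappa_one_reg)
    with eq ne show False by simp
  qed
  show ?thesis
  proof (rule inj_onI)
    fix x x' assume x: "x \<in> carrier X" "x' \<in> carrier X" "v x = v x'"
    let ?m = "act X (- 1) x'"
    have m: "?m \<in> carrier X" using act_closed[OF X _ x(2)] S_closed by simp
    have "v (x \<oplus>\<^bsub>X\<^esub> ?m) = v x \<oplus>\<^bsub>reg\<^esub> v ?m"
      using v m x by (simp add: lmod_simps left_module_homD)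
    also have "\<dots> = \<kappa> 0" using v_act[of "- 1" x'] x S_closed by (simp add: lid_def)
    finally have "x \<oplus>\<^bsub>X\<^esub> ?m = \<zero>\<^bsub>X\<^esub>" using ker m x by simp
    moreover have "?m \<oplus>\<^bsub>X\<^esub> x' = \<zero>\<^bsub>X\<^esub>"
      using act_add[OF X S_closed(5)[OF S_closed(2)] S_closed(2) x(2)] act_one[OF X x(2)] act_zero[OF X x(2)] by simp
    ultimately show "x = x'"
      using m x by (metis X.M.a_assoc X.M.l_zero X.M.r_zero)
  qed
qed

lemma uniform_dual_basis:
  assumes dom: "\<And>x y. x \<in> S \<Longrightarrow> y \<in> S \<Longrightarrow> x * y = 0 \<Longrightarrow> x = 0 \<or> y = 0"
    and X: "X \<in> lc_obj lmod" and uni: "uniform lmod reg X" and ps: "decomposition lmod reg X ps"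
  obtains L gws where "submod L" "L \<subseteq> S" "L \<noteq> {0}" "dual_basis L gws"
    "\<And>\<phi>. trace_on \<phi> \<Longrightarrow>
      hs_trace lmod reg X ps (\<lambda>f. \<phi> (elt f)) (lc_id lmod X) = \<phi> (\<Sum>(g, w)\<leftarrow>gws. w g)"
proof -
  interpret X: left_module A X using X by (simp add: lmod_simps)
  have uv: "u \<in> lc_hom lmod reg X" "v \<in> lc_hom lmod X reg" if "(u, v) \<in> set ps" for u v
    using ps that by (auto simp: decomposition_def)
  have "\<exists>(u, v)\<in>set ps. \<exists>y\<in>carrier X. v y \<noteq> \<kappa> 0"
  proof (rule ccontr)
    assume neg: "\<not> ?thesis"
    have "f x = \<zero>\<^bsub>X\<^esub>" if f: "f \<in> set (map (\<lambda>(u, v). lc_comp lmod X reg X u v) ps)" and x: "x \<in> carrier X" for f x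
    proof -
      obtain u v where f: "(u, v) \<in> set ps" "f = lc_comp lmod X reg X u v" using f by auto
      then have "f x = u (\<kappa> 0)" using neg x by (auto simp: lmod_simps(4) compose_eq)
      then show ?thesis using hom_zero[OF reg_obj X uv(1)[OF f(1)]] by (simp add: lid_def)
    qed
    moreover have "foldr (\<lambda>f z. f x \<oplus>\<^bsub>X\<^esub> z) fs \<zero>\<^bsub>X\<^esub> = \<zero>\<^bsub>X\<^esub>"
      if "\<forall>f\<in>set fs. f x = \<zero>\<^bsub>X\<^esub>" for fs x
      using that by (induction fs) simp_all
    ultimately have z: "foldr (\<lambda>f z. f x \<oplus>\<^bsub>X\<^esub> z) (map (\<lambda>(u, v). lc_comp lmod X reg X u v) ps) \<zero>\<^bsub>X\<^esub> = \<zero>\<^bsub>X\<^esub>"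
      if "x \<in> carrier X" for x
      using that by metis
    have "lc_id lmod X x = \<zero>\<^bsub>X\<^esub>" if "x \<in> carrier X" for x
      using z[OF that] lc_sum_lmod[OF X X that] ps unfolding decomposition_def by metis
    then have "lc_id lmod X = lc_zero lmod X X"
      by (auto simp: lc_zero_lmod[OF X X] lmod_simps(3))
    with uni show False by (simp add: uniform_def)
  qed
  then obtain u0 v y where v: "(u0, v) \<in> set ps" and y: "y \<in> carrier X" "v y \<noteq> \<kappa> 0" by auto
  note vh = uv(2)[OF v]
  define j where "j x = kinv (v x)" for x
  have vj: "v x = \<kappa> (j x)" "j x \<in> S" if "x \<in> carrier X" for x
    using hom_carrier[OF reg_obj vh that] kinv_reg by (auto simp: j_def)
  have inj: "inj_on j (carrier X)"
    using uniform_hom_reg_injective[OF dom X uni vh y] vj(1) by (metis inj_on_def)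
  have j_add: "j (x \<oplus>\<^bsub>X\<^esub> x') = j x + j x'" if "x \<in> carrier X" "x' \<in> carrier X" for x x'
    using vh that by (simp add: lmod_simps left_module_homD j_def) (simp add: lid_def)
  have j_act: "j (act X s x) = s * j x" if "s \<in> S" "x \<in> carrier X" for s x
    using hom_act[OF X vh that] act_lid[OF that(1), of S "j x"] by (simp add: vj(1)[OF that(2)] j_def[of "act X s x"])
  have j_zero: "j \<zero>\<^bsub>X\<^esub> = 0" using hom_zero[OF X reg_obj vh] by (simp add: lid_def j_def)
  define i where "i = the_inv_into (carrier X) j"
  have ij: "i (j x) = x" if "x \<in> carrier X" for x
    using that inj by (simp add: i_def the_inv_into_f_f)
  define L where "L = j ` carrier X"
  define gws where "gws = map (\<lambda>(u, v). (j (u (\<kappa> 1)), \<lambda>z. kinv (v (i z)))) ps"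
  have uc: "u (\<kappa> 1) \<in> carrier X" if "(u, v) \<in> set ps" for u v
    using hom_carrier[OF X uv(1)[OF that] kappa_one_reg] .
  show ?thesis
  proof (rule that)
    show L: "submod L"
      unfolding submod_def L_def
      using j_zero j_add[symmetric] j_act[symmetric] act_closed[OF X]
      by (auto intro!: imageI intro: rev_image_eqI[of "\<zero>\<^bsub>X\<^esub>"])
    show "L \<subseteq> S" using vj by (auto simp: L_def)
    have "j y \<noteq> 0" using y vj by auto
    then show "L \<noteq> {0}" using y by (auto simp: L_def)
    show "dual_basis L gws"
      unfolding dual_basis_def
    proof (intro conjI ballI)
      fix p assume "p \<in> set gws"
      then obtain u v where p: "(u, v) \<in> set ps" "p = (j (u (\<kappa> 1)), \<lambda>z. kinv (v (i z)))"
        by (auto simp: gws_def)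
      note v' = uv(2)[OF p(1)]
      have "kinv (v (i (y + z))) = kinv (v (i y)) + kinv (v (i z))" if yz: "y \<in> L" "z \<in> L" for y z
      proof -
        obtain a b where ab: "a \<in> carrier X" "b \<in> carrier X" "y = j a" "z = j b"
          using yz by (auto simp: L_def)
        then show ?thesis using v'
          by (simp add: j_add[symmetric] ij lmod_simps left_module_homD) (simp add: lid_def)
      qed
      moreover have "kinv (v (i (s * z))) = s * kinv (v (i z))" if s: "s \<in> S" "z \<in> L" for s z
      proof -
        obtain b where b: "b \<in> carrier X" "z = j b" using s(2) by (auto simp: L_def)
        have "v b = \<kappa> (kinv (v b))" using kinv_reg(2) hom_carrier[OF reg_obj v' b(1)] by simp
        then show ?thesis
          using hom_act[OF X v' s(1) b(1)] act_lid[OF s(1), of S "kinv (v b)"] b s act_closed[OF X]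
          by (simp add: j_act[symmetric] ij)
      qed
      moreover have "kinv (v (i z)) \<in> S" if "z \<in> L" for z
        using that ij kinv_reg(1) hom_carrier[OF reg_obj v'] by (auto simp: L_def)
      ultimately show "case p of (g, w) \<Rightarrow> g \<in> L \<and> (\<forall>z\<in>L. w z \<in> S) \<and>
         (\<forall>y\<in>L. \<forall>z\<in>L. w (y + z) = w y + w z) \<and> (\<forall>s\<in>S. \<forall>z\<in>L. w (s * z) = s * w z)"
        using uc[OF p(1)] by (simp add: p(2) L_def)
    next
      fix z assume "z \<in> L"
      then obtain x where x: "x \<in> carrier X" "z = j x" by (auto simp: L_def)
      have "lc_id lmod X x = x" using x by (simp add: lmod_simps(3))
      then have fold: "x = foldr (\<lambda>f z. f x \<oplus>\<^bsub>X\<^esub> z) (map (\<lambda>(u, v). lc_comp lmod X reg X u v) ps) \<zero>\<^bsub>X\<^esub>"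
        using ps lc_sum_lmod[OF X X x(1)] unfolding decomposition_def by metis
      have c: "lc_comp lmod X reg X u v x \<in> carrier X"
          "j (lc_comp lmod X reg X u v x) = kinv (v x) * j (u (\<kappa> 1))"
        if p: "(u, v) \<in> set ps" for u v
      proof -
        have "v x = \<kappa> (kinv (v x))" "kinv (v x) \<in> S"
          using kinv_reg hom_carrier[OF reg_obj uv(2)[OF p] x(1)] by auto
        then have "lc_comp lmod X reg X u v x = act X (kinv (v x)) (u (\<kappa> 1))"
          using hom_reg_apply[OF X uv(1)[OF p]] x by (metis lmod_simps(4) compose_eq)
        then show "lc_comp lmod X reg X u v x \<in> carrier X"
          "j (lc_comp lmod X reg X u v x) = kinv (v x) * j (u (\<kappa> 1))"
          using act_closed[OF X] j_act uc[OF p] \<open>kinv (v x) \<in> S\<close> by auto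
      qed
      have "foldr (\<lambda>f z. f x \<oplus>\<^bsub>X\<^esub> z) (map (\<lambda>(u, v). lc_comp lmod X reg X u v) qs) \<zero>\<^bsub>X\<^esub> \<in> carrier X \<and>
        j (foldr (\<lambda>f z. f x \<oplus>\<^bsub>X\<^esub> z) (map (\<lambda>(u, v). lc_comp lmod X reg X u v) qs) \<zero>\<^bsub>X\<^esub>) =
        (\<Sum>(u, v)\<leftarrow>qs. kinv (v x) * j (u (\<kappa> 1)))" if "set qs \<subseteq> set ps" for qs
        using that
      proof (induction qs)
        case (Cons q qs)
        then show ?case using c by (cases q) (auto simp: j_add)
      qed (simp add: j_zero)
      from this[of ps] fold have "z = (\<Sum>(u, v)\<leftarrow>ps. kinv (v x) * j (u (\<kappa> 1)))" by (simp add: x(2))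
      moreover have "i z = x" using x ij by simp
      ultimately show "z = (\<Sum>(g, w)\<leftarrow>gws. w z * g)"
        unfolding gws_def by (simp add: o_def case_prod_unfold)
    qed
    fix \<phi> assume \<phi>: "trace_on \<phi>"
    have vu: "elt (lc_comp lmod reg X reg v (lc_comp lmod reg X X (lc_id lmod X) u)) = kinv (v (i (j (u (\<kappa> 1)))))
        \<and> kinv (v (u (\<kappa> 1))) \<in> S"
      if "(u, v) \<in> set ps" for u v
      using uc[OF that] ij kappa_one_reg kinv_reg(1) hom_carrier[OF reg_obj uv(2)[OF that]]
      by (simp add: elt_def lmod_simps(3,4) compose_eq)
    have "(\<Sum>(g, w)\<leftarrow>gws. w g) = (\<Sum>(u, v)\<leftarrow>ps. kinv (v (u (\<kappa> 1))))"
      unfolding gws_def map_map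
      by (intro arg_cong[where f = sum_list] map_cong refl) (auto simp: ij uc)
    moreover have "\<phi> (\<Sum>(u, v)\<leftarrow>ps. kinv (v (u (\<kappa> 1)))) = (\<Sum>p\<leftarrow>ps. \<phi> (case p of (u, v) \<Rightarrow> kinv (v (u (\<kappa> 1)))))"
      using vu by (intro trace_on_sum_list[OF \<phi>]) auto
    moreover have "hs_trace lmod reg X ps (\<lambda>f. \<phi> (elt f)) (lc_id lmod X) =
      (\<Sum>p\<leftarrow>ps. \<phi> (case p of (u, v) \<Rightarrow> kinv (v (u (\<kappa> 1)))))"
      unfolding hs_trace_def
      by (intro arg_cong[where f = sum_list] map_cong refl) (auto simp: vu ij uc)
    ultimately show "hs_trace lmod reg X ps (\<lambda>f. \<phi> (elt f)) (lc_id lmod X) = \<phi> (\<Sum>(g, w)\<leftarrow>gws. w g)"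
      by simp
  qed
qed

lemma dual_basis_decomposition:
  assumes L: "submod L" and gws: "dual_basis L gws"
  obtains ps where "decomposition lmod reg (lid L) ps"
    "\<And>\<phi>. trace_on \<phi> \<Longrightarrow>
      hs_trace lmod reg (lid L) ps (\<lambda>f. \<phi> (elt f)) (lc_id lmod (lid L)) = \<phi> (\<Sum>(g, w)\<leftarrow>gws. w g)"
proof -
  have gw: "g \<in> L" "\<And>z. z \<in> L \<Longrightarrow> w z \<in> S" "\<And>y z. y \<in> L \<Longrightarrow> z \<in> L \<Longrightarrow> w (y + z) = w y + w z"
    "\<And>s z. s \<in> S \<Longrightarrow> z \<in> L \<Longrightarrow> w (s * z) = s * w z" if "(g, w) \<in> set gws" for g w
    using gws that by (auto simp: dual_basis_def)
  define V where "V w = (\<lambda>u\<in>\<kappa> ` L. \<kappa> (w (kinv u)))" for w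
  define ps where "ps = map (\<lambda>(g, w). (rmap (lid L) (\<kappa> g), V w)) gws"
  have Lc: "carrier (lid L) = \<kappa> ` L" by (simp add: lid_def)
  have V: "V w \<in> lc_hom lmod (lid L) reg" if "(g, w) \<in> set gws" for g w
    using gw[OF that] L psi_S unfolding lmod_simps left_module_hom_def V_def submod_def
    by (auto simp: lid_def)
  have U: "rmap (lid L) (\<kappa> g) \<in> lc_hom lmod reg (lid L)" if "(g, w) \<in> set gws" for g w
    using gw[OF that] by (intro rmap_hom lid_obj L) (simp add: Lc)
  have sub: "set ps \<subseteq> lc_hom lmod reg (lid L) \<times> lc_hom lmod (lid L) reg"
    using U V by (auto simp: ps_def)
  have "lc_sum lmod (lid L) (lid L) (map (\<lambda>(u, v). lc_comp lmod (lid L) reg (lid L) u v) ps) = lc_id lmod (lid L)"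
    (is "?l = ?r")
  proof (rule extensionalityI[of _ "carrier (lid L)"])
    have "?l \<in> lc_hom lmod (lid L) (lid L)"
      using sub lmod.comp_hom[OF lid_obj[OF L] reg_obj lid_obj[OF L]]
      by (intro lmod.lc_sum_hom lid_obj L) fastforce
    then show "?l \<in> extensional (carrier (lid L))" by (simp add: lmod_simps left_module_homD)
    show "?r \<in> extensional (carrier (lid L))" by (simp add: lmod_simps(3))
    fix u assume u: "u \<in> carrier (lid L)"
    then obtain z where z: "z \<in> L" "u = \<kappa> z" by (auto simp: Lc)
    have "kinv (lc_comp lmod (lid L) reg (lid L) (rmap (lid L) (\<kappa> g)) (V w) u) = w z * g"
      if "(g, w) \<in> set gws" for g w
      using gw[OF that] z u by (simp add: lmod_simps(4) compose_eq V_def rmap_apply act_lid)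
    then have "?l u = \<kappa> (\<Sum>(g, w)\<leftarrow>gws. w z * g)"
      unfolding lc_sum_lid[OF L lid_obj[OF L] u] ps_def map_map
      by (intro arg_cong[where f = \<kappa>] arg_cong[where f = sum_list] map_cong refl) auto
    then show "?l u = ?r u"
      using gws z u unfolding dual_basis_def by (simp add: lmod_simps(3))
  qed
  with sub have dec: "decomposition lmod reg (lid L) ps" by (simp add: decomposition_def)
  have "hs_trace lmod reg (lid L) ps (\<lambda>f. \<phi> (elt f)) (lc_id lmod (lid L)) = \<phi> (\<Sum>(g, w)\<leftarrow>gws. w g)"
    if \<phi>: "trace_on \<phi>" for \<phi>
  proof -
    have "elt (lc_comp lmod reg (lid L) reg (V w) (lc_comp lmod reg (lid L) (lid L) (lc_id lmod (lid L)) (rmap (lid L) (\<kappa> g)))) = w g"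
      if "(g, w) \<in> set gws" for g w
      using gw[OF that] rmap_one[OF lid_obj[OF L], of "\<kappa> g"] kappa_one_reg
      by (simp add: elt_def lmod_simps(3,4) compose_eq Lc V_def)
    then have "hs_trace lmod reg (lid L) ps (\<lambda>f. \<phi> (elt f)) (lc_id lmod (lid L)) =
      (\<Sum>p\<leftarrow>gws. \<phi> (case p of (g, w) \<Rightarrow> w g))"
      unfolding hs_trace_def ps_def map_map
      by (intro arg_cong[where f = sum_list] map_cong refl) auto
    also have "\<dots> = \<phi> (\<Sum>(g, w)\<leftarrow>gws. w g)"
      using gw by (intro trace_on_sum_list[OF \<phi>, symmetric]) auto
    finally show ?thesis .
  qed
  with dec show ?thesis by (rule that)
qed

lemma uniform_lid:
  assumes ore: "\<And>x y. x \<in> S \<Longrightarrow> y \<in> S \<Longrightarrow> x \<noteq> 0 \<Longrightarrow> y \<noteq> 0 \<Longrightarrow>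
      \<exists>r\<in>S. \<exists>s\<in>S. r * x = s * y \<and> r * x \<noteq> 0"
    and L: "submod L" "L \<subseteq> S" "L \<noteq> {0}"
  shows "uniform lmod reg (lid L)"
  unfolding uniform_def
proof (intro conjI ballI impI)
  note Lo = lid_obj[OF L(1)]
  have Lc: "carrier (lid L) = \<kappa> ` L" "\<zero>\<^bsub>lid L\<^esub> = \<kappa> 0" by (simp_all add: lid_def)
  obtain z where z: "z \<in> L" "z \<noteq> 0" using L by (auto simp: submod_def)
  have "lc_id lmod (lid L) (\<kappa> z) = \<kappa> z" "lc_zero lmod (lid L) (lid L) (\<kappa> z) = \<kappa> 0"
    using z by (simp_all add: lc_zero_lmod[OF Lo Lo] lmod_simps(3) Lc)
  then show "lc_id lmod (lid L) \<noteq> lc_zero lmod (lid L) (lid L)"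
    using z inj_kappa by (auto simp: inj_eq)
  have nz: "\<exists>x\<in>L. x \<noteq> 0 \<and> f (\<kappa> 1) = \<kappa> x"
    if f: "f \<in> lc_hom lmod reg (lid L)" "f \<noteq> lc_zero lmod reg (lid L)" for f
  proof -
    obtain x where x: "x \<in> L" "f (\<kappa> 1) = \<kappa> x"
      using hom_carrier[OF Lo f(1) kappa_one_reg] by (auto simp: Lc)
    have "x \<noteq> 0"
    proof
      assume "x = 0"
      then have "f = lc_zero lmod reg (lid L)"
        using x f(1) lmod.zero_hom[OF reg_obj Lo]
        by (intro hom_reg_ext[OF Lo]) (simp_all add: lc_zero_lmod[OF Lo reg_obj] kappa_one_reg Lc)
      with f show False by simp
    qed
    with x show ?thesis by blast
  qed
  fix f g assume f: "f \<in> lc_hom lmod reg (lid L)" "f \<noteq> lc_zero lmod reg (lid L)"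
    and g: "g \<in> lc_hom lmod reg (lid L)" "g \<noteq> lc_zero lmod reg (lid L)"
  obtain x where x: "x \<in> L" "x \<noteq> 0" "f (\<kappa> 1) = \<kappa> x" using nz[OF f] by blast
  obtain y where y: "y \<in> L" "y \<noteq> 0" "g (\<kappa> 1) = \<kappa> y" using nz[OF g] by blast
  obtain r s where rs: "r \<in> S" "s \<in> S" "r * x = s * y" "r * x \<noteq> 0" using ore[of x y] x y L by blast
  have val: "lc_comp lmod reg reg (lid L) h (rmap reg (\<kappa> t)) (\<kappa> 1) = \<kappa> (t * z)"
    if "h \<in> lc_hom lmod reg (lid L)" "h (\<kappa> 1) = \<kappa> z" "t \<in> S" for h t z
    using hom_reg_apply[OF Lo that(1,3)] rmap_one[OF reg_obj, of "\<kappa> t"] that kappa_one_reg act_lid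
    by (simp add: lmod_simps(4) compose_eq) (simp add: lid_def)
  have "lc_comp lmod reg reg (lid L) f (rmap reg (\<kappa> r)) = lc_comp lmod reg reg (lid L) g (rmap reg (\<kappa> s))"
    using val[OF f(1) x(3) rs(1)] val[OF g(1) y(3) rs(2)] rs f g
      lmod.comp_hom[OF reg_obj reg_obj Lo rmap_reg_hom]
    by (intro hom_reg_ext[OF Lo]) auto
  moreover have "lc_comp lmod reg reg (lid L) f (rmap reg (\<kappa> r)) \<noteq> lc_zero lmod reg (lid L)"
  proof
    assume "lc_comp lmod reg reg (lid L) f (rmap reg (\<kappa> r)) = lc_zero lmod reg (lid L)"
    then have "\<kappa> (r * x) = \<kappa> 0"
      using val[OF f(1) x(3) rs(1)] by (simp add: lc_zero_lmod[OF Lo reg_obj] kappa_one_reg Lc)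
    then show False using rs inj_kappa by (simp add: inj_eq)
  qed
  ultimately show "\<exists>f'\<in>lc_hom lmod reg reg. \<exists>g'\<in>lc_hom lmod reg reg.
      lc_comp lmod reg reg (lid L) f f' = lc_comp lmod reg reg (lid L) g g' \<and>
      lc_comp lmod reg reg (lid L) f f' \<noteq> lc_zero lmod reg (lid L)"
    using rmap_reg_hom rs by blast
qed

end

section \<open>Skew Laurent polynomials\<close>

definition pshift :: "int \<Rightarrow> 'a::field_char_0 poly \<Rightarrow> 'a poly" where
  "pshift n p = pcompose p [:- of_int n, 1:]"

lemma poly_pshift [simp]: "poly (pshift n p) t = poly p (t - of_int n)"
  by (simp add: pshift_def poly_pcompose)

lemma poly_ext: "(\<And>t. poly p t = poly q t) \<Longrightarrow> p = (q :: 'a::field_char_0 poly)"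
  by (metis poly_eq_poly_eq_iff ext)

lemma pshift_simps [simp]:
  "pshift n 0 = 0" "pshift n 1 = 1" "pshift n [:c:] = [:c:]" "pshift 0 p = p"
  "pshift n (p + q) = pshift n p + pshift n q" "pshift n (p - q) = pshift n p - pshift n q"
  "pshift n (- p) = - pshift n p"
  "pshift n (p * q) = pshift n p * pshift n q" "pshift n (pshift m p) = pshift (n + m) p"
  by (rule poly_ext; simp add: algebra_simps)+

lemma pshift_sum: "pshift n (sum f A) = (\<Sum>x\<in>A. pshift n (f x))"
  by (rule poly_ext) (simp add: poly_sum)

lemma pshift_prod: "pshift n (prod f A) = (\<Prod>x\<in>A. pshift n (f x))"
  by (rule poly_ext) (simp add: poly_prod)

lemma pshift_eq_0_iff [simp]: "pshift n p = 0 \<longleftrightarrow> p = 0"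
proof
  assume "pshift n p = 0"
  then have "pshift (- n) (pshift n p) = 0" by (simp only: pshift_simps)
  then show "p = 0" by simp
qed simp

lemma pshift_dvd: "p dvd q \<Longrightarrow> pshift n p dvd pshift n q"
  by (auto simp: dvd_def)

text \<open>\<open>cf z d\<close> is the coefficient of \<open>x\<^sup>d\<close>, written on the left, and \<open>x p(h) = p(h - 1) x\<close>.\<close>

typedef (overloaded) 'a skew = "{f :: int \<Rightarrow> 'a::field_char_0 poly. finite {d. f d \<noteq> 0}}"
  morphisms cf Skew
  by (rule exI[of _ "\<lambda>_. 0"]) simp

definition supp :: "'a::field_char_0 skew \<Rightarrow> int set" where
  "supp z = {d. cf z d \<noteq> 0}"

lemma finite_supp [simp]: "finite (supp z)"
  using cf[of z] by (simp add: supp_def)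

lemma not_supp: "d \<notin> supp z \<Longrightarrow> cf z d = 0"
  by (simp add: supp_def)

lemma cf_Skew: "finite {d. f d \<noteq> 0} \<Longrightarrow> cf (Skew f) = f"
  by (simp add: Skew_inverse)

lemma skew_eqI: "(\<And>d. cf z d = cf w d) \<Longrightarrow> z = w"
  by (metis cf_inject ext)

definition smon :: "'a::field_char_0 poly \<Rightarrow> int \<Rightarrow> 'a skew" where
  "smon p d = Skew (\<lambda>e. if e = d then p else 0)"

lemma cf_smon: "cf (smon p d) e = (if e = d then p else 0)"
  unfolding smon_def by (subst cf_Skew) auto

instantiation skew :: (field_char_0) ring_1
begin

definition zero_skew :: "'a skew" where "0 = Skew (\<lambda>_. 0)"
definition one_skew :: "'a skew" where "1 = smon 1 0"
definition plus_skew :: "'a skew \<Rightarrow> 'a skew \<Rightarrow> 'a skew" where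
  "z + w = Skew (\<lambda>d. cf z d + cf w d)"
definition uminus_skew :: "'a skew \<Rightarrow> 'a skew" where
  "- z = Skew (\<lambda>d. - cf z d)"
definition minus_skew :: "'a skew \<Rightarrow> 'a skew \<Rightarrow> 'a skew" where
  "z - w = Skew (\<lambda>d. cf z d - cf w d)"
definition times_skew :: "'a skew \<Rightarrow> 'a skew \<Rightarrow> 'a skew" where
  "z * w = Skew (\<lambda>d. \<Sum>e\<in>supp z. cf z e * pshift e (cf w (d - e)))"

lemma cf_zero: "cf 0 d = (0 :: 'a poly)"
  by (simp add: zero_skew_def cf_Skew)

lemma cf_one: "cf 1 d = (if d = 0 then 1 else 0 :: 'a poly)"
  by (simp add: one_skew_def cf_smon)

lemma cf_add: "cf (z + w) d = cf z d + (cf w d :: 'a poly)"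
proof -
  have "{d. cf z d + cf w d \<noteq> 0} \<subseteq> supp z \<union> supp w" by (auto simp: supp_def)
  then have "finite {d. cf z d + cf w d \<noteq> 0}" using finite_supp finite_subset by blast
  then show ?thesis by (simp add: plus_skew_def cf_Skew)
qed

lemma cf_uminus: "cf (- z) d = - (cf z d :: 'a poly)"
  using finite_supp[of z] by (simp add: uminus_skew_def cf_Skew supp_def)

lemma cf_minus: "cf (z - w) d = cf z d - (cf w d :: 'a poly)"
proof -
  have "{d. cf z d - cf w d \<noteq> 0} \<subseteq> supp z \<union> supp w" by (auto simp: supp_def)
  then have "finite {d. cf z d - cf w d \<noteq> 0}" using finite_supp finite_subset by blast
  then show ?thesis by (simp add: minus_skew_def cf_Skew)
qed

lemma cf_times_supp: "cf (z * w) d = (\<Sum>e\<in>supp z. cf z e * pshift e (cf w (d - e)) :: 'a poly)"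
proof -
  have "{d. (\<Sum>e\<in>supp z. cf z e * pshift e (cf w (d - e))) \<noteq> 0} \<subseteq> (\<lambda>(e, f). e + f) ` (supp z \<times> supp w)"
  proof
    fix d assume "d \<in> {d. (\<Sum>e\<in>supp z. cf z e * pshift e (cf w (d - e))) \<noteq> 0}"
    then have "(\<Sum>e\<in>supp z. cf z e * pshift e (cf w (d - e))) \<noteq> 0" by simp
    then obtain e where "e \<in> supp z" "cf z e * pshift e (cf w (d - e)) \<noteq> 0"
      by (rule sum.not_neutral_contains_not_neutral)
    then have "e \<in> supp z" "d - e \<in> supp w" by (auto simp: supp_def)
    then show "d \<in> (\<lambda>(e, f). e + f) ` (supp z \<times> supp w)"
      by (intro image_eqI[of _ _ "(e, d - e)"]) auto
  qed
  then have "finite {d. (\<Sum>e\<in>supp z. cf z e * pshift e (cf w (d - e))) \<noteq> 0}"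
    using finite_supp by (meson finite_SigmaI finite_imageI finite_subset)
  then show ?thesis by (simp add: times_skew_def cf_Skew)
qed

lemma cf_times:
  assumes "finite E" "supp z \<subseteq> E"
  shows "cf (z * w) d = (\<Sum>e\<in>E. cf z e * pshift e (cf w (d - e)) :: 'a poly)"
  unfolding cf_times_supp
  by (rule sum.mono_neutral_left) (use assms in \<open>auto simp: supp_def\<close>)

instance
proof
  fix p q r :: "'a skew"
  show "p + q + r = p + (q + r)" "p + q = q + p" "0 + p = p" "- p + p = 0" "p - q = p + - q"
    by (rule skew_eqI; simp add: cf_add cf_zero cf_uminus cf_minus)+
  show "1 * p = p"
    by (rule skew_eqI, subst cf_times[of "{0}"]) (auto simp: supp_def cf_one)
  show "p * 1 = p"
  proof (rule skew_eqI)
    fix d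
    have "cf (p * 1) d = (\<Sum>e\<in>insert d (supp p). cf p e * pshift e (cf 1 (d - e)))"
      by (rule cf_times) auto
    also have "\<dots> = (\<Sum>e\<in>{d}. cf p e * pshift e (cf 1 (d - e)))"
      by (rule sum.mono_neutral_right) (auto simp: cf_one)
    finally show "cf (p * 1) d = cf p d" by (simp add: cf_one)
  qed
  show "(0 :: 'a skew) \<noteq> 1"
    using cf_zero[of 0] cf_one[of 0] by (metis zero_neq_one)
  show "p * (q + r) = p * q + p * r"
    by (rule skew_eqI) (simp add: cf_times[of "supp p"] cf_add distrib_left sum.distrib)
  show "(p + q) * r = p * r + q * r"
  proof (rule skew_eqI)
    fix d
    have s: "supp (p + q) \<subseteq> supp p \<union> supp q" by (auto simp: supp_def cf_add)
    show "cf ((p + q) * r) d = cf (p * r + q * r) d"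
      using s by (simp add: cf_times[of "supp p \<union> supp q"] cf_add distrib_right sum.distrib)
  qed
  show "p * q * r = p * (q * r)"
  proof (rule skew_eqI)
    fix d
    define E where "E = (\<lambda>(e, f). e + f) ` (supp p \<times> supp q)"
    have E: "finite E" by (simp add: E_def)
    have sE: "supp (p * q) \<subseteq> E"
    proof
      fix e assume "e \<in> supp (p * q)"
      then have "(\<Sum>f\<in>supp p. cf p f * pshift f (cf q (e - f))) \<noteq> 0"
        by (simp add: supp_def cf_times_supp)
      then obtain f where "f \<in> supp p" "cf p f * pshift f (cf q (e - f)) \<noteq> 0"
        by (rule sum.not_neutral_contains_not_neutral)
      then have "f \<in> supp p" "e - f \<in> supp q" by (auto simp: supp_def)
      then show "e \<in> E" unfolding E_def by (intro image_eqI[of _ _ "(f, e - f)"]) auto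
    qed
    have "cf (p * q * r) d = (\<Sum>e\<in>E. \<Sum>f\<in>supp p. cf p f * pshift f (cf q (e - f)) * pshift e (cf r (d - e)))"
      by (simp add: cf_times[OF E sE] cf_times_supp[of p q] sum_distrib_right)
    also have "\<dots> = (\<Sum>f\<in>supp p. \<Sum>e\<in>E. cf p f * pshift f (cf q (e - f)) * pshift e (cf r (d - e)))"
      by (rule sum.swap)
    also have "\<dots> = (\<Sum>f\<in>supp p. \<Sum>g\<in>supp q. cf p f * (pshift f (cf q g) * pshift (f + g) (cf r (d - f - g))))"
    proof (rule sum.cong[OF refl])
      fix f assume f: "f \<in> supp p"
      have "(\<Sum>e\<in>E. cf p f * pshift f (cf q (e - f)) * pshift e (cf r (d - e))) =
        (\<Sum>e\<in>(+) f ` supp q. cf p f * pshift f (cf q (e - f)) * pshift e (cf r (d - e)))"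
      proof (rule sum.mono_neutral_right[OF E])
        show "(+) f ` supp q \<subseteq> E" using f by (auto simp: E_def intro!: image_eqI)
        show "\<forall>e\<in>E - (+) f ` supp q. cf p f * pshift f (cf q (e - f)) * pshift e (cf r (d - e)) = 0"
        proof
          fix e assume "e \<in> E - (+) f ` supp q"
          then have "e - f \<notin> supp q" by (metis DiffE add.commute diff_add_cancel image_eqI)
          then show "cf p f * pshift f (cf q (e - f)) * pshift e (cf r (d - e)) = 0"
            by (simp add: not_supp)
        qed
      qed
      also have "\<dots> = (\<Sum>g\<in>supp q. cf p f * (pshift f (cf q g) * pshift (f + g) (cf r (d - f - g))))"
        by (subst sum.reindex) (auto simp: inj_on_def algebra_simps)
      finally show "(\<Sum>e\<in>E. cf p f * pshift f (cf q (e - f)) * pshift e (cf r (d - e))) =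
        (\<Sum>g\<in>supp q. cf p f * (pshift f (cf q g) * pshift (f + g) (cf r (d - f - g))))" .
    qed
    also have "\<dots> = cf (p * (q * r)) d"
      by (simp add: cf_times_supp pshift_sum sum_distrib_left)
    finally show "cf (p * q * r) d = cf (p * (q * r)) d" .
  qed
qed

end

lemma cf_sum: "cf (sum f A) d = (\<Sum>x\<in>A. cf (f x) d)"
  by (induction A rule: infinite_finite_induct) (simp_all add: cf_zero cf_add)

lemma supp_empty_iff [simp]: "supp z = {} \<longleftrightarrow> z = 0"
  by (auto simp: supp_def cf_zero intro: skew_eqI)

lemma supp_smon: "supp (smon p d) \<subseteq> {d}"
  by (auto simp: supp_def cf_smon)

lemma cf_smon_times: "cf (smon p d * z) e = p * pshift d (cf z (e - d))"
  using cf_times[OF _ supp_smon[of p d], of z e] by (simp add: cf_smon)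

lemma cf_times_smon: "cf (z * smon p d) e = cf z (e - d) * pshift (e - d) p"
proof -
  have "cf (z * smon p d) e = (\<Sum>f\<in>insert (e - d) (supp z). cf z f * pshift f (cf (smon p d) (e - f)))"
    by (rule cf_times) auto
  also have "\<dots> = (\<Sum>f\<in>{e - d}. cf z f * pshift f (cf (smon p d) (e - f)))"
    by (rule sum.mono_neutral_right) (auto simp: cf_smon)
  finally show ?thesis by (simp add: cf_smon)
qed

lemma smon_times_smon: "smon p d * smon q e = smon (p * pshift d q) (d + e)"
  by (rule skew_eqI) (auto simp: cf_smon_times cf_smon)

lemma smon_add: "smon (p + q) d = smon p d + smon q d"
  and smon_diff: "smon (p - q) d = smon p d - smon q d"
  and smon_zero: "smon 0 d = 0"
  by (rule skew_eqI; simp add: cf_smon cf_add cf_zero cf_minus)+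

lemma smon_sum: "smon (sum f A) d = (\<Sum>x\<in>A. smon (f x) d)"
  by (induction A rule: infinite_finite_induct) (simp_all add: smon_zero smon_add)

lemma smon_eq_0_iff: "smon p d = 0 \<longleftrightarrow> p = 0"
  by (metis cf_smon cf_zero smon_zero)

lemma skew_smon_decomp: "finite E \<Longrightarrow> supp z \<subseteq> E \<Longrightarrow> z = (\<Sum>d\<in>E. smon (cf z d) d)"
  by (rule skew_eqI) (auto simp: cf_sum cf_smon intro!: not_supp)

definition top_deg :: "'a::field_char_0 skew \<Rightarrow> int" where "top_deg z = Max (supp z)"
definition bot_deg :: "'a::field_char_0 skew \<Rightarrow> int" where "bot_deg z = Min (supp z)"
definition width :: "'a::field_char_0 skew \<Rightarrow> nat" where "width z = nat (top_deg z - bot_deg z)"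

lemma mem_supp: "d \<in> supp z \<longleftrightarrow> cf z d \<noteq> 0"
  by (simp add: supp_def)

lemma top_deg: "z \<noteq> 0 \<Longrightarrow> cf z (top_deg z) \<noteq> 0" "cf z d \<noteq> 0 \<Longrightarrow> d \<le> top_deg z"
  unfolding top_deg_def mem_supp[symmetric] by simp_all

lemma bot_deg: "z \<noteq> 0 \<Longrightarrow> cf z (bot_deg z) \<noteq> 0" "cf z d \<noteq> 0 \<Longrightarrow> bot_deg z \<le> d"
  unfolding bot_deg_def mem_supp[symmetric] by simp_all

lemma bot_le_top: "z \<noteq> 0 \<Longrightarrow> bot_deg z \<le> top_deg z"
  using bot_deg(1) top_deg(2) by blast

lemma skew_no_zero_divisors:
  assumes "z \<noteq> 0" "w \<noteq> 0" shows "z * w \<noteq> (0 :: 'a::field_char_0 skew)"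
proof -
  have "cf (z * w) (top_deg z + top_deg w) =
    (\<Sum>e\<in>supp z. cf z e * pshift e (cf w (top_deg z + top_deg w - e)))" by (rule cf_times_supp)
  also have "\<dots> = (\<Sum>e\<in>{top_deg z}. cf z e * pshift e (cf w (top_deg z + top_deg w - e)))"
  proof (rule sum.mono_neutral_right)
    show "{top_deg z} \<subseteq> supp z" using top_deg(1)[OF assms(1)] by (simp add: supp_def)
    show "\<forall>e\<in>supp z - {top_deg z}. cf z e * pshift e (cf w (top_deg z + top_deg w - e)) = 0"
    proof
      fix e assume "e \<in> supp z - {top_deg z}"
      then have "e < top_deg z" using top_deg(2)[of z e] by (simp add: supp_def)
      then have "cf w (top_deg z + top_deg w - e) = 0" using top_deg(2)[of w] by force
      then show "cf z e * pshift e (cf w (top_deg z + top_deg w - e)) = 0" by simp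
    qed
  qed simp
  also have "\<dots> \<noteq> 0" using top_deg(1)[OF assms(1)] top_deg(1)[OF assms(2)] by simp
  finally show ?thesis by (auto simp: cf_zero)
qed

section \<open>Generalized Weyl algebras inside skew Laurent polynomials\<close>

text \<open>
  \<open>y = a(h) x\<^sup>-\<^sup>1\<close>, hence \<open>y\<^sup>n = a(h) a(h + 1) \<dots> a(h + n - 1) x\<^sup>-\<^sup>n\<close>.
\<close>

definition yfac :: "'a::field_char_0 poly \<Rightarrow> int \<Rightarrow> 'a poly" where
  "yfac a d = (\<Prod>i\<in>{0..<- d}. pshift (- i) a)"

definition gwa_sub :: "'a::field_char_0 poly \<Rightarrow> 'a skew set" where
  "gwa_sub a = {z. \<forall>d. yfac a d dvd cf z d}"

lemma yfac_nonneg: "0 \<le> d \<Longrightarrow> yfac a d = 1"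
  by (simp add: yfac_def)

lemma yfac_nonzero: "a \<noteq> 0 \<Longrightarrow> yfac a d \<noteq> 0"
  by (simp add: yfac_def)

lemma yfac_minus_one: "yfac a (- 1) = a"
proof -
  have "{0..<1::int} = {0}" by auto
  then show ?thesis by (simp add: yfac_def)
qed

lemma pshift_yfac: "pshift d (yfac a e) = (\<Prod>i\<in>{- d..<- d - e}. pshift (- i) a)"
  unfolding yfac_def pshift_prod pshift_simps
  by (rule prod.reindex_bij_witness[of _ "\<lambda>i. i + d" "\<lambda>i. i - d"]) (auto simp: algebra_simps)

lemma yfac_dvd: "yfac a (d + e) dvd yfac a d * pshift d (yfac a e)"
proof -
  have "yfac a d * pshift d (yfac a e) = (\<Prod>i\<in>{0..<- d} \<union> {- d..<- d - e}. pshift (- i) a)"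
    unfolding pshift_yfac by (subst prod.union_disjoint) (auto simp: yfac_def)
  then show ?thesis unfolding yfac_def by (auto intro!: prod_dvd_prod_subset)
qed

lemma gwa_subD: "z \<in> gwa_sub a \<Longrightarrow> yfac a d dvd cf z d"
  by (simp add: gwa_sub_def)

lemma gwa_sub_closed:
  "0 \<in> gwa_sub a" "1 \<in> gwa_sub a" "z \<in> gwa_sub a \<Longrightarrow> w \<in> gwa_sub a \<Longrightarrow> z + w \<in> gwa_sub a"
  "z \<in> gwa_sub a \<Longrightarrow> w \<in> gwa_sub a \<Longrightarrow> z - w \<in> gwa_sub a" "z \<in> gwa_sub a \<Longrightarrow> - z \<in> gwa_sub a"
  by (auto simp: gwa_sub_def cf_zero cf_one cf_add cf_minus cf_uminus yfac_nonneg)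

lemma gwa_sub_times:
  assumes "z \<in> gwa_sub a" "w \<in> gwa_sub a"
  shows "z * w \<in> gwa_sub a"
  unfolding gwa_sub_def
proof (clarsimp simp: cf_times_supp, rule dvd_sum)
  fix d e
  have "yfac a e * pshift e (yfac a (d - e)) dvd cf z e * pshift e (cf w (d - e))"
    using assms by (intro mult_dvd_mono pshift_dvd gwa_subD)
  then show "yfac a d dvd cf z e * pshift e (cf w (d - e))"
    using yfac_dvd[of a e "d - e"] by (simp add: dvd_trans)
qed

lemma smon_gwa_sub: "yfac a d dvd p \<Longrightarrow> smon p d \<in> gwa_sub a"
  by (simp add: gwa_sub_def cf_smon)

lemma smon0_gwa_sub: "smon p 0 \<in> gwa_sub a"
  by (simp add: smon_gwa_sub yfac_nonneg)

lemma smon_cf_gwa_sub: "z \<in> gwa_sub a \<Longrightarrow> smon (cf z d) d \<in> gwa_sub a"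
  by (simp add: smon_gwa_sub gwa_subD)

lemma width_reduce:
  assumes a: "a \<noteq> 0" and f: "f \<noteq> 0" and g: "g \<noteq> 0" and le: "width f \<le> width g"
  obtains s z where "s \<noteq> 0" "z \<in> gwa_sub a"
    "smon s 0 * g - z * f = 0 \<or> width (smon s 0 * g - z * f) < width g"
proof -
  define k where "k = top_deg g - top_deg f"
  define s where "s = yfac a k * pshift k (cf f (top_deg f))"
  define z where "z = smon (cf g (top_deg g) * yfac a k) k"
  define r where "r = smon s 0 * g - z * f"
  have s: "s \<noteq> 0" using a f by (simp add: s_def yfac_nonzero top_deg)
  have z: "z \<in> gwa_sub a" by (simp add: z_def smon_gwa_sub)
  have cfr: "cf r e = s * cf g e - cf g (top_deg g) * yfac a k * pshift k (cf f (e - k))" for e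
    by (simp add: r_def cf_minus z_def cf_smon_times)
  have "bot_deg g \<le> e \<and> e < top_deg g" if "cf r e \<noteq> 0" for e
  proof -
    have "e \<noteq> top_deg g" using that by (auto simp: cfr s_def k_def)
    moreover have "cf g e \<noteq> 0 \<or> cf f (e - k) \<noteq> 0" using that by (auto simp: cfr)
    moreover have "bot_deg g \<le> bot_deg f + k"
      using le bot_le_top[OF f] bot_le_top[OF g] by (simp add: width_def k_def)
    ultimately show ?thesis
      using top_deg(2)[of g e] top_deg(2)[of f "e - k"] bot_deg(2)[of g e] bot_deg(2)[of f "e - k"]
      by (auto simp: k_def)
  qed
  then have "r = 0 \<or> bot_deg g \<le> bot_deg r \<and> top_deg r < top_deg g"
    using top_deg(1)[of r] bot_deg(1)[of r] by blast
  then have "r = 0 \<or> width r < width g"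
    using bot_le_top[of r] by (auto simp: width_def)
  with s z that show ?thesis by (simp add: r_def)
qed

lemma gwa_sub_ore:
  assumes a: "a \<noteq> 0" and "f \<in> gwa_sub a" "g \<in> gwa_sub a" "f \<noteq> 0" "g \<noteq> 0"
  shows "\<exists>r\<in>gwa_sub a. \<exists>s\<in>gwa_sub a. r * f = s * g \<and> r * f \<noteq> 0"
  using assms(2-5)
proof (induction "width f + width g" arbitrary: f g rule: less_induct)
  case less
  have main: "\<exists>r\<in>gwa_sub a. \<exists>s\<in>gwa_sub a. r * f = s * g \<and> r * f \<noteq> 0"
    if fg: "f \<in> gwa_sub a" "g \<in> gwa_sub a" "f \<noteq> 0" "g \<noteq> 0" "width f \<le> width g"
      "\<And>g'. width g' < width g \<Longrightarrow> g' \<in> gwa_sub a \<Longrightarrow> g' \<noteq> 0 \<Longrightarrow>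
         \<exists>r\<in>gwa_sub a. \<exists>s\<in>gwa_sub a. r * f = s * g' \<and> r * f \<noteq> 0" for f g
  proof -
    obtain s z where s: "s \<noteq> 0" and z: "z \<in> gwa_sub a"
      and red: "smon s 0 * g - z * f = 0 \<or> width (smon s 0 * g - z * f) < width g"
      using width_reduce[OF a fg(3-5)] by blast
    have sg: "smon s 0 * g \<noteq> 0" using s fg(4) by (simp add: skew_no_zero_divisors smon_eq_0_iff)
    show ?thesis
    proof (cases "smon s 0 * g - z * f = 0")
      case True
      then have "z * f = smon s 0 * g" by simp
      then show ?thesis using z sg smon0_gwa_sub by metis
    next
      case False
      define g' where "g' = smon s 0 * g - z * f"
      have "g' \<in> gwa_sub a"
        using z fg(1,2) by (simp add: g'_def gwa_sub_closed gwa_sub_times smon0_gwa_sub)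
      then obtain r t where rt: "r \<in> gwa_sub a" "t \<in> gwa_sub a" "r * f = t * g'" "r * f \<noteq> 0"
        using fg(6)[of g'] False red by (auto simp: g'_def)
      have "(r + t * z) * f = (t * smon s 0) * g"
        using rt(3) by (simp add: g'_def algebra_simps)
      moreover have "t \<noteq> 0" using rt by auto
      then have "(t * smon s 0) * g \<noteq> 0" using sg by (simp add: mult.assoc skew_no_zero_divisors)
      moreover have "r + t * z \<in> gwa_sub a" "t * smon s 0 \<in> gwa_sub a"
        using rt z by (simp_all add: gwa_sub_closed gwa_sub_times smon0_gwa_sub)
      ultimately show ?thesis by metis
    qed
  qed
  show ?case
  proof (cases "width f \<le> width g")
    case True
    have "\<exists>r\<in>gwa_sub a. \<exists>s\<in>gwa_sub a. r * f = s * g' \<and> r * f \<noteq> 0"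
      if "width g' < width g" "g' \<in> gwa_sub a" "g' \<noteq> 0" for g'
      using that less.prems by (intro less.hyps) auto
    with True show ?thesis using main[OF less.prems] by blast
  next
    case False
    have "\<exists>r\<in>gwa_sub a. \<exists>s\<in>gwa_sub a. r * g = s * g' \<and> r * g \<noteq> 0"
      if g': "width g' < width f" "g' \<in> gwa_sub a" "g' \<noteq> 0" for g'
    proof -
      have "\<exists>r\<in>gwa_sub a. \<exists>s\<in>gwa_sub a. r * g' = s * g \<and> r * g' \<noteq> 0"
        by (rule less.hyps) (use g' less.prems in auto)
      then show ?thesis by metis
    qed
    with False have "\<exists>r\<in>gwa_sub a. \<exists>s\<in>gwa_sub a. r * g = s * f \<and> r * g \<noteq> 0"
      using main[OF less.prems(2,1,4,3)] by simp
    then show ?thesis by metis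
  qed
qed

lemma gwa_sub_left_ideal_generic_generator:
  assumes a: "a \<noteq> 0" and L: "0 \<in> L" "\<And>x y. x \<in> L \<Longrightarrow> y \<in> L \<Longrightarrow> x - y \<in> L"
    "\<And>s x. s \<in> gwa_sub a \<Longrightarrow> x \<in> L \<Longrightarrow> s * x \<in> L" "L \<noteq> {0}"
  obtains f where "f \<in> L" "f \<noteq> 0"
    "\<And>g. g \<in> L \<Longrightarrow> \<exists>s z. s \<noteq> 0 \<and> z \<in> gwa_sub a \<and> smon s 0 * g = z * f"
proof -
  obtain f0 where "f0 \<in> L \<and> f0 \<noteq> 0" using L by auto
  then obtain f where f: "f \<in> L \<and> f \<noteq> 0" "\<And>g. g \<in> L \<and> g \<noteq> 0 \<Longrightarrow> width f \<le> width g"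
    using ex_has_least_nat[of "\<lambda>f. f \<in> L \<and> f \<noteq> 0" f0 width] by blast
  have "\<exists>s z. s \<noteq> 0 \<and> z \<in> gwa_sub a \<and> smon s 0 * g = z * f" if "g \<in> L" for g
    using that
  proof (induction "width g" arbitrary: g rule: less_induct)
    case less
    show ?case
    proof (cases "g = 0")
      case True
      then show ?thesis using gwa_sub_closed(1)[of a] by (intro exI[of _ 1] exI[of _ 0]) auto
    next
      case False
      obtain s z where s: "s \<noteq> 0" and z: "z \<in> gwa_sub a"
        and red: "smon s 0 * g - z * f = 0 \<or> width (smon s 0 * g - z * f) < width g"
        using width_reduce[OF a _ False f(2)] f less.prems False by blast
      define g' where "g' = smon s 0 * g - z * f"
      have "g' \<in> L"
        unfolding g'_def using L(3)[OF smon0_gwa_sub less.prems] L(3)[OF z] f(1) L(2) by blast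
      have "\<exists>s' z'. s' \<noteq> 0 \<and> z' \<in> gwa_sub a \<and> smon s' 0 * g' = z' * f"
      proof (cases "g' = 0")
        case True
        then show ?thesis using gwa_sub_closed(1)[of a] by (intro exI[of _ 1] exI[of _ 0]) auto
      next
        case False
        then show ?thesis using red less.hyps \<open>g' \<in> L\<close> by (auto simp: g'_def)
      qed
      then obtain s' z' where s': "s' \<noteq> 0" "z' \<in> gwa_sub a" "smon s' 0 * g' = z' * f" by blast
      have "smon (s' * s) 0 * g = smon s' 0 * (smon s 0 * g)"
        by (simp add: mult.assoc[symmetric] smon_times_smon)
      also have "\<dots> = (z' + smon s' 0 * z) * f"
        using s'(3) by (simp add: g'_def algebra_simps)
      finally show ?thesis
        using s s' z
        by (intro exI[of _ "s' * s"] exI[of _ "z' + smon s' 0 * z"])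
          (simp add: gwa_sub_closed gwa_sub_times smon0_gwa_sub)
    qed
  qed
  with f that show ?thesis by blast
qed

section \<open>Trace functionals\<close>

definition bdiff :: "'a::field_char_0 poly \<Rightarrow> 'a poly" where
  "bdiff q = q - pshift 1 q"

lemma bdiff_simps: "bdiff (p + q) = bdiff p + bdiff q" "bdiff (p - q) = bdiff p - bdiff q"
  "bdiff (- p) = - bdiff p" "bdiff [:c:] = 0" "bdiff ([:c:] * p) = [:c:] * bdiff p" "bdiff 0 = 0"
  by (simp_all add: bdiff_def algebra_simps del: mult_pCons_left mult_pCons_right)

lemma bdiff_sum: "bdiff (sum f A) = (\<Sum>x\<in>A. bdiff (f x))"
  by (simp add: bdiff_def pshift_sum sum_subtractf)

lemma bdiff_surj: "\<exists>q. bdiff q = p"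
proof (induction "degree p" arbitrary: p rule: less_induct)
  case less
  show ?case
  proof (cases "p = 0")
    case True
    then show ?thesis by (intro exI[of _ 0]) (simp add: bdiff_def)
  next
    case False
    define m where "m = degree p"
    have step: "degree (bdiff (monom 1 (Suc k) :: 'a poly)) \<le> k \<and>
        coeff (bdiff (monom 1 (Suc k) :: 'a poly)) k = of_nat (Suc k)" for k
    proof (induction k)
      case 0
      have "bdiff (monom 1 (Suc 0) :: 'a poly) = 1"
        by (rule poly_ext) (simp add: bdiff_def poly_monom)
      then show ?case by simp
    next
      case (Suc k)
      have "bdiff (monom 1 (Suc (Suc k)) :: 'a poly) =
          monom 1 1 * bdiff (monom 1 (Suc k)) + pshift 1 (monom 1 (Suc k))"
        by (rule poly_ext) (simp add: bdiff_def poly_monom algebra_simps)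
      then have e: "bdiff (monom 1 (Suc (Suc k)) :: 'a poly) =
          pCons 0 (bdiff (monom 1 (Suc k))) + (monom 1 (Suc k) - bdiff (monom 1 (Suc k)))"
        by (simp add: bdiff_def monom_Suc)
      have 1: "degree (pCons 0 (bdiff (monom 1 (Suc k) :: 'a poly))) \<le> Suc k"
        using Suc degree_pCons_le[of 0 "bdiff (monom 1 (Suc k) :: 'a poly)"] by linarith
      have 2: "degree (monom 1 (Suc k) - bdiff (monom 1 (Suc k)) :: 'a poly) \<le> Suc k"
        using Suc by (intro degree_diff_le) (auto simp: degree_monom_eq)
      have 3: "coeff (bdiff (monom 1 (Suc k) :: 'a poly)) (Suc k) = 0"
        using Suc by (intro coeff_eq_0) auto
      show ?case unfolding e using degree_add_le[OF 1 2] Suc 3 by simp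
    qed
    define c where "c = lead_coeff p / of_nat (Suc m)"
    define r where "r = p - [:c:] * bdiff (monom 1 (Suc m))"
    have d: "degree r \<le> m"
      using step[of m] by (auto simp: r_def m_def intro!: degree_diff_le)
    have "c * of_nat (Suc m) = lead_coeff p"
      unfolding c_def using of_nat_neq_0[of m, where ?'a = 'a]
      by (metis nonzero_eq_divide_eq)
    then have d': "coeff r m = 0"
      using step[of m, THEN conjunct2] by (simp add: r_def m_def del: of_nat_Suc)
    show ?thesis
    proof (cases "m = 0")
      case True
      then have "r = 0" using d d' by (metis le_zero_eq leading_coeff_0_iff)
      then have "p = bdiff ([:c:] * monom 1 (Suc m))" unfolding bdiff_simps by (simp add: r_def)
      then show ?thesis by blast
    next
      case False
      then have "degree r < m" using d d'
        by (metis coeff_0 leading_coeff_0_iff le_neq_implies_less degree_0 neq0_conv)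
      then obtain q where "bdiff q = r" using less.hyps unfolding m_def by blast
      then have "bdiff (q + [:c:] * monom 1 (Suc m)) = p"
        by (simp only: bdiff_simps) (simp add: r_def)
      then show ?thesis by blast
    qed
  qed
qed

lemma bdiff_zero_const:
  assumes "bdiff q = (0 :: 'a::field_char_0 poly)"
  shows "poly q s = poly q t"
proof -
  have per: "poly q u = poly q (u - 1)" for u
    using arg_cong[OF assms, of "\<lambda>p. poly p u"] by (simp add: bdiff_def)
  have shift: "poly q (t + of_nat n) = poly q t" for n t
    by (induction n) (use per in \<open>auto simp: algebra_simps\<close>, metis add_diff_cancel_left')
  have "q - [:poly q t:] = 0"
  proof (rule ccontr)
    assume "q - [:poly q t:] \<noteq> 0"
    then have "finite {u. poly (q - [:poly q t:]) u = 0}" by (rule poly_roots_finite)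
    moreover have "range (\<lambda>n. t + of_nat n) \<subseteq> {u. poly (q - [:poly q t:]) u = 0}"
      by (auto simp: shift)
    moreover have "infinite (range (\<lambda>n. t + of_nat n :: 'a))"
      by (rule range_inj_infinite) (auto intro: injI)
    ultimately show False using finite_subset by blast
  qed
  then have "poly (q - [:poly q t:]) s = 0" by simp
  then show ?thesis by simp
qed

definition tau :: "'a::field_char_0 \<Rightarrow> 'a \<Rightarrow> 'a skew \<Rightarrow> 'a" where
  "tau s t z = (let q = (SOME q. bdiff q = cf z 0) in poly q s - poly q t)"

lemma tau_eq:
  assumes "bdiff q = cf z 0"
  shows "tau s t z = poly q s - poly q t"
proof -
  define q' where "q' = (SOME q. bdiff q = cf z 0)"
  have "bdiff q' = cf z 0" unfolding q'_def using bdiff_surj by (rule someI_ex)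
  then have "bdiff (q' - q) = 0" using assms by (simp add: bdiff_simps)
  from bdiff_zero_const[OF this, of s t] show ?thesis
    by (simp add: tau_def q'_def[symmetric] algebra_simps)
qed

lemma tau_add: "tau s t (z + w) = tau s t z + tau s t w"
proof -
  obtain p q where "bdiff p = cf z 0" "bdiff q = cf w 0" using bdiff_surj by metis
  then show ?thesis
    using tau_eq[of p z s t] tau_eq[of q w s t] tau_eq[of "p + q" "z + w" s t]
    by (simp add: bdiff_simps cf_add)
qed

lemma tau_scale: "tau s t (smon [:c:] 0 * z) = c * tau s t z"
proof -
  obtain p where "bdiff p = cf z 0" using bdiff_surj by metis
  moreover then have "bdiff ([:c:] * p) = cf (smon [:c:] 0 * z) 0"
    unfolding bdiff_simps by (simp add: cf_smon_times)
  ultimately have "tau s t z = poly p s - poly p t"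
    "tau s t (smon [:c:] 0 * z) = poly ([:c:] * p) s - poly ([:c:] * p) t"
    using tau_eq by blast+
  then show ?thesis by (simp add: right_diff_distrib)
qed

lemma telescope: "bdiff (\<Sum>m<n. pshift (int m) v) = v - pshift (int n) v"
  by (induction n) (simp_all add: bdiff_simps, simp add: bdiff_def algebra_simps)

lemma commutator_bdiff:
  assumes z: "z \<in> gwa_sub a" and w: "w \<in> gwa_sub a"
  obtains q where "a dvd q" "bdiff q = cf (z * w) 0 - cf (w * z) 0"
proof -
  have sum_dvd: "a dvd (\<Sum>m<n. pshift (int m) v)" if "yfac a (- int n) dvd v" for n v
  proof (rule dvd_sum)
    fix m assume "m \<in> {..<n}"
    then have "pshift (- int m) a dvd yfac a (- int n)"
      unfolding yfac_def by (intro dvd_prodI) auto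
    then have "pshift (- int m) a dvd v" using that dvd_trans by blast
    from pshift_dvd[OF this, of "int m"] show "a dvd pshift (int m) v" by simp
  qed
  have one: "\<exists>q. a dvd q \<and> bdiff q = p * pshift d r - r * pshift (- d) p"
    if "yfac a d dvd p" "yfac a (- d) dvd r" for p r d
  proof (cases "0 \<le> d")
    case True
    define v where "v = r * pshift (- d) p"
    have "a dvd - (\<Sum>m<nat d. pshift (int m) v)"
      using that True sum_dvd[of "nat d" v] by (simp add: v_def)
    moreover have "bdiff (- (\<Sum>m<nat d. pshift (int m) v)) = p * pshift d r - r * pshift (- d) p"
      using True unfolding bdiff_simps telescope by (simp add: v_def algebra_simps)
    ultimately show ?thesis by blast
  next
    case False
    define v where "v = p * pshift d r"
    have "a dvd (\<Sum>m<nat (- d). pshift (int m) v)"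
      using that False sum_dvd[of "nat (- d)" v] by (simp add: v_def)
    moreover have "bdiff (\<Sum>m<nat (- d). pshift (int m) v) = p * pshift d r - r * pshift (- d) p"
      using False unfolding telescope by (simp add: v_def algebra_simps)
    ultimately show ?thesis by blast
  qed
  define E where "E = supp z \<union> uminus ` supp w"
  have E: "finite E" by (simp add: E_def)
  have "\<forall>d. \<exists>q. a dvd q \<and> bdiff q = cf z d * pshift d (cf w (- d)) - cf w (- d) * pshift (- d) (cf z d)"
    by (intro allI one gwa_subD[OF z] gwa_subD[OF w])
  from choice[OF this] obtain q where q: "\<And>d. a dvd q d"
    "\<And>d. bdiff (q d) = cf z d * pshift d (cf w (- d)) - cf w (- d) * pshift (- d) (cf z d)" by blast
  have 1: "cf (z * w) 0 = (\<Sum>d\<in>E. cf z d * pshift d (cf w (- d)))"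
    by (subst cf_times[OF E]) (auto simp: E_def)
  have "cf (w * z) 0 = (\<Sum>d\<in>uminus ` E. cf w d * pshift d (cf z (- d)))"
    by (subst cf_times[of "uminus ` E"]) (auto simp: E_def image_image image_Un)
  also have "\<dots> = (\<Sum>d\<in>E. cf w (- d) * pshift (- d) (cf z d))"
    by (subst sum.reindex) (auto simp: inj_on_def)
  finally have 2: "cf (w * z) 0 = (\<Sum>d\<in>E. cf w (- d) * pshift (- d) (cf z d))" .
  have "bdiff (\<Sum>d\<in>E. q d) = cf (z * w) 0 - cf (w * z) 0"
    unfolding 1 2 bdiff_sum q by (simp add: sum_subtractf)
  moreover have "a dvd (\<Sum>d\<in>E. q d)" using q by (intro dvd_sum) auto
  ultimately show ?thesis using that by blast
qed

lemma tau_commute: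
  assumes "z \<in> gwa_sub a" "w \<in> gwa_sub a" "poly a s = 0" "poly a t = 0"
  shows "tau s t (z * w) = tau s t (w * z)"
proof -
  obtain q where q: "a dvd q" "bdiff q = cf (z * w) 0 - cf (w * z) 0"
    using commutator_bdiff[OF assms(1,2)] by blast
  have "tau s t (z * w - w * z) = poly q s - poly q t"
    using q by (intro tau_eq) (simp add: cf_minus)
  also have "\<dots> = 0" using q(1) assms(3,4) by (auto simp: dvd_def)
  finally show ?thesis using tau_add[of s t "z * w - w * z" "w * z"] by simp
qed

lemma prod_linear_dvd:
  fixes lam :: "'i \<Rightarrow> 'a::field_char_0"
  assumes "finite I" "inj_on lam I" "\<And>i. i \<in> I \<Longrightarrow> poly r (lam i) = 0"
  shows "(\<Prod>i\<in>I. [:- lam i, 1:]) dvd r"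
  using assms
proof (induction I rule: finite_induct)
  case (insert j I)
  then have "(\<Prod>i\<in>I. [:- lam i, 1:]) dvd r" by simp
  then obtain s where s: "r = (\<Prod>i\<in>I. [:- lam i, 1:]) * s" by blast
  have "poly r (lam j) = 0" using insert by simp
  moreover have "poly (\<Prod>i\<in>I. [:- lam i, 1:]) (lam j) \<noteq> 0"
    using insert by (auto simp: poly_prod)
  ultimately have "[:- lam j, 1:] dvd s" by (simp add: s poly_eq_0_iff_dvd)
  then show ?case using insert.hyps by (simp add: s mult_dvd_mono mult.commute del: mult_pCons_left mult_pCons_right)
qed simp

lemma trace_spanned_by_tau:
  fixes lam :: "nat \<Rightarrow> 'a::field_char_0"
  assumes n: "1 \<le> n" and a: "a = (\<Prod>i=1..n. [:- lam i, 1:])" and inj: "inj_on lam {1..n}"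
    and l: "\<And>i j. i \<in> {1..n} \<Longrightarrow> j \<in> {1..<n} \<Longrightarrow> poly (l j) (lam i) = (if i = j then 1 else 0)"
    and add: "\<And>z w. z \<in> gwa_sub a \<Longrightarrow> w \<in> gwa_sub a \<Longrightarrow> \<phi> (z + w) = \<phi> z + \<phi> w"
    and scale: "\<And>c z. z \<in> gwa_sub a \<Longrightarrow> \<phi> (smon [:c:] 0 * z) = c * (\<phi> z :: 'a)"
    and comm: "\<And>z w. z \<in> gwa_sub a \<Longrightarrow> w \<in> gwa_sub a \<Longrightarrow> \<phi> (z * w) = \<phi> (w * z)"
    and z: "z \<in> gwa_sub a"
  shows "\<phi> z = (\<Sum>j\<in>{1..<n}. tau (lam n) (lam j) z * \<phi> (smon (- bdiff (l j)) 0))"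
proof -
  have zero: "\<phi> 0 = 0" using add[of 0 0] gwa_sub_closed(1)[of a] by simp
  have sum: "\<phi> (sum f I) = (\<Sum>i\<in>I. \<phi> (f i))" "sum f I \<in> gwa_sub a"
    if "finite I" "\<And>i. i \<in> I \<Longrightarrow> f i \<in> gwa_sub a" for f :: "'b \<Rightarrow> 'a skew" and I
    using that by (induction I rule: finite_induct) (auto simp: zero add gwa_sub_closed)
  have minus: "\<phi> (x - y) = \<phi> x - \<phi> y" if "x \<in> gwa_sub a" "y \<in> gwa_sub a" for x y
    using add[OF gwa_sub_closed(4)[OF that] that(2)] by simp
  have graded: "\<phi> (smon p d) = 0" if "smon p d \<in> gwa_sub a" "d \<noteq> 0" for p d
  proof -
    have "smon [:0, 1:] 0 * smon p d - smon p d * smon [:0, 1:] 0 = smon [:of_int d:] 0 * smon p d"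
      unfolding smon_times_smon by (rule skew_eqI) (auto simp: cf_smon cf_minus intro!: poly_ext, simp add: algebra_simps)
    then have "of_int d * \<phi> (smon p d) =
        \<phi> (smon [:0, 1:] 0 * smon p d) - \<phi> (smon p d * smon [:0, 1:] 0)"
      using minus[of "smon [:0, 1:] 0 * smon p d" "smon p d * smon [:0, 1:] 0"] that scale[of "smon p d" "of_int d"]
      by (simp add: gwa_sub_times smon0_gwa_sub)
    also have "\<dots> = 0" using comm[OF smon0_gwa_sub that(1)] by simp
    finally show ?thesis using that by simp
  qed
  have "\<phi> z = \<phi> (\<Sum>d\<in>insert 0 (supp z). smon (cf z d) d)"
    using skew_smon_decomp[of "insert 0 (supp z)" z] by (simp add: subset_insertI)
  also have "\<dots> = (\<Sum>d\<in>insert 0 (supp z). \<phi> (smon (cf z d) d))"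
    using z smon_cf_gwa_sub by (intro sum(1)) auto
  also have "\<dots> = (\<Sum>d\<in>{0}. \<phi> (smon (cf z d) d))"
    using graded[OF smon_cf_gwa_sub[OF z]] by (intro sum.mono_neutral_right) auto
  finally have z0: "\<phi> z = \<phi> (smon (cf z 0) 0)" by simp
  obtain q where q: "bdiff q = cf z 0" using bdiff_surj by blast
  define t where "t j = tau (lam n) (lam j) z" for j
  have t: "t j = poly q (lam n) - poly q (lam j)" for j
    unfolding t_def by (rule tau_eq[OF q])
  define r where "r = q - [:poly q (lam n):] + (\<Sum>j\<in>{1..<n}. [:t j:] * l j)"
  have "poly r (lam i) = 0" if i: "i \<in> {1..n}" for i
  proof -
    have "(\<Sum>j\<in>{1..<n}. t j * poly (l j) (lam i)) = (\<Sum>j\<in>{1..<n}. if i = j then t j else 0)"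
      using i l by (intro sum.cong) auto
    also have "\<dots> = t i" using i by (cases "i = n") (auto simp: t)
    finally show ?thesis by (simp add: r_def poly_sum t)
  qed
  then have "a dvd r" unfolding a using inj by (intro prod_linear_dvd) auto
  then obtain g where g: "r = a * g" by blast
  have y: "smon a (- 1) \<in> gwa_sub a" by (rule smon_gwa_sub) (simp add: yfac_minus_one)
  have x: "smon (pshift 1 g) 1 \<in> gwa_sub a" by (rule smon_gwa_sub) (simp add: yfac_nonneg)
  have "smon (bdiff r) 0 = smon a (- 1) * smon (pshift 1 g) 1 - smon (pshift 1 g) 1 * smon a (- 1)"
    by (simp add: smon_times_smon g bdiff_def smon_diff mult.commute)
  then have "\<phi> (smon (bdiff r) 0) = 0"
    using comm[OF y x] by (simp add: minus gwa_sub_times x y)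
  moreover have "bdiff r = cf z 0 - (\<Sum>j\<in>{1..<n}. [:t j:] * - bdiff (l j))"
    by (simp add: r_def bdiff_simps bdiff_sum q sum_negf del: mult_pCons_left)
  then have "smon (cf z 0) 0 = smon (bdiff r) 0 + (\<Sum>j\<in>{1..<n}. smon [:t j:] 0 * smon (- bdiff (l j)) 0)"
    by (simp add: smon_diff smon_sum smon_times_smon del: mult_pCons_left)
  ultimately have "\<phi> (smon (cf z 0) 0) = \<phi> (\<Sum>j\<in>{1..<n}. smon [:t j:] 0 * smon (- bdiff (l j)) 0)"
    by (simp add: add sum gwa_sub_times smon0_gwa_sub)
  also have "\<dots> = (\<Sum>j\<in>{1..<n}. t j * \<phi> (smon (- bdiff (l j)) 0))"
    by (subst sum) (auto simp: gwa_sub_times smon0_gwa_sub scale)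
  finally show ?thesis by (simp add: z0 t_def)
qed

section \<open>Integrality of traces of left ideals\<close>

lemma idempotent_kernel_trace:
  fixes P :: "'i \<Rightarrow> 'i \<Rightarrow> 'a::field"
  assumes "finite I" "\<And>x z. x \<in> I \<Longrightarrow> z \<in> I \<Longrightarrow> (\<Sum>y\<in>I. P x y * P y z) = P x z"
  shows "(\<Sum>x\<in>I. P x x) \<in> \<nat>"
  using assms
proof (induction "card I" arbitrary: I P)
  case 0
  then show ?case by simp
next
  case (Suc k)
  note idem = Suc.prems(2)
  show ?case
  proof (cases "\<forall>x\<in>I. \<forall>y\<in>I. P y x = 0")
    case True
    then have "(\<Sum>x\<in>I. P x x) = 0" by simp
    then show ?thesis by (metis Nats_0)
  next
    case False
    then obtain x0 y0 where x0: "x0 \<in> I" and y0: "y0 \<in> I" and ne: "P y0 x0 \<noteq> 0" by blast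
    define r where "r z = P y0 z / P y0 x0" for z
    define P' where "P' x z = P x z - P x x0 * r z" for x z
    have rc: "(\<Sum>y\<in>I. r y * P y z) = r z" if "z \<in> I" for z
      using idem[OF y0 that] by (simp add: r_def sum_divide_distrib[symmetric])
    have rx0: "r x0 = 1" using ne by (simp add: r_def)
    have zero: "P' y0 z = 0" for z using ne by (simp add: P'_def r_def)
    have P': "(\<Sum>y\<in>I. P' x y * P' y z) = P' x z" if "x \<in> I" "z \<in> I" for x z
    proof -
      have "(\<Sum>y\<in>I. P' x y * P' y z) = (\<Sum>y\<in>I. P x y * P y z) - (\<Sum>y\<in>I. P x y * P y x0) * r z
          - P x x0 * (\<Sum>y\<in>I. r y * P y z) + P x x0 * (\<Sum>y\<in>I. r y * P y x0) * r z"
        by (simp add: P'_def algebra_simps sum.distrib sum_subtractf sum_distrib_left sum_distrib_right)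
      then show ?thesis using that x0 by (simp add: idem rc rx0 P'_def)
    qed
    have "(\<Sum>x\<in>I. P x x) = (\<Sum>x\<in>I. P' x x) + (\<Sum>x\<in>I. r x * P x x0)"
      by (simp add: P'_def sum.distrib sum_subtractf mult.commute)
    also have "(\<Sum>x\<in>I. r x * P x x0) = 1" using rc[OF x0] rx0 by simp
    also have "(\<Sum>x\<in>I. P' x x) = (\<Sum>x\<in>I - {y0}. P' x x)"
      using Suc.prems(1) y0 zero by (simp add: sum.remove)
    finally have eq: "(\<Sum>x\<in>I. P x x) = (\<Sum>x\<in>I - {y0}. P' x x) + 1" .
    have "(\<Sum>x\<in>I - {y0}. P' x x) \<in> \<nat>"
    proof (rule Suc.hyps(1)[of "I - {y0}" P'])
      show "k = card (I - {y0})" using Suc.hyps(2) y0 Suc.prems(1) by simp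
      show "finite (I - {y0})" using Suc.prems(1) by simp
      fix x z assume "x \<in> I - {y0}" "z \<in> I - {y0}"
      then show "(\<Sum>y\<in>I - {y0}. P' x y * P' y z) = P' x z"
        using P'[of x z] Suc.prems(1) y0 zero by (simp add: sum.remove)
    qed
    then show ?thesis unfolding eq by (metis Nats_add Nats_1)
  qed
qed

definition ratfun :: "('a::field_char_0 \<Rightarrow> 'a) \<Rightarrow> bool" where
  "ratfun G \<longleftrightarrow> (\<exists>P Q. Q \<noteq> 0 \<and> (\<forall>z. poly Q z \<noteq> 0 \<longrightarrow> G z = poly P z / poly Q z))"

lemma ratfun_poly: "ratfun (\<lambda>z. poly p (z + c))"
  unfolding ratfun_def
  by (intro exI[of _ "pcompose p [:c, 1:]"] exI[of _ 1]) (simp add: poly_pcompose add.commute)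

lemma ratfun_divide:
  assumes "q \<noteq> 0" shows "ratfun (\<lambda>z. poly p (z + c) / poly q (z + c))"
  unfolding ratfun_def
proof (intro exI conjI)
  show "pcompose q [:c, 1:] \<noteq> 0" using assms by (simp add: pcompose_eq_0_iff)
  show "\<forall>z. poly (pcompose q [:c, 1:]) z \<noteq> 0 \<longrightarrow>
      poly p (z + c) / poly q (z + c) = poly (pcompose p [:c, 1:]) z / poly (pcompose q [:c, 1:]) z"
    by (simp add: poly_pcompose add.commute)
qed

lemma ratfun_add: "ratfun f \<Longrightarrow> ratfun g \<Longrightarrow> ratfun (\<lambda>z. f z + g z)"
proof -
  assume "ratfun f" "ratfun g"
  then obtain P Q R S where *: "Q \<noteq> 0" "\<And>z. poly Q z \<noteq> 0 \<Longrightarrow> f z = poly P z / poly Q z"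
    "S \<noteq> 0" "\<And>z. poly S z \<noteq> 0 \<Longrightarrow> g z = poly R z / poly S z"
    unfolding ratfun_def by metis
  show ?thesis unfolding ratfun_def
    by (intro exI[of _ "P * S + R * Q"] exI[of _ "Q * S"]) (simp add: * add_frac_eq)
qed

lemma ratfun_mult: "ratfun f \<Longrightarrow> ratfun g \<Longrightarrow> ratfun (\<lambda>z. f z * g z)"
proof -
  assume "ratfun f" "ratfun g"
  then obtain P Q R S where *: "Q \<noteq> 0" "\<And>z. poly Q z \<noteq> 0 \<Longrightarrow> f z = poly P z / poly Q z"
    "S \<noteq> 0" "\<And>z. poly S z \<noteq> 0 \<Longrightarrow> g z = poly R z / poly S z"
    unfolding ratfun_def by metis
  show ?thesis unfolding ratfun_def
    by (intro exI[of _ "P * R"] exI[of _ "Q * S"]) (simp add: *)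
qed

lemma ratfun_const: "ratfun (\<lambda>z. c)"
  unfolding ratfun_def by (intro exI[of _ "[:c:]"] exI[of _ 1]) simp

lemma ratfun_sum: "(\<And>i. i \<in> I \<Longrightarrow> ratfun (f i)) \<Longrightarrow> ratfun (\<lambda>z. \<Sum>i\<in>I. f i z)"
  by (induction I rule: infinite_finite_induct) (auto intro: ratfun_const ratfun_add)

lemma eventually_poly_nonzero:
  fixes p :: "'a::field_char_0 poly"
  assumes "p \<noteq> 0"
  obtains K :: int where "\<And>u. u \<ge> K \<Longrightarrow> poly p (c + of_int u) \<noteq> 0"
proof -
  have "finite {u::int. poly p (c + of_int u) = 0}"
  proof (rule finite_imageD)
    show "finite ((\<lambda>u. c + of_int u) ` {u::int. poly p (c + of_int u) = 0})"
      by (rule finite_subset[OF _ poly_roots_finite[OF assms]]) auto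
  qed (auto intro: inj_onI)
  then have "bdd_above {u::int. poly p (c + of_int u) = 0}" by (rule bdd_above_finite)
  then obtain K where K: "\<And>u. poly p (c + of_int u) = 0 \<Longrightarrow> u \<le> K"
    unfolding bdd_above_def by blast
  have "poly p (c + of_int u) \<noteq> 0" if "u \<ge> K + 1" for u
    using K[of u] that by auto
  then show ?thesis by (rule that)
qed

lemma ratfun_increment:
  fixes G :: "'a::field_char_0 \<Rightarrow> 'a"
  assumes "ratfun G" "\<And>N::int. N \<ge> N0 \<Longrightarrow> G (s + of_int (N + 1)) = G (s + of_int N) + 1"
  obtains \<kappa> where "\<And>c. \<exists>K::int. \<forall>N\<ge>K. G (c + of_int N) = \<kappa> + c + of_int N"
proof -
  obtain P Q where Q: "Q \<noteq> 0" and G: "\<And>z. poly Q z \<noteq> 0 \<Longrightarrow> G z = poly P z / poly Q z"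
    using assms(1) unfolding ratfun_def by blast
  obtain K where K: "\<And>u. u \<ge> K \<Longrightarrow> poly Q (s + of_int u) \<noteq> 0"
    using eventually_poly_nonzero[OF Q] by blast
  define M where "M = max K N0"
  define \<kappa> where "\<kappa> = G (s + of_int M) - (s + of_int M)"
  have lin: "G (s + of_int (M + int k)) = \<kappa> + (s + of_int (M + int k))" for k
  proof (induction k)
    case (Suc k)
    have "G (s + of_int (M + int k + 1)) = G (s + of_int (M + int k)) + 1"
      by (rule assms(2)) (simp add: M_def)
    with Suc show ?case by (simp add: algebra_simps)
  qed (simp add: \<kappa>_def)
  define D where "D = P - [:\<kappa>, 1:] * Q"
  have "poly D (s + of_int (M + int k)) = 0" for k
  proof -
    have "poly Q (s + of_int (M + int k)) \<noteq> 0" by (rule K) (simp add: M_def)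
    then have "poly P (s + of_int (M + int k)) = (\<kappa> + (s + of_int (M + int k))) * poly Q (s + of_int (M + int k))"
      using G lin by (metis nonzero_eq_divide_eq)
    then show ?thesis by (simp add: D_def algebra_simps)
  qed
  then have sub: "range (\<lambda>k. s + of_int (M + int k)) \<subseteq> {z. poly D z = 0}" by auto
  have "infinite (range (\<lambda>k. s + of_int (M + int k)))"
    by (rule range_inj_infinite) (auto intro!: injI)
  then have "D = 0" using sub poly_roots_finite finite_subset by blast
  then have P: "P = [:\<kappa>, 1:] * Q" by (simp add: D_def)
  have "\<exists>K::int. \<forall>N\<ge>K. G (c + of_int N) = \<kappa> + c + of_int N" for c
  proof -
    obtain K where "\<And>u. u \<ge> K \<Longrightarrow> poly Q (c + of_int u) \<noteq> 0"
      using eventually_poly_nonzero[OF Q] by blast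
    then show ?thesis using G by (intro exI[of _ K]) (simp add: P algebra_simps add_divide_distrib)
  qed
  then show ?thesis by (rule that)
qed

text \<open>
  Matrix entries of \<open>z\<close> acting on the functions on \<open>c + \<int>\<close>, in the basis of delta functions
  at the points \<open>c + 1 + t\<close>. For a root \<open>c\<close> of \<open>a\<close>, those with \<open>t \<ge> 0\<close> span a submodule.
\<close>

definition ent :: "'a::field_char_0 \<Rightarrow> 'a skew \<Rightarrow> int \<Rightarrow> int \<Rightarrow> 'a" where
  "ent c z t' t = poly (cf z (t' - t)) (c + 1 + of_int t')"

lemma ent_mult:
  assumes "finite W" "\<And>t'. t' \<notin> W \<Longrightarrow> ent c z t'' t' * ent c w t' t = 0"
  shows "ent c (z * w) t'' t = (\<Sum>t'\<in>W. ent c z t'' t' * ent c w t' t)"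
proof -
  let ?I = "(\<lambda>e. t'' - e) ` supp z"
  have "ent c (z * w) t'' t = (\<Sum>e\<in>supp z. ent c z t'' (t'' - e) * ent c w (t'' - e) t)"
    by (simp add: ent_def cf_times_supp poly_sum algebra_simps)
  also have "\<dots> = (\<Sum>t'\<in>?I. ent c z t'' t' * ent c w t' t)"
    by (subst sum.reindex) (auto simp: inj_on_def)
  also have "\<dots> = (\<Sum>t'\<in>?I \<union> W. ent c z t'' t' * ent c w t' t)"
  proof (rule sum.mono_neutral_left)
    show "\<forall>t'\<in>?I \<union> W - ?I. ent c z t'' t' * ent c w t' t = 0"
    proof
      fix t' assume "t' \<in> ?I \<union> W - ?I"
      then have "t'' - t' \<notin> supp z" by (auto simp: image_iff)
      then show "ent c z t'' t' * ent c w t' t = 0" by (simp add: ent_def not_supp)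
    qed
  qed (use assms in auto)
  also have "\<dots> = (\<Sum>t'\<in>W. ent c z t'' t' * ent c w t' t)"
    by (rule sum.mono_neutral_right) (use assms in auto)
  finally show ?thesis .
qed

lemma ent_negative:
  assumes "w \<in> gwa_sub a" "poly a c = 0" "0 \<le> t" "t' < 0"
  shows "ent c w t' t = 0"
proof -
  have "poly (yfac a (t' - t)) (c + 1 + of_int t') = 0"
    unfolding yfac_def poly_prod
    using assms(2-4) by (intro prod_zero bexI[of _ "- 1 - t'"]) auto
  then show ?thesis
    using gwa_subD[OF assms(1), of "t' - t"] by (auto simp: ent_def dvd_def)
qed

lemma ent_band: "supp z \<subseteq> {- \<beta>..\<beta>} \<Longrightarrow> \<beta> < \<bar>t' - t\<bar> \<Longrightarrow> ent c z t' t = 0"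
proof -
  assume *: "supp z \<subseteq> {- \<beta>..\<beta>}" "\<beta> < \<bar>t' - t\<bar>"
  have "t' - t \<notin> {- \<beta>..\<beta>}" using *(2) by auto
  then have "t' - t \<notin> supp z" using *(1) by blast
  then show ?thesis by (simp add: ent_def not_supp)
qed

lemma ent_smon_times: "ent c (smon p 0 * z) t' t = poly p (c + 1 + of_int t') * ent c z t' t"
  by (simp add: ent_def cf_smon_times)

lemma ent_times_smon: "ent c (z * smon p 0) t' t = ent c z t' t * poly p (c + 1 + of_int t)"
  by (simp add: ent_def cf_times_smon algebra_simps)

lemma ent_smon: "ent c (smon p 0) t' t = (if t' = t then poly p (c + 1 + of_int t) else 0)"
  by (simp add: ent_def cf_smon)

lemma ent_sum: "ent c (sum f A) t' t = (\<Sum>x\<in>A. ent c (f x) t' t)"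
  by (simp add: ent_def cf_sum poly_sum)

text \<open>
  \<open>e\<close> is the idempotent matrix of a projective left ideal; over the skew field of fractions it is
  the rank one matrix \<open>sp\<^sup>-\<^sup>1 B D\<close>, and (by \<open>sp'\<close> and \<open>D'\<close>) \<open>\<Sum>j. D j sp\<^sup>-\<^sup>1 B j = 1\<close>.
\<close>

locale rank_one_idempotent =
  fixes a :: "'a::field_char_0 poly" and m :: nat and sp sp' :: "'a poly"
    and B D D' :: "nat \<Rightarrow> 'a skew" and e :: "nat \<Rightarrow> nat \<Rightarrow> 'a skew" and \<beta> :: int
  assumes sp: "sp \<noteq> 0" and sp': "sp' \<noteq> 0" and \<beta>: "0 \<le> \<beta>"
    and band: "\<And>j. j < m \<Longrightarrow> supp (B j) \<subseteq> {- \<beta>..\<beta>}" "\<And>j. j < m \<Longrightarrow> supp (D j) \<subseteq> {- \<beta>..\<beta>}"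
      "\<And>j l. j < m \<Longrightarrow> l < m \<Longrightarrow> supp (e j l) \<subseteq> {- \<beta>..\<beta>}"
    and mem: "\<And>j l. j < m \<Longrightarrow> l < m \<Longrightarrow> e j l \<in> gwa_sub a"
    and sp_e: "\<And>j l. j < m \<Longrightarrow> l < m \<Longrightarrow> smon sp 0 * e j l = B j * D l"
    and D_e: "\<And>l. l < m \<Longrightarrow> (\<Sum>j<m. D j * e j l) = D l"
    and e_e: "\<And>j l. j < m \<Longrightarrow> l < m \<Longrightarrow> (\<Sum>k<m. e j k * e k l) = e j l"
    and D'_sp: "\<And>j. j < m \<Longrightarrow> smon sp' 0 * D j = D' j * smon sp 0"
    and D'_B: "(\<Sum>j<m. D' j * B j) = smon sp' 0"
begin

definition H :: "'a \<Rightarrow> 'a" where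
  "H z = (\<Sum>j<m. \<Sum>\<rho>\<in>{0..2 * \<beta>}. \<Sum>\<tau>\<in>{- \<beta>..<\<beta>}.
     poly (cf (B j) (\<tau> - \<rho>)) (z + (1 + of_int \<tau>)) / poly sp (z + (1 + of_int \<tau>)) *
     poly (cf (D j) (\<rho> - \<tau>)) (z + (1 + of_int \<rho>)))"

lemma ratfun_H: "ratfun H"
  unfolding H_def by (intro ratfun_sum ratfun_mult ratfun_divide ratfun_poly sp)

context
  fixes c :: 'a and N :: int
  assumes root: "poly a c = 0" and N: "3 * \<beta> \<le> N"
    and reg: "\<And>u. N - 3 * \<beta> \<le> u \<Longrightarrow> poly sp (c + 1 + of_int u) \<noteq> 0"
      "\<And>u. N - 3 * \<beta> \<le> u \<Longrightarrow> poly sp' (c + 1 + of_int u) \<noteq> 0"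
begin

abbreviation (input) W :: "int set" where "W \<equiv> {0..<N + 4 * \<beta> + 2}"
abbreviation (input) Rg :: "int set" where "Rg \<equiv> {N..N + 2 * \<beta>}"
abbreviation (input) sv :: "int \<Rightarrow> 'a" where "sv t \<equiv> poly sp (c + 1 + of_int t)"

definition U :: "nat \<Rightarrow> int \<Rightarrow> int \<Rightarrow> 'a" where "U j t r = ent c (B j) t r / sv t"
definition R :: "nat \<Rightarrow> nat \<Rightarrow> int \<Rightarrow> int \<Rightarrow> 'a" where
  "R j l t' t = (\<Sum>r\<in>Rg. U j t' r * ent c (D l) r t)"
definition E :: "nat \<Rightarrow> nat \<Rightarrow> int \<Rightarrow> int \<Rightarrow> 'a" where
  "E j l t' t = ent c (e j l) t' t - R j l t' t"

lemma U_band: "j < m \<Longrightarrow> \<beta> < \<bar>t - r\<bar> \<Longrightarrow> U j t r = 0"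
  using ent_band[OF band(1)] by (simp add: U_def)

lemma D_U:
  assumes "N - 3 * \<beta> \<le> \<rho>" "r \<in> Rg"
  shows "(\<Sum>k<m. \<Sum>t\<in>W. ent c (D k) \<rho> t * U k t r) = (if \<rho> = r then 1 else 0)"
proof -
  have "poly sp' (c + 1 + of_int \<rho>) * (\<Sum>k<m. \<Sum>t\<in>W. ent c (D k) \<rho> t * U k t r) =
    (\<Sum>k<m. \<Sum>t\<in>W. ent c (D' k) \<rho> t * ent c (B k) t r)"
    unfolding sum_distrib_left
  proof (intro sum.cong refl)
    fix k t assume k: "k \<in> {..<m}" and t: "t \<in> W"
    have "poly sp' (c + 1 + of_int \<rho>) * ent c (D k) \<rho> t = ent c (D' k) \<rho> t * sv t"
      using k by (simp add: ent_smon_times[symmetric] D'_sp ent_times_smon)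
    moreover have "sv t \<noteq> 0 \<or> ent c (B k) t r = 0"
    proof (cases "N - 3 * \<beta> \<le> t")
      case False
      then have "\<beta> < \<bar>t - r\<bar>" using assms(2) \<beta> by auto
      then show ?thesis using ent_band[OF band(1)] k by simp
    qed (simp add: reg)
    ultimately show "poly sp' (c + 1 + of_int \<rho>) * (ent c (D k) \<rho> t * U k t r) =
      ent c (D' k) \<rho> t * ent c (B k) t r"
      by (auto simp: U_def mult.assoc[symmetric])
  qed
  also have "\<dots> = (\<Sum>k<m. ent c (D' k * B k) \<rho> r)"
  proof (intro sum.cong refl ent_mult[symmetric])
    fix k t assume k: "k \<in> {..<m}" and t: "t \<notin> W"
    then have "\<beta> < \<bar>t - r\<bar>" using assms(2) \<beta> N by auto
    then show "ent c (D' k) \<rho> t * ent c (B k) t r = 0" using ent_band[OF band(1)] k by simp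
  qed simp
  also have "\<dots> = (if \<rho> = r then poly sp' (c + 1 + of_int \<rho>) else 0)"
    by (simp add: ent_sum[symmetric] D'_B ent_smon)
  finally show ?thesis using reg(2)[OF assms(1)] by (auto split: if_splits)
qed

lemma e_U:
  assumes j: "j < m" and r: "r \<in> Rg"
  shows "(\<Sum>k<m. \<Sum>t\<in>W. ent c (e j k) t'' t * U k t r) = U j t'' r"
proof (cases "N - 2 * \<beta> \<le> t''")
  case False
  have "ent c (e j k) t'' t * U k t r = 0" if "k < m" for k t
  proof (cases "\<beta> < \<bar>t'' - t\<bar>")
    case True
    then show ?thesis using ent_band[OF band(3)[OF j that]] by simp
  next
    case False
    then have "\<beta> < \<bar>t - r\<bar>" using \<open>\<not> N - 2 * \<beta> \<le> t''\<close> r \<beta> by auto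
    then show ?thesis using U_band that by simp
  qed
  then have "(\<Sum>k<m. \<Sum>t\<in>W. ent c (e j k) t'' t * U k t r) = 0"
    by (intro sum.neutral ballI) simp
  moreover have "U j t'' r = 0" using U_band[OF j] False r \<beta> by auto
  ultimately show ?thesis by simp
next
  case True
  let ?P = "{N - 3 * \<beta>..N + 5 * \<beta> + 2}"
  have s: "sv t'' \<noteq> 0" using True \<beta> by (intro reg) simp
  have "sv t'' * (\<Sum>k<m. \<Sum>t\<in>W. ent c (e j k) t'' t * U k t r) =
    (\<Sum>k<m. \<Sum>t\<in>W. \<Sum>\<rho>\<in>?P. ent c (B j) t'' \<rho> * ent c (D k) \<rho> t * U k t r)"
    unfolding sum_distrib_left
  proof (intro sum.cong refl)
    fix k t assume k: "k \<in> {..<m}" and t: "t \<in> W"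
    have 1: "sv t'' * ent c (e j k) t'' t = ent c (B j * D k) t'' t"
      using k j by (simp add: ent_smon_times[symmetric] sp_e)
    show "sv t'' * (ent c (e j k) t'' t * U k t r) =
      (\<Sum>\<rho>\<in>?P. ent c (B j) t'' \<rho> * ent c (D k) \<rho> t * U k t r)"
    proof (cases "\<beta> < \<bar>t - r\<bar>")
      case True
      then show ?thesis using U_band k by simp
    next
      case False
      have "ent c (B j * D k) t'' t = (\<Sum>\<rho>\<in>?P. ent c (B j) t'' \<rho> * ent c (D k) \<rho> t)"
      proof (rule ent_mult)
        fix \<rho> assume "\<rho> \<notin> ?P"
        then have "\<beta> < \<bar>\<rho> - t\<bar>" using t False r \<beta> by auto
        then show "ent c (B j) t'' \<rho> * ent c (D k) \<rho> t = 0"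
          using ent_band[OF band(2)] k by simp
      qed simp
      then show ?thesis by (simp add: mult.assoc[symmetric] 1 sum_distrib_right)
    qed
  qed
  also have "\<dots> = (\<Sum>\<rho>\<in>?P. ent c (B j) t'' \<rho> * (\<Sum>k<m. \<Sum>t\<in>W. ent c (D k) \<rho> t * U k t r))"
    unfolding sum_distrib_left mult.assoc
    by (subst sum.swap[of _ _ W], subst sum.swap[of _ ?P]) (rule refl)
  also have "\<dots> = (\<Sum>\<rho>\<in>?P. if \<rho> = r then ent c (B j) t'' \<rho> else 0)"
    using D_U[OF _ r] by (intro sum.cong) auto
  also have "\<dots> = ent c (B j) t'' r" using r \<beta> by simp
  finally show ?thesis using s by (simp add: U_def field_simps)
qed

lemma ent_mult_e:
  assumes l: "l < m" and t: "0 \<le> t" "t \<le> N + \<beta>"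
  shows "(\<Sum>k<m. \<Sum>t'\<in>W. ent c (z k) r t' * ent c (e k l) t' t) = ent c (\<Sum>k<m. z k * e k l) r t"
  unfolding ent_sum
proof (intro sum.cong refl ent_mult[symmetric])
  fix k t' assume k: "k \<in> {..<m}" and t': "t' \<notin> W"
  show "ent c (z k) r t' * ent c (e k l) t' t = 0"
  proof (cases "t' < 0")
    case True
    then show ?thesis using ent_negative[OF mem root t(1)] k l by simp
  next
    case False
    then have "\<beta> < \<bar>t' - t\<bar>" using t' t \<beta> by auto
    then show ?thesis using ent_band[OF band(3)] k l by simp
  qed
qed simp

lemma E_vanishes:
  assumes j: "j < m" and l: "l < m" and t: "t \<le> N + \<beta>" and t': "N + \<beta> \<le> t'"
  shows "E j l t' t = 0"
proof -
  have s: "sv t' \<noteq> 0" using t' \<beta> by (intro reg) simp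
  have "sv t' * R j l t' t = (\<Sum>r\<in>Rg. ent c (B j) t' r * ent c (D l) r t)"
    using s by (simp add: R_def U_def sum_distrib_left)
  also have "\<dots> = ent c (B j * D l) t' t"
  proof (rule ent_mult[symmetric])
    fix r assume "r \<notin> Rg"
    then have "\<beta> < \<bar>t' - r\<bar> \<or> \<beta> < \<bar>r - t\<bar>" using t t' by auto
    then show "ent c (B j) t' r * ent c (D l) r t = 0"
      using ent_band[OF band(1)[OF j]] ent_band[OF band(2)[OF l]] by auto
  qed simp
  also have "\<dots> = sv t' * ent c (e j l) t' t"
    using j l by (simp add: ent_smon_times[symmetric] sp_e)
  finally show ?thesis using s by (simp add: E_def)
qed

lemma R_R:
  assumes j: "j < m" and l: "l < m"
  shows "(\<Sum>k<m. \<Sum>t'\<in>W. R j k t'' t' * R k l t' t) = R j l t'' t"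
proof -
  have "(\<Sum>k<m. \<Sum>t'\<in>W. R j k t'' t' * R k l t' t) =
    (\<Sum>k<m. \<Sum>t'\<in>W. \<Sum>r\<in>Rg. \<Sum>\<rho>\<in>Rg. U j t'' r * (ent c (D k) r t' * U k t' \<rho>) * ent c (D l) \<rho> t)"
    unfolding R_def sum_product by (simp add: mult.assoc)
  also have "\<dots> = (\<Sum>r\<in>Rg. \<Sum>\<rho>\<in>Rg. \<Sum>k<m. \<Sum>t'\<in>W. U j t'' r * (ent c (D k) r t' * U k t' \<rho>) * ent c (D l) \<rho> t)"
    by (subst sum.swap[of _ _ W], subst sum.swap[of _ Rg], subst sum.swap[of _ Rg W],
        subst sum.swap[of _ Rg "{..<m}"]) (rule refl)
  also have "\<dots> = (\<Sum>r\<in>Rg. \<Sum>\<rho>\<in>Rg. U j t'' r * (\<Sum>k<m. \<Sum>t'\<in>W. ent c (D k) r t' * U k t' \<rho>) * ent c (D l) \<rho> t)"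
    by (simp add: sum_distrib_left sum_distrib_right)
  also have "\<dots> = (\<Sum>r\<in>Rg. \<Sum>\<rho>\<in>Rg. if r = \<rho> then U j t'' r * ent c (D l) \<rho> t else 0)"
    using D_U \<beta> by (intro sum.cong refl) auto
  also have "\<dots> = R j l t'' t" by (simp add: R_def)
  finally show ?thesis .
qed

lemma E_idempotent:
  assumes j: "j < m" and l: "l < m" and t: "0 \<le> t" "t < N + \<beta>"
  shows "(\<Sum>k<m. \<Sum>t'\<in>{0..<N + \<beta>}. E j k t'' t' * E k l t' t) = E j l t'' t"
proof -
  have "(\<Sum>k<m. \<Sum>t'\<in>{0..<N + \<beta>}. E j k t'' t' * E k l t' t) = (\<Sum>k<m. \<Sum>t'\<in>W. E j k t'' t' * E k l t' t)"
    using E_vanishes l t \<beta> by (intro sum.cong refl sum.mono_neutral_left) auto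
  also have "\<dots> = (\<Sum>k<m. \<Sum>t'\<in>W. ent c (e j k) t'' t' * ent c (e k l) t' t)
      - (\<Sum>k<m. \<Sum>t'\<in>W. ent c (e j k) t'' t' * R k l t' t)
      - (\<Sum>k<m. \<Sum>t'\<in>W. R j k t'' t' * ent c (e k l) t' t)
      + (\<Sum>k<m. \<Sum>t'\<in>W. R j k t'' t' * R k l t' t)"
    by (simp add: E_def algebra_simps sum.distrib sum_subtractf)
  also have "(\<Sum>k<m. \<Sum>t'\<in>W. ent c (e j k) t'' t' * R k l t' t) =
      (\<Sum>r\<in>Rg. (\<Sum>k<m. \<Sum>t'\<in>W. ent c (e j k) t'' t' * U k t' r) * ent c (D l) r t)"
    unfolding R_def sum_distrib_left sum_distrib_right mult.assoc
    by (subst sum.swap[of _ _ W], subst sum.swap[of _ Rg]) (rule refl)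
  also have "\<dots> = R j l t'' t" by (simp add: e_U[OF j] R_def)
  also have "(\<Sum>k<m. \<Sum>t'\<in>W. R j k t'' t' * ent c (e k l) t' t) =
      (\<Sum>r\<in>Rg. U j t'' r * (\<Sum>k<m. \<Sum>t'\<in>W. ent c (D k) r t' * ent c (e k l) t' t))"
    unfolding R_def sum_distrib_left sum_distrib_right mult.assoc
    by (subst sum.swap[of _ _ W], subst sum.swap[of _ Rg]) (rule refl)
  also have "\<dots> = R j l t'' t" using t by (simp add: ent_mult_e[OF l] D_e[OF l] R_def)
  also have "(\<Sum>k<m. \<Sum>t'\<in>W. R j k t'' t' * R k l t' t) = R j l t'' t" by (rule R_R[OF j l])
  also have "(\<Sum>k<m. \<Sum>t'\<in>W. ent c (e j k) t'' t' * ent c (e k l) t' t) = ent c (e j l) t'' t"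
    using t by (simp add: ent_mult_e[OF l] e_e[OF j l])
  finally show ?thesis by (simp add: E_def)
qed

lemma E_trace_Nats: "(\<Sum>j<m. \<Sum>t\<in>{0..<N + \<beta>}. E j j t t) \<in> \<nat>"
proof -
  let ?P = "\<lambda>(j, t') (l, t). E j l t' t"
  have "(\<Sum>x\<in>{..<m} \<times> {0..<N + \<beta>}. ?P x x) \<in> \<nat>"
  proof (rule idempotent_kernel_trace[where P = ?P])
    fix x z assume "x \<in> {..<m} \<times> {0..<N + \<beta>}" "z \<in> {..<m} \<times> {0..<N + \<beta>}"
    then obtain j t' l t where "x = (j, t')" "z = (l, t)" "j < m" "l < m" "0 \<le> t" "t < N + \<beta>"
      by auto
    then show "(\<Sum>y\<in>{..<m} \<times> {0..<N + \<beta>}. ?P x y * ?P y z) = ?P x z"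
      using E_idempotent[of j l t t'] by (simp add: sum.cartesian_product case_prod_unfold)
  qed simp
  then show ?thesis by (simp add: sum.cartesian_product case_prod_unfold)
qed

lemma R_trace: "(\<Sum>j<m. \<Sum>t\<in>{0..<N + \<beta>}. R j j t t) = H (c + of_int N)"
proof -
  have "(\<Sum>j<m. \<Sum>t\<in>{0..<N + \<beta>}. R j j t t) = (\<Sum>j<m. \<Sum>r\<in>Rg. \<Sum>t\<in>{0..<N + \<beta>}. U j t r * ent c (D j) r t)"
    unfolding R_def by (intro sum.cong refl sum.swap)
  also have "\<dots> = (\<Sum>j<m. \<Sum>r\<in>Rg. \<Sum>t\<in>{N - \<beta>..<N + \<beta>}. U j t r * ent c (D j) r t)"
    using U_band N \<beta> by (intro sum.cong refl sum.mono_neutral_right) auto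
  also have "\<dots> = (\<Sum>j<m. \<Sum>\<rho>\<in>{0..2 * \<beta>}. \<Sum>\<tau>\<in>{- \<beta>..<\<beta>}. U j (N + \<tau>) (N + \<rho>) * ent c (D j) (N + \<rho>) (N + \<tau>))"
  proof (rule sum.cong[OF refl])
    fix j
    have "(\<Sum>r\<in>Rg. \<Sum>t\<in>{N - \<beta>..<N + \<beta>}. U j t r * ent c (D j) r t) =
      (\<Sum>\<rho>\<in>{0..2 * \<beta>}. \<Sum>t\<in>{N - \<beta>..<N + \<beta>}. U j t (N + \<rho>) * ent c (D j) (N + \<rho>) t)"
      by (rule sum.reindex_bij_witness[of _ "\<lambda>\<rho>. N + \<rho>" "\<lambda>r. r - N"]) auto
    also have "\<dots> = (\<Sum>\<rho>\<in>{0..2 * \<beta>}. \<Sum>\<tau>\<in>{- \<beta>..<\<beta>}. U j (N + \<tau>) (N + \<rho>) * ent c (D j) (N + \<rho>) (N + \<tau>))"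
      by (rule sum.cong[OF refl],
          rule sum.reindex_bij_witness[of _ "\<lambda>\<tau>. N + \<tau>" "\<lambda>t. t - N"]) auto
    finally show "(\<Sum>r\<in>Rg. \<Sum>t\<in>{N - \<beta>..<N + \<beta>}. U j t r * ent c (D j) r t) = \<dots>" .
  qed
  also have "\<dots> = H (c + of_int N)"
    unfolding H_def U_def ent_def by (intro sum.cong refl) (simp add: algebra_simps)
  finally show ?thesis .
qed

lemma e_trace:
  assumes "bdiff q = cf (\<Sum>j<m. e j j) 0"
  shows "(\<Sum>j<m. \<Sum>t\<in>{0..<N + \<beta>}. ent c (e j j) t t) = poly q (c + of_int (N + \<beta>)) - poly q c"
proof -
  have step: "(\<Sum>j<m. ent c (e j j) t t) = poly q (c + of_int (t + 1)) - poly q (c + of_int t)" for t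
  proof -
    have "(\<Sum>j<m. ent c (e j j) t t) = poly (bdiff q) (c + 1 + of_int t)"
      by (simp add: assms ent_def cf_sum poly_sum)
    then show ?thesis by (simp add: bdiff_def algebra_simps)
  qed
  have "(\<Sum>t\<in>{0..<int k}. \<Sum>j<m. ent c (e j j) t t) = poly q (c + of_int (int k)) - poly q c" for k
  proof (induction k)
    case (Suc k)
    have "{0..<int (Suc k)} = insert (int k) {0..<int k}" by auto
    then show ?case using Suc by (simp add: step algebra_simps)
  qed simp
  from this[of "nat (N + \<beta>)"] show ?thesis using N \<beta> by (subst sum.swap) simp
qed

lemma trace_E:
  assumes "bdiff q = cf (\<Sum>j<m. e j j) 0"
  shows "(\<Sum>j<m. \<Sum>t\<in>{0..<N + \<beta>}. E j j t t) = poly q (c + of_int (N + \<beta>)) - H (c + of_int N) - poly q c"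
  using e_trace[OF assms] R_trace unfolding E_def by (simp add: sum_subtractf)

lemma trace_integral:
  assumes "bdiff q = cf (\<Sum>j<m. e j j) 0"
  shows "poly q (c + of_int (N + \<beta>)) - H (c + of_int N) - poly q c \<in> \<int>"
  using E_trace_Nats trace_E[OF assms] Nats_subset_Ints by (metis subsetD)

lemma trace_E_extend: "(\<Sum>j<m. \<Sum>t\<in>{0..N + \<beta>}. E j j t t) = (\<Sum>j<m. \<Sum>t\<in>{0..<N + \<beta>}. E j j t t)"
  using E_vanishes \<beta> N by (intro sum.cong refl sum.mono_neutral_right) auto

end

lemma trace_increment:
  assumes root: "poly a c = 0" and N: "3 * \<beta> \<le> N"
    and reg: "\<And>u. N - 3 * \<beta> \<le> u \<Longrightarrow> poly sp (c + 1 + of_int u) \<noteq> 0"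
      "\<And>u. N - 3 * \<beta> \<le> u \<Longrightarrow> poly sp' (c + 1 + of_int u) \<noteq> 0"
    and q: "bdiff q = cf (\<Sum>j<m. e j j) 0"
  shows "poly q (c + of_int (N + 1 + \<beta>)) - H (c + of_int (N + 1)) =
    poly q (c + of_int (N + \<beta>)) - H (c + of_int N) + 1"
proof -
  note ctx = root N reg
  have N': "3 * \<beta> \<le> N + 1" and reg': "\<And>u. N + 1 - 3 * \<beta> \<le> u \<Longrightarrow> poly sp (c + 1 + of_int u) \<noteq> 0"
      "\<And>u. N + 1 - 3 * \<beta> \<le> u \<Longrightarrow> poly sp' (c + 1 + of_int u) \<noteq> 0"
    using N reg by auto
  note ctx' = root N' reg'
  have RR: "R c N j j t t - R c (N + 1) j j t t = U c j t N * ent c (D j) N t"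
    if t: "t \<le> N + \<beta>" and j: "j < m" for j t
  proof -
    let ?f = "\<lambda>r. U c j t r * ent c (D j) r t"
    have z: "?f r = 0" if "N + 2 * \<beta> < r" for r
      using that t ent_band[OF band(2)[OF j], of r t] by simp
    have 1: "(\<Sum>r\<in>{N..N + 2 * \<beta>}. ?f r) = ?f N + (\<Sum>r\<in>{N + 1..N + 2 * \<beta>}. ?f r)"
    proof -
      have "{N..N + 2 * \<beta>} = insert N {N + 1..N + 2 * \<beta>}" using \<beta> by auto
      then show ?thesis by simp
    qed
    have 2: "(\<Sum>r\<in>{N + 1..N + 1 + 2 * \<beta>}. ?f r) = (\<Sum>r\<in>{N + 1..N + 2 * \<beta>}. ?f r)"
      by (intro sum.mono_neutral_right ballI z) auto
    have "R c N j j t t = (\<Sum>r\<in>{N..N + 2 * \<beta>}. ?f r)"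
      by (rule R_def[OF ctx])
    moreover have "R c (N + 1) j j t t = (\<Sum>r\<in>{N + 1..N + 1 + 2 * \<beta>}. ?f r)"
      by (rule R_def[OF ctx'])
    ultimately show ?thesis by (simp only: 1 2 add_diff_cancel_right')
  qed
  have "(\<Sum>j<m. \<Sum>t\<in>{0..<N + 1 + \<beta>}. E c (N + 1) j j t t) - (\<Sum>j<m. \<Sum>t\<in>{0..<N + \<beta>}. E c N j j t t) =
    (\<Sum>j<m. \<Sum>t\<in>{0..N + \<beta>}. E c (N + 1) j j t t - E c N j j t t)"
  proof -
    have "{0..<N + 1 + \<beta>} = {0..N + \<beta>}" by auto
    then show ?thesis by (simp add: trace_E_extend[OF ctx, symmetric] sum_subtractf)
  qed
  also have "\<dots> = (\<Sum>j<m. \<Sum>t\<in>{0..N + \<beta>}. ent c (D j) N t * U c j t N)"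
  proof (intro sum.cong refl)
    fix j t assume jt: "j \<in> {..<m}" "t \<in> {0..N + \<beta>}"
    have "E c N j j t t = ent c (e j j) t t - R c N j j t t"
      by (rule E_def[OF ctx])
    moreover have "E c (N + 1) j j t t = ent c (e j j) t t - R c (N + 1) j j t t"
      by (rule E_def[OF ctx'])
    ultimately show "E c (N + 1) j j t t - E c N j j t t = ent c (D j) N t * U c j t N"
      using RR[of t j] jt by (simp add: mult.commute del: add.commute)
  qed
  also have "\<dots> = (\<Sum>j<m. \<Sum>t\<in>{0..<N + 4 * \<beta> + 2}. ent c (D j) N t * U c j t N)"
    using U_band[OF ctx] \<beta> by (intro sum.cong refl sum.mono_neutral_left) auto
  also have "\<dots> = 1" using D_U[OF ctx, of N N] \<beta> by simp
  finally have "(\<Sum>j<m. \<Sum>t\<in>{0..<N + 1 + \<beta>}. E c (N + 1) j j t t) =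
    (\<Sum>j<m. \<Sum>t\<in>{0..<N + \<beta>}. E c N j j t t) + 1" by (simp add: diff_eq_eq add.commute)
  moreover have "(\<Sum>j<m. \<Sum>t\<in>{0..<N + \<beta>}. E c N j j t t) =
      poly q (c + of_int (N + \<beta>)) - H (c + of_int N) - poly q c"
    by (rule trace_E[OF ctx q])
  moreover have "(\<Sum>j<m. \<Sum>t\<in>{0..<N + 1 + \<beta>}. E c (N + 1) j j t t) =
      poly q (c + of_int (N + 1 + \<beta>)) - H (c + of_int (N + 1)) - poly q c"
    by (rule trace_E[OF ctx' q])
  moreover have "x = y + 1" if "x - z = y - z + 1" for x y z :: 'a
    using that by (simp add: diff_eq_eq)
  ultimately show ?thesis by metis
qed

theorem trace_difference_integral:
  assumes roots: "poly a s = 0" "poly a t = 0"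
  shows "tau s t (\<Sum>j<m. e j j) - (s - t) \<in> \<int>"
proof -
  obtain q where q: "bdiff q = cf (\<Sum>j<m. e j j) 0" using bdiff_surj by blast
  define G where "G z = poly q (z + of_int \<beta>) - H z" for z
  have Grat: "ratfun G"
    using ratfun_add[OF ratfun_poly[of q "of_int \<beta>"] ratfun_mult[OF ratfun_const[of "- 1"] ratfun_H]]
    by (simp add: G_def[abs_def])
  have ex: "\<exists>K. \<forall>N\<ge>K. 3 * \<beta> \<le> N \<and> (\<forall>u\<ge>N - 3 * \<beta>. poly sp (c + 1 + of_int u) \<noteq> 0 \<and> poly sp' (c + 1 + of_int u) \<noteq> 0)" for c
  proof -
    obtain K1 where K1: "\<And>u. u \<ge> K1 \<Longrightarrow> poly sp (c + 1 + of_int u) \<noteq> 0"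
      using eventually_poly_nonzero[OF sp] by blast
    obtain K2 where K2: "\<And>u. u \<ge> K2 \<Longrightarrow> poly sp' (c + 1 + of_int u) \<noteq> 0"
      using eventually_poly_nonzero[OF sp'] by blast
    show ?thesis
      by (intro exI[of _ "max (max K1 K2) 0 + 3 * \<beta>"]) (auto intro!: K1 K2)
  qed
  obtain K where K: "\<And>N u. N \<ge> K \<Longrightarrow> 3 * \<beta> \<le> N"
     "\<And>N u. N \<ge> K \<Longrightarrow> u \<ge> N - 3 * \<beta> \<Longrightarrow> poly sp (s + 1 + of_int u) \<noteq> 0"
     "\<And>N u. N \<ge> K \<Longrightarrow> u \<ge> N - 3 * \<beta> \<Longrightarrow> poly sp' (s + 1 + of_int u) \<noteq> 0"
    using ex[of s] by metis
  have "G (s + of_int (N + 1)) = G (s + of_int N) + 1" if "N \<ge> K" for N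
    using trace_increment[OF roots(1) K(1)[OF that] K(2)[OF that] K(3)[OF that] q]
    by (simp add: G_def algebra_simps)
  from ratfun_increment[OF Grat this] obtain \<kappa>
    where \<kappa>: "\<And>c. \<exists>K::int. \<forall>N\<ge>K. G (c + of_int N) = \<kappa> + c + of_int N" by blast
  have main: "poly q c - c - \<kappa> \<in> \<int>" if c: "poly a c = 0" for c
  proof -
    obtain K1 where K1: "\<And>N u. N \<ge> K1 \<Longrightarrow> 3 * \<beta> \<le> N"
     "\<And>N u. N \<ge> K1 \<Longrightarrow> u \<ge> N - 3 * \<beta> \<Longrightarrow> poly sp (c + 1 + of_int u) \<noteq> 0"
     "\<And>N u. N \<ge> K1 \<Longrightarrow> u \<ge> N - 3 * \<beta> \<Longrightarrow> poly sp' (c + 1 + of_int u) \<noteq> 0"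
      using ex[of c] by metis
    obtain K2 where K2: "\<And>N. N \<ge> K2 \<Longrightarrow> G (c + of_int N) = \<kappa> + c + of_int N" using \<kappa> by blast
    define N where "N = max K1 K2"
    have N: "N \<ge> K1" "N \<ge> K2" by (simp_all add: N_def)
    have "G (c + of_int N) - poly q c \<in> \<int>"
      using trace_integral[OF c K1(1)[OF N(1)] K1(2)[OF N(1)] K1(3)[OF N(1)] q]
      by (simp add: G_def algebra_simps)
    then have "\<kappa> + c + of_int N - poly q c \<in> \<int>" using K2[OF N(2)] by simp
    then have "of_int N - (\<kappa> + c + of_int N - poly q c) \<in> \<int>" by (rule Ints_diff[OF Ints_of_int])
    then show ?thesis by (simp add: algebra_simps)
  qed
  have "(poly q s - s - \<kappa>) - (poly q t - t - \<kappa>) \<in> \<int>"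
    by (rule Ints_diff[OF main[OF roots(1)] main[OF roots(2)]])
  then show ?thesis unfolding tau_eq[OF q] by (simp add: algebra_simps)
qed

end

lemma gwa_sub_dual_basis_trace_integral:
  fixes g :: "nat \<Rightarrow> 'a::field_char_0 skew" and w :: "nat \<Rightarrow> 'a skew \<Rightarrow> 'a skew"
  assumes a: "a \<noteq> 0" and roots: "poly a s = 0" "poly a t = 0"
    and L: "0 \<in> L" "\<And>x y. x \<in> L \<Longrightarrow> y \<in> L \<Longrightarrow> x + y \<in> L"
      "\<And>r x. r \<in> gwa_sub a \<Longrightarrow> x \<in> L \<Longrightarrow> r * x \<in> L" "L \<noteq> {0}"
    and g: "\<And>j. j < m \<Longrightarrow> g j \<in> L"
    and w: "\<And>j z. j < m \<Longrightarrow> z \<in> L \<Longrightarrow> w j z \<in> gwa_sub a"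
      "\<And>j y z. j < m \<Longrightarrow> y \<in> L \<Longrightarrow> z \<in> L \<Longrightarrow> w j (y + z) = w j y + w j z"
      "\<And>j r z. j < m \<Longrightarrow> r \<in> gwa_sub a \<Longrightarrow> z \<in> L \<Longrightarrow> w j (r * z) = r * w j z"
    and dual: "\<And>z. z \<in> L \<Longrightarrow> z = (\<Sum>j<m. w j z * g j)"
  shows "tau s t (\<Sum>j<m. w j (g j)) - (s - t) \<in> \<int>"
proof -
  have Lneg: "- x \<in> L" if "x \<in> L" for x
    using L(3)[OF gwa_sub_closed(5)[OF gwa_sub_closed(2)] that] by simp
  have Ldiff: "x - y \<in> L" if "x \<in> L" "y \<in> L" for x y
    using L(2)[OF that(1) Lneg[OF that(2)]] by simp
  obtain f where f: "f \<in> L" "f \<noteq> 0" and gen: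
    "\<And>g. g \<in> L \<Longrightarrow> \<exists>s z. s \<noteq> 0 \<and> z \<in> gwa_sub a \<and> smon s 0 * g = z * f"
    using gwa_sub_left_ideal_generic_generator[OF a L(1) Ldiff L(3,4)] by blast
  have "\<forall>j\<in>{..<m}. \<exists>p. fst p \<noteq> 0 \<and> snd p \<in> gwa_sub a \<and> smon (fst p) 0 * g j = snd p * f"
    using gen g by force
  from bchoice[OF this] obtain p where p: "\<And>j. j < m \<Longrightarrow> fst (p j) \<noteq> 0"
    "\<And>j. j < m \<Longrightarrow> snd (p j) \<in> gwa_sub a" "\<And>j. j < m \<Longrightarrow> smon (fst (p j)) 0 * g j = snd (p j) * f"
    by auto
  define sp where "sp = (\<Prod>j<m. fst (p j))"
  define B where "B j = smon (\<Prod>k\<in>{..<m} - {j}. fst (p k)) 0 * snd (p j)" for j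
  define D where "D j = w j f" for j
  define e where "e j l = w l (g j)" for j l
  have B: "B j \<in> gwa_sub a" if "j < m" for j
    using p that by (simp add: B_def gwa_sub_times smon0_gwa_sub)
  have D: "D j \<in> gwa_sub a" if "j < m" for j using w f that by (simp add: D_def)
  have sp_g: "smon sp 0 * g j = B j * f" if j: "j < m" for j
  proof -
    have "sp = (\<Prod>k\<in>{..<m} - {j}. fst (p k)) * fst (p j)"
      unfolding sp_def using j by (subst prod.remove[of _ j]) (auto simp: mult.commute)
    then have "smon sp 0 = smon (\<Prod>k\<in>{..<m} - {j}. fst (p k)) 0 * smon (fst (p j)) 0"
      by (simp add: smon_times_smon)
    then show ?thesis using p(3)[OF j] by (simp add: B_def mult.assoc)
  qed
  have w_sum: "w l (\<Sum>j\<in>J. r j * g j) = (\<Sum>j\<in>J. r j * w l (g j)) \<and> (\<Sum>j\<in>J. r j * g j) \<in> L"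
    if "l < m" "finite J" "J \<subseteq> {..<m}" "\<And>j. j \<in> J \<Longrightarrow> r j \<in> gwa_sub a" for l r J
    using that(2-)
  proof (induction J rule: finite_induct)
    case empty
    have "w l 0 = 0" using w(3)[OF that(1) gwa_sub_closed(1) L(1)] by simp
    then show ?case using L(1) by simp
  next
    case (insert j J)
    then show ?case using w that(1) L g by simp
  qed
  define T where "T = (\<Union>j<m. supp (B j)) \<union> (\<Union>j<m. supp (D j)) \<union> (\<Union>j<m. \<Union>l<m. supp (e j l))"
  have T: "finite T" by (simp add: T_def)
  define \<beta> where "\<beta> = Max (insert 0 (abs ` T))"
  have \<beta>0: "0 \<le> \<beta>" using T by (simp add: \<beta>_def)
  have "T \<subseteq> {- \<beta>..\<beta>}"
  proof
    fix d assume "d \<in> T"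
    then have "\<bar>d\<bar> \<le> \<beta>" using T by (simp add: \<beta>_def)
    then show "d \<in> {- \<beta>..\<beta>}" by auto
  qed
  then have band: "supp (B j) \<subseteq> {- \<beta>..\<beta>}" "supp (D j) \<subseteq> {- \<beta>..\<beta>}" "supp (e j l) \<subseteq> {- \<beta>..\<beta>}"
    if "j < m" "l < m" for j l
    using that unfolding T_def UN_subset_iff Un_subset_iff by blast+
  define sp' where "sp' = (\<Prod>k\<in>{- \<beta>..\<beta>}. pshift k sp)"
  define D' where "D' j = (\<Sum>k\<in>{- \<beta>..\<beta>}. smon (cf (D j) k * (\<Prod>i\<in>{- \<beta>..\<beta>} - {k}. pshift i sp)) k)" for j
  have D': "smon sp' 0 * D j = D' j * smon sp 0" if j: "j < m" for j
  proof -
    have "D' j * smon sp 0 = (\<Sum>k\<in>{- \<beta>..\<beta>}. smon (cf (D j) k * sp') k)"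
      unfolding D'_def sum_distrib_right
    proof (rule sum.cong[OF refl])
      fix k assume "k \<in> {- \<beta>..\<beta>}"
      then have "sp' = (\<Prod>i\<in>{- \<beta>..\<beta>} - {k}. pshift i sp) * pshift k sp"
        unfolding sp'_def by (subst prod.remove[of _ k]) (auto simp: mult.commute)
      then show "smon (cf (D j) k * (\<Prod>i\<in>{- \<beta>..\<beta>} - {k}. pshift i sp)) k * smon sp 0 = smon (cf (D j) k * sp') k"
        by (simp add: smon_times_smon mult.assoc)
    qed
    also have "\<dots> = smon sp' 0 * (\<Sum>k\<in>{- \<beta>..\<beta>}. smon (cf (D j) k) k)"
      by (simp add: sum_distrib_left smon_times_smon mult.commute)
    also have "(\<Sum>k\<in>{- \<beta>..\<beta>}. smon (cf (D j) k) k) = D j"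
      using band(2)[OF j j] by (intro skew_smon_decomp[symmetric]) auto
    finally show ?thesis by simp
  qed
  have f_sum: "f = (\<Sum>j<m. D j * g j)" using dual[OF f(1)] by (simp add: D_def)
  interpret rank_one_idempotent a m sp sp' B D D' e \<beta>
  proof
    show "sp \<noteq> 0" using p(1) by (simp add: sp_def)
    then show "sp' \<noteq> 0" by (simp add: sp'_def)
    show "0 \<le> \<beta>" by (rule \<beta>0)
    fix j l assume j: "j < m" and l: "l < m"
    show "e j l \<in> gwa_sub a" using w(1) g j l by (simp add: e_def)
    have "smon sp 0 * e j l = w l (smon sp 0 * g j)"
      using w(3)[OF l smon0_gwa_sub g[OF j]] by (simp add: e_def)
    also have "\<dots> = B j * D l" using w(3)[OF l B[OF j] f(1)] by (simp add: sp_g[OF j] D_def)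
    finally show "smon sp 0 * e j l = B j * D l" .
    have "e j l = w l (\<Sum>k<m. e j k * g k)" using dual[OF g[OF j]] by (simp add: e_def)
    then show "(\<Sum>k<m. e j k * e k l) = e j l"
      using w_sum[OF l, of "{..<m}" "e j"] w(1) g[OF j] by (simp add: e_def)
  next
    fix l assume l: "l < m"
    have "D l = w l (\<Sum>j<m. D j * g j)" using f_sum by (simp add: D_def)
    then show "(\<Sum>j<m. D j * e j l) = D l"
      using w_sum[OF l, of "{..<m}" D] D by (simp add: e_def)
  next
    fix j assume j: "j < m"
    then show "supp (B j) \<subseteq> {- \<beta>..\<beta>}" "supp (D j) \<subseteq> {- \<beta>..\<beta>}" using band by auto
    show "smon sp' 0 * D j = D' j * smon sp 0" by (rule D'[OF j])
  next
    fix j l assume "j < m" "l < m"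
    then show "supp (e j l) \<subseteq> {- \<beta>..\<beta>}" by (rule band)
  next
    have "(\<Sum>j<m. D' j * B j) * f = (\<Sum>j<m. D' j * smon sp 0 * g j)"
      by (simp add: sum_distrib_right mult.assoc sp_g)
    also have "\<dots> = smon sp' 0 * (\<Sum>j<m. D j * g j)"
      by (simp add: sum_distrib_left mult.assoc[symmetric] D')
    finally have "((\<Sum>j<m. D' j * B j) - smon sp' 0) * f = 0"
      using f_sum by (simp add: algebra_simps)
    then show "(\<Sum>j<m. D' j * B j) = smon sp' 0"
      using skew_no_zero_divisors f(2) by (metis right_minus_eq)
  qed
  show ?thesis using trace_difference_integral[OF roots] by (simp add: e_def)
qed

lemma lagrange_basis:
  fixes lam :: "nat \<Rightarrow> 'a::field_char_0"
  assumes "finite I" "inj_on lam I"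
  shows "\<exists>l. \<forall>i\<in>I. \<forall>j\<in>I. poly (l j) (lam i) = (if i = j then 1 else 0)"
proof (rule exI, intro ballI)
  fix i j assume ij: "i \<in> I" "j \<in> I"
  let ?p = "\<lambda>j. \<Prod>k\<in>I - {j}. [:- lam k, 1:]"
  have "poly (?p j) (lam j) \<noteq> 0"
    using assms ij by (auto simp: poly_prod inj_on_def)
  moreover have "i \<noteq> j \<Longrightarrow> poly (?p j) (lam i) = 0"
    using assms(1) ij unfolding poly_prod by (intro prod_zero) auto
  ultimately show "poly (Polynomial.smult (inverse (poly (?p j) (lam j))) (?p j)) (lam i) = (if i = j then 1 else 0)"
    by simp
qed

lemma tau_one: "tau s t 1 = s - (t :: 'a::field_char_0)"
proof -
  have "bdiff [:0, 1:] = (1 :: 'a poly)" by (rule poly_ext) (simp add: bdiff_def)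
  then show ?thesis using tau_eq[of "[:0, 1:]" 1 s t] by (simp add: cf_one)
qed

lemma tau_bdiff: "tau s t (smon (- bdiff l) 0) = poly l t - poly l s"
  using tau_eq[of "- l" "smon (- bdiff l) 0" s t] by (simp add: cf_smon bdiff_simps)

text \<open>
  The left ideal \<open>A x + A (h - \<mu>)\<close> for a simple root \<open>\<mu>\<close> of \<open>a\<close>, where \<open>l\<close> vanishes at the other
  roots and \<open>l(\<mu>) = 1\<close>. Its inverse is generated by \<open>l x\<^sup>-\<^sup>1\<close> and \<open>(1 - l) / (h - \<mu>)\<close>.
\<close>

lemma gwa_sub_root_ideal:
  fixes a :: "'a::field_char_0 poly"
  assumes l: "a dvd [:- \<mu>, 1:] * l" "poly l \<mu> = 1"
  obtains L g w where "0 \<in> L" "\<And>x y. x \<in> L \<Longrightarrow> y \<in> L \<Longrightarrow> x + y \<in> L"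
    "\<And>r x. r \<in> gwa_sub a \<Longrightarrow> x \<in> L \<Longrightarrow> r * x \<in> L" "L \<noteq> {0}" "L \<subseteq> gwa_sub a"
    "\<And>j :: nat. j < 2 \<Longrightarrow> g j \<in> L" "\<And>j z. j < 2 \<Longrightarrow> z \<in> L \<Longrightarrow> w j z \<in> gwa_sub a"
    "\<And>j y z. j < 2 \<Longrightarrow> w j (y + z) = w j y + w j z" "\<And>j r z. j < 2 \<Longrightarrow> w j (r * z) = r * w j z"
    "\<And>z. z = (\<Sum>j<2. w j z * g j)" "(\<Sum>j<2. w j (g j)) = 1 + smon (- bdiff l) 0"
proof -
  define x where "x = smon (1 :: 'a poly) 1"
  define h where "h = smon [:- \<mu>, 1:] 0"
  define L where "L = {u * x + v * h | u v. u \<in> gwa_sub a \<and> v \<in> gwa_sub a}"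
  have "[:- \<mu>, 1:] dvd 1 - l" using l(2) by (simp add: poly_eq_0_iff_dvd[symmetric])
  then obtain \<alpha> where \<alpha>: "1 - l = [:- \<mu>, 1:] * \<alpha>" by blast
  define g where "g j = (if j = 0 then x else h)" for j :: nat
  define w where "w j z = (if j = 0 then z * smon l (- 1) else z * smon \<alpha> 0)" for j :: nat and z
  note closed = gwa_sub_closed gwa_sub_times
  have xh: "x \<in> gwa_sub a" "h \<in> gwa_sub a"
    by (simp_all add: x_def h_def smon_gwa_sub yfac_nonneg)
  show ?thesis
  proof (rule that[of L g w])
    show "0 \<in> L" unfolding L_def using closed(1) by force
    have xL: "x \<in> L" unfolding L_def
      by (rule CollectI, rule exI[of _ 1], rule exI[of _ 0]) (simp add: closed)
    have hL: "h \<in> L" unfolding L_def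
      by (rule CollectI, rule exI[of _ 0], rule exI[of _ 1]) (simp add: closed)
    have "x \<noteq> 0" by (simp add: x_def smon_eq_0_iff)
    then show "L \<noteq> {0}" using xL by auto
    show "L \<subseteq> gwa_sub a" using xh by (auto simp: L_def intro!: closed)
    show "y + z \<in> L" if "y \<in> L" "z \<in> L" for y z
    proof -
      obtain u v u' v' where "y = u * x + v * h" "z = u' * x + v' * h" "u \<in> gwa_sub a" "v \<in> gwa_sub a"
        "u' \<in> gwa_sub a" "v' \<in> gwa_sub a" using \<open>y \<in> L\<close> \<open>z \<in> L\<close> unfolding L_def by blast
      note uv = this
      show ?thesis unfolding L_def
        by (rule CollectI, rule exI[of _ "u + u'"], rule exI[of _ "v + v'"]) (simp add: uv algebra_simps closed)
    qed
    show "r * z \<in> L" if "r \<in> gwa_sub a" "z \<in> L" for r z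
    proof -
      obtain u v where "z = u * x + v * h" "u \<in> gwa_sub a" "v \<in> gwa_sub a"
        using \<open>z \<in> L\<close> unfolding L_def by blast
      note uv = this
      show ?thesis unfolding L_def
        by (rule CollectI, rule exI[of _ "r * u"], rule exI[of _ "r * v"], insert that(1)) (simp add: uv algebra_simps closed)
    qed
    show "g j \<in> L" for j using xL hL by (simp add: g_def)
    show "w j z \<in> gwa_sub a" if "z \<in> L" for j z
    proof -
      obtain u v where z: "z = u * x + v * h" "u \<in> gwa_sub a" "v \<in> gwa_sub a"
        using \<open>z \<in> L\<close> unfolding L_def by blast
      have "z * smon l (- 1) = u * smon (pshift 1 l) 0 + v * smon ([:- \<mu>, 1:] * l) (- 1)"
        unfolding z by (simp add: x_def h_def distrib_right mult.assoc smon_times_smon del: mult_pCons_left)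
      moreover have "smon ([:- \<mu>, 1:] * l) (- 1) \<in> gwa_sub a"
        using l(1) by (intro smon_gwa_sub) (simp only: yfac_minus_one)
      ultimately have "z * smon l (- 1) \<in> gwa_sub a"
        using z by (simp add: smon0_gwa_sub closed)
      moreover have "z * smon \<alpha> 0 \<in> gwa_sub a"
        using z xh by (simp add: smon0_gwa_sub closed)
      ultimately show ?thesis by (simp add: w_def)
    qed
    show "w j (y + z) = w j y + w j z" "w j (r * z) = r * w j z" for j y z r
      by (simp_all add: w_def distrib_right mult.assoc)
    have two: "(\<Sum>j<2. F j) = F 0 + F 1" for F :: "nat \<Rightarrow> 'a skew"
      by (simp add: numeral_2_eq_2)
    have id: "l + [:- \<mu>, 1:] * \<alpha> = 1" using \<alpha> by (metis add.commute diff_add_cancel)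
    have "smon l (- 1) * x + smon \<alpha> 0 * h = smon (l + [:- \<mu>, 1:] * \<alpha>) 0"
      by (simp add: x_def h_def smon_times_smon smon_add mult.commute del: mult_pCons_left mult_pCons_right)
    then have "smon l (- 1) * x + smon \<alpha> 0 * h = 1" unfolding id by (simp add: one_skew_def)
    then have "z * (smon l (- 1) * x + smon \<alpha> 0 * h) = z" for z by simp
    then show "z = (\<Sum>j<2. w j z * g j)" for z
      unfolding two by (simp add: w_def g_def mult.assoc distrib_left)
    have "(\<Sum>j<2. w j (g j)) = smon (pshift 1 l + [:- \<mu>, 1:] * \<alpha>) 0"
      unfolding two by (simp add: w_def g_def x_def h_def smon_times_smon smon_add del: mult_pCons_left)
    also have "pshift 1 l + [:- \<mu>, 1:] * \<alpha> = 1 + - bdiff l"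
      unfolding \<alpha>[symmetric] by (simp add: bdiff_def)
    finally show "(\<Sum>j<2. w j (g j)) = 1 + smon (- bdiff l) 0"
      by (simp only: smon_add one_skew_def)
  qed
qed

section \<open>The generalized Weyl algebra as a subring of skew Laurent polynomials\<close>

fun letter_val :: "'k::field_char_0 poly \<Rightarrow> gwa_gen \<Rightarrow> 'k skew" where
  "letter_val a Gen_h = smon [:0, 1:] 0"
| "letter_val a Gen_x = smon 1 1"
| "letter_val a Gen_y = smon a (- 1)"

fun word_val :: "'k::field_char_0 poly \<Rightarrow> gwa_word \<Rightarrow> 'k skew" where
  "word_val a (Word ws) = prod_list (map (letter_val a) ws)"

definition free_val :: "'k::field_char_0 poly \<Rightarrow> 'k gwa_free \<Rightarrow> 'k skew" where
  "free_val a F = (\<Sum>w\<in>Poly_Mapping.keys F. smon [:Poly_Mapping.lookup F w:] 0 * word_val a w)"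

lemma smon_scalar_commute: "smon [:c:] 0 * z = z * smon [:c:] 0"
  by (rule skew_eqI) (simp add: cf_smon_times cf_times_smon)

lemma word_val_add: "word_val a (v + w) = word_val a v * word_val a w"
  by (cases v; cases w) simp

lemma free_val_superset:
  assumes "finite W" "Poly_Mapping.keys F \<subseteq> W"
  shows "free_val a F = (\<Sum>w\<in>W. smon [:Poly_Mapping.lookup F w:] 0 * word_val a w)"
  unfolding free_val_def
  by (rule sum.mono_neutral_left) (use assms in \<open>auto simp: in_keys_iff smon_zero\<close>)

lemma free_val_add: "free_val a (F + G) = free_val a F + free_val a G"
proof -
  let ?W = "Poly_Mapping.keys F \<union> Poly_Mapping.keys G"
  have "free_val a H = (\<Sum>w\<in>?W. smon [:Poly_Mapping.lookup H w:] 0 * word_val a w)"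
    if "Poly_Mapping.keys H \<subseteq> ?W" for H
    using that by (intro free_val_superset) auto
  from this[of F] this[of G] this[of "F + G"] show ?thesis
    using Poly_Mapping.keys_add[of F G]
    by (simp add: lookup_add smon_add[symmetric] sum.distrib[symmetric] distrib_right[symmetric])
qed

lemma free_val_zero: "free_val a 0 = 0"
  by (simp add: free_val_def)

lemma free_val_sum: "free_val a (sum f A) = (\<Sum>x\<in>A. free_val a (f x))"
  by (induction A rule: infinite_finite_induct) (simp_all add: free_val_zero free_val_add)

lemma free_val_uminus: "free_val a (- F) = - free_val a F"
  using free_val_add[of a F "- F"] by (simp add: free_val_zero add_eq_0_iff)

lemma free_val_diff: "free_val a (F - G) = free_val a F - free_val a G"
  using free_val_add[of a F "- G"] by (simp add: free_val_uminus)

lemma free_val_single: "free_val a (Poly_Mapping.single w c) = smon [:c:] 0 * word_val a w"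
  by (subst free_val_superset[of "{w}"]) auto

lemma free_decomp: "F = (\<Sum>w\<in>Poly_Mapping.keys F. Poly_Mapping.single w (Poly_Mapping.lookup F w))"
  by (rule poly_mapping_eqI) (auto simp: lookup_sum lookup_single when_def in_keys_iff)

lemma free_val_mult: "free_val a (F * G) = free_val a F * free_val a G"
proof -
  have single: "free_val a (Poly_Mapping.single v c * Poly_Mapping.single w d) =
    free_val a (Poly_Mapping.single v c) * free_val a (Poly_Mapping.single w d)" for v w c d
  proof -
    have "smon [:c * d:] 0 * (word_val a v * word_val a w) =
      smon [:c:] 0 * (smon [:d:] 0 * word_val a v) * word_val a w"
      by (simp add: mult.assoc[symmetric] smon_times_smon mult.commute[of d c])
    also have "smon [:d:] 0 * word_val a v = word_val a v * smon [:d:] 0"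
      by (rule smon_scalar_commute)
    finally show ?thesis
      by (simp add: mult_single free_val_single word_val_add mult.assoc)
  qed
  have "free_val a (F * G) = free_val a
     ((\<Sum>w\<in>Poly_Mapping.keys F. Poly_Mapping.single w (Poly_Mapping.lookup F w)) *
      (\<Sum>w\<in>Poly_Mapping.keys G. Poly_Mapping.single w (Poly_Mapping.lookup G w)))"
    by (simp add: free_decomp[symmetric])
  also have "\<dots> =
     free_val a (\<Sum>w\<in>Poly_Mapping.keys F. Poly_Mapping.single w (Poly_Mapping.lookup F w)) *
     free_val a (\<Sum>w\<in>Poly_Mapping.keys G. Poly_Mapping.single w (Poly_Mapping.lookup G w))"
    by (simp add: sum_product free_val_sum single)
  also have "\<dots> = free_val a F * free_val a G" by (simp add: free_decomp[symmetric])
  finally show ?thesis .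
qed

lemma word_val_zero: "word_val a 0 = 1"
  by (simp add: zero_gwa_word_def)

lemma free_val_scalar: "free_val a (gwa_scalar c) = smon [:c:] 0"
  by (simp add: gwa_scalar_def free_val_single word_val_zero)

lemma free_val_one: "free_val a 1 = 1"
  using free_val_scalar[of a 1] by (simp add: gwa_scalar_def one_skew_def one_pCons)

lemma free_val_gen: "free_val a (gwa_gen g) = letter_val a g"
  by (simp add: gwa_gen_def free_val_single one_pCons[symmetric] one_skew_def[symmetric])

lemma free_val_power: "free_val a (F ^ n) = free_val a F ^ n"
  by (induction n) (simp_all add: free_val_one free_val_mult)

lemma smon0_power: "smon p 0 ^ n = smon (p ^ n) 0"
  by (induction n) (simp_all add: one_skew_def smon_times_smon)

lemma free_val_poly: "free_val a (gwa_poly p) = smon p 0"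
proof -
  have "free_val a (gwa_poly p) = smon (\<Sum>i\<le>degree p. [:coeff p i:] * [:0, 1:] ^ i) 0"
    by (simp add: gwa_poly_def free_val_sum free_val_mult free_val_power free_val_scalar free_val_gen
        smon0_power smon_times_smon smon_sum del: mult_pCons_left)
  also have "(\<Sum>i\<le>degree p. [:coeff p i:] * [:0, 1:] ^ i) = p"
    by (rule poly_ext) (simp add: poly_sum poly_altdef[of p])
  finally show ?thesis .
qed

lemma free_val_relations: "F \<in> gwa_relations a \<Longrightarrow> free_val a F = 0"
  by (auto simp: gwa_relations_def Let_def free_val_diff free_val_add free_val_mult free_val_gen
      free_val_poly free_val_one one_skew_def smon_times_smon smon_diff[symmetric] smon_add[symmetric]
      pshift_def[of 1, symmetric, simplified] smon_eq_0_iff intro!: poly_ext)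

context
  fixes a :: "'k::field_char_0 poly"
begin

interpretation F: ring "type_ring :: 'k gwa_free ring" by (rule ring_type_ring)

lemma type_ring_simps: "carrier (type_ring :: 'b::ring_1 ring) = UNIV"
  "monoid.mult (type_ring :: 'b ring) = (*)" "ring.add (type_ring :: 'b ring) = (+)"
  "monoid.one (type_ring :: 'b ring) = 1" "ring.zero (type_ring :: 'b ring) = 0"
  by (simp_all add: type_ring_def)

lemma ideal_gwa_ideal: "ideal (gwa_ideal a) type_ring"
  unfolding gwa_ideal_def by (rule F.genideal_ideal) (simp add: type_ring_simps)

interpretation I: ideal "gwa_ideal a" "type_ring :: 'k gwa_free ring" by (rule ideal_gwa_ideal)

lemma gwa_ideal_closed:
  "0 \<in> gwa_ideal a" "F \<in> gwa_ideal a \<Longrightarrow> G \<in> gwa_ideal a \<Longrightarrow> F + G \<in> gwa_ideal a"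
  "F \<in> gwa_ideal a \<Longrightarrow> H * F \<in> gwa_ideal a" "F \<in> gwa_ideal a \<Longrightarrow> F * H \<in> gwa_ideal a"
  using I.additive_subgroup_axioms additive_subgroup.zero_closed[OF I.additive_subgroup_axioms]
    additive_subgroup.a_closed[OF I.additive_subgroup_axioms, of F G]
    I.I_l_closed[of F H] I.I_r_closed[of F H]
  by (simp_all add: type_ring_simps)

lemma gwa_relations_ideal: "F \<in> gwa_relations a \<Longrightarrow> F \<in> gwa_ideal a"
  unfolding gwa_ideal_def using F.genideal_self[of "gwa_relations a"] by (auto simp: type_ring_simps)

lemma gwa_ideal_val: "F \<in> gwa_ideal a \<Longrightarrow> free_val a F = 0"
proof -
  assume F: "F \<in> gwa_ideal a"
  have "ring_hom_ring type_ring type_ring (free_val a)"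
    by (rule ring_hom_ringI2[OF ring_type_ring ring_type_ring], rule ring_hom_memI)
      (simp_all add: type_ring_simps free_val_add free_val_mult free_val_one)
  then have "ideal (a_kernel type_ring type_ring (free_val a)) type_ring"
    by (rule ring_hom_ring.kernel_is_ideal)
  then have "gwa_ideal a \<subseteq> a_kernel type_ring type_ring (free_val a)"
    unfolding gwa_ideal_def
    by (rule F.genideal_minimal) (auto simp: a_kernel_def' type_ring_simps free_val_relations)
  with F show ?thesis by (auto simp: a_kernel_def' type_ring_simps)
qed

definition gwa_cong :: "'k gwa_free \<Rightarrow> 'k gwa_free \<Rightarrow> bool" where
  "gwa_cong F G \<longleftrightarrow> F - G \<in> gwa_ideal a"

lemma gwa_cong_refl: "gwa_cong F F"
  by (simp add: gwa_cong_def gwa_ideal_closed)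

lemma gwa_cong_trans: "gwa_cong F G \<Longrightarrow> gwa_cong G H \<Longrightarrow> gwa_cong F H"
  using gwa_ideal_closed(2)[of "F - G" "G - H"] by (simp add: gwa_cong_def)

lemma gwa_cong_add: "gwa_cong F G \<Longrightarrow> gwa_cong F' G' \<Longrightarrow> gwa_cong (F + F') (G + G')"
  using gwa_ideal_closed(2)[of "F - G" "F' - G'"] by (simp add: gwa_cong_def algebra_simps)

lemma gwa_cong_mult_left: "gwa_cong F G \<Longrightarrow> gwa_cong (H * F) (H * G)"
  using gwa_ideal_closed(3)[of "F - G" H] by (simp add: gwa_cong_def algebra_simps)

lemma gwa_cong_mult_right: "gwa_cong F G \<Longrightarrow> gwa_cong (F * H) (G * H)"
  using gwa_ideal_closed(4)[of "F - G" H] by (simp add: gwa_cong_def algebra_simps)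

abbreviation "hh \<equiv> gwa_gen Gen_h :: 'k gwa_free"
abbreviation "xx \<equiv> gwa_gen Gen_x :: 'k gwa_free"
abbreviation "yy \<equiv> gwa_gen Gen_y :: 'k gwa_free"

lemma gwa_cong_relations:
  "gwa_cong (xx * hh) ((hh - 1) * xx)" "gwa_cong (yy * hh) ((hh + 1) * yy)"
  "gwa_cong (yy * xx) (gwa_poly a)" "gwa_cong (xx * yy) (gwa_poly (pshift 1 a))"
  unfolding gwa_cong_def
  by (rule gwa_relations_ideal; simp add: gwa_relations_def Let_def pshift_def)+

lemma gwa_scalar_simps: "gwa_scalar (c + d) = gwa_scalar c + gwa_scalar d"
    "gwa_scalar (c * d) = gwa_scalar c * gwa_scalar d" "gwa_scalar 1 = 1" "gwa_scalar 0 = 0" for c d :: 'k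
  by (simp_all add: gwa_scalar_def single_add mult_single)

lemma gwa_scalar_commute: "gwa_scalar c * F = F * gwa_scalar c" for c :: 'k
proof -
  have "gwa_scalar c * (\<Sum>w\<in>Poly_Mapping.keys F. Poly_Mapping.single w (Poly_Mapping.lookup F w)) =
    (\<Sum>w\<in>Poly_Mapping.keys F. Poly_Mapping.single w (Poly_Mapping.lookup F w)) * gwa_scalar c"
    by (simp add: sum_distrib_left sum_distrib_right gwa_scalar_def mult_single mult.commute)
  then show ?thesis by (simp add: free_decomp[symmetric])
qed

lemma gwa_poly_superset: "degree p \<le> n \<Longrightarrow> gwa_poly p = (\<Sum>i\<le>n. gwa_scalar (coeff p i) * hh ^ i)"
  unfolding gwa_poly_def
  by (rule sum.mono_neutral_left) (auto simp: gwa_scalar_simps coeff_eq_0)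

lemma gwa_poly_add: "gwa_poly (p + q) = gwa_poly p + gwa_poly q" for p q :: "'k poly"
proof -
  let ?n = "max (degree p) (degree q)"
  have "degree (p + q) \<le> ?n" by (rule degree_add_le_max)
  then show ?thesis
    by (simp add: gwa_poly_superset[of _ ?n] gwa_scalar_simps distrib_right sum.distrib)
qed

lemma gwa_poly_pCons: "gwa_poly (pCons c p) = gwa_scalar c + hh * gwa_poly p"
proof -
  have "gwa_poly (pCons c p) = (\<Sum>i\<le>Suc (degree p). gwa_scalar (coeff (pCons c p) i) * hh ^ i)"
    by (rule gwa_poly_superset) (rule degree_pCons_le)
  also have "\<dots> = gwa_scalar c + (\<Sum>i\<le>degree p. gwa_scalar (coeff p i) * hh * hh ^ i)"
    by (subst sum.atMost_Suc_shift) (simp add: mult.assoc)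
  also have "(\<Sum>i\<le>degree p. gwa_scalar (coeff p i) * hh * hh ^ i) = hh * gwa_poly p"
    by (simp add: gwa_poly_def sum_distrib_left gwa_scalar_commute[of _ hh] mult.assoc)
  finally show ?thesis .
qed

lemma gwa_poly_0: "gwa_poly 0 = (0 :: 'k gwa_free)"
  by (simp add: gwa_poly_def gwa_scalar_simps)

lemma gwa_poly_const: "gwa_poly [:c:] = gwa_scalar c" for c :: 'k
  by (simp add: gwa_poly_pCons gwa_poly_0)

lemma gwa_poly_smult: "gwa_poly (Polynomial.smult c p) = gwa_scalar c * gwa_poly p" for c :: 'k
  by (induction p) (simp_all add: gwa_poly_0 gwa_poly_pCons gwa_scalar_simps distrib_left
      mult.assoc[symmetric] gwa_scalar_commute[of c hh])

lemma gwa_poly_mult: "gwa_poly (p * q) = gwa_poly p * gwa_poly q" for p q :: "'k poly"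
proof (induction p)
  case (pCons c p)
  have "gwa_poly (pCons c p * q) = gwa_scalar c * gwa_poly q + hh * (gwa_poly p * gwa_poly q)"
    by (simp add: gwa_poly_add gwa_poly_smult gwa_poly_pCons pCons gwa_scalar_simps)
  then show ?case by (simp add: gwa_poly_pCons distrib_right mult.assoc)
qed (simp add: gwa_poly_0)

lemma gwa_cong_move:
  assumes "gwa_cong (z * hh) ((hh - gwa_scalar (of_int d)) * z)"
  shows "gwa_cong (z * gwa_poly p) (gwa_poly (pshift d p) * z)"
proof (induction p)
  case 0
  then show ?case by (simp add: gwa_poly_0 gwa_cong_refl)
next
  case (pCons c p)
  have ps: "pshift d (pCons c p) = [:c:] + [:- of_int d, 1:] * pshift d p"
    by (rule poly_ext) (simp add: algebra_simps)
  have lin: "gwa_poly [:- of_int d, 1:] = hh - gwa_scalar (of_int d :: 'k)"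
    by (simp add: gwa_poly_pCons gwa_poly_0 gwa_scalar_simps algebra_simps)
      (metis gwa_scalar_simps(1,4) add.commute add.left_inverse add_diff_cancel diff_add_cancel minus_add_cancel)
  have 1: "gwa_cong (z * hh * gwa_poly p) ((hh - gwa_scalar (of_int d)) * z * gwa_poly p)"
    using assms by (rule gwa_cong_mult_right)
  have 2: "gwa_cong ((hh - gwa_scalar (of_int d)) * (z * gwa_poly p))
      ((hh - gwa_scalar (of_int d)) * (gwa_poly (pshift d p) * z))"
    using pCons.IH by (rule gwa_cong_mult_left)
  have "gwa_cong (gwa_scalar c * z + z * hh * gwa_poly p)
      (gwa_scalar c * z + (hh - gwa_scalar (of_int d)) * (gwa_poly (pshift d p) * z))"
    using gwa_cong_trans[OF 1[unfolded mult.assoc[of _ z]] 2] by (intro gwa_cong_add gwa_cong_refl)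
  then show ?case
    unfolding ps gwa_poly_add gwa_poly_mult lin gwa_poly_const
    by (simp add: gwa_poly_pCons distrib_left distrib_right mult.assoc gwa_scalar_commute[of c z])
qed

definition XX :: "int \<Rightarrow> 'k gwa_free" where
  "XX d = (if d \<ge> 0 then xx ^ nat d else yy ^ nat (- d))"

lemma smon_one_power: "smon 1 1 ^ n = smon (1 :: 'k poly) (int n)"
  by (induction n) (simp_all add: one_skew_def smon_times_smon)

lemma smon_y_power: "smon a (- 1) ^ n = smon (yfac a (- int n)) (- int n)"
proof (induction n)
  case (Suc n)
  have "{0..<int n + 1} = insert 0 {1..<1 + int n}" by auto
  then have "yfac a (- int (Suc n)) = a * pshift (- 1) (yfac a (- int n))"
    unfolding pshift_yfac by (simp add: yfac_def)
  then show ?case using Suc by (simp add: smon_times_smon)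
qed (simp add: one_skew_def yfac_def)

lemma free_val_XX: "free_val a (XX d) = smon (yfac a d) d"
  by (simp add: XX_def free_val_power free_val_gen smon_one_power smon_y_power yfac_nonneg)

definition nf :: "'k skew \<Rightarrow> 'k gwa_free" where
  "nf z = (\<Sum>d\<in>supp z. gwa_poly (cf z d) * XX d)"

lemma nf_superset: "finite E \<Longrightarrow> supp z \<subseteq> E \<Longrightarrow> nf z = (\<Sum>d\<in>E. gwa_poly (cf z d) * XX d)"
  unfolding nf_def by (rule sum.mono_neutral_left) (auto simp: not_supp gwa_poly_0)

lemma nf_add: "nf (z + w) = nf z + nf w"
proof -
  have "supp (z + w) \<subseteq> supp z \<union> supp w" by (auto simp: supp_def cf_add)
  then show ?thesis
    by (simp add: nf_superset[of "supp z \<union> supp w"] cf_add gwa_poly_add distrib_right sum.distrib)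
qed

lemma nf_zero: "nf 0 = 0"
  by (simp add: nf_def cf_zero gwa_poly_0)

lemma nf_smon: "nf (smon p d) = gwa_poly p * XX d"
  using nf_superset[of "{d}" "smon p d"] supp_smon[of p d] by (simp add: cf_smon)

definition reducible :: "'k gwa_free \<Rightarrow> bool" where
  "reducible F \<longleftrightarrow> (\<exists>z. gwa_cong F (nf z))"

lemma reducible_cong: "gwa_cong F G \<Longrightarrow> reducible G \<Longrightarrow> reducible F"
  unfolding reducible_def using gwa_cong_trans by blast

lemma reducible_add: "reducible F \<Longrightarrow> reducible G \<Longrightarrow> reducible (F + G)"
  unfolding reducible_def using gwa_cong_add nf_add by metis

lemma reducible_zero: "reducible 0"
  unfolding reducible_def using nf_zero gwa_cong_refl by metis

lemma reducible_sum: "(\<And>x. x \<in> A \<Longrightarrow> reducible (f x)) \<Longrightarrow> reducible (sum f A)"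
  by (induction A rule: infinite_finite_induct) (auto simp: reducible_zero reducible_add)

lemma reducible_smon: "reducible (gwa_poly p * XX d)"
  unfolding reducible_def using nf_smon gwa_cong_refl by metis

lemma reducible_poly_mult: "reducible F \<Longrightarrow> reducible (gwa_poly p * F)"
proof -
  assume "reducible F"
  then obtain z where "gwa_cong F (nf z)" by (auto simp: reducible_def)
  then have 1: "gwa_cong (gwa_poly p * F) (gwa_poly p * nf z)" by (rule gwa_cong_mult_left)
  have "reducible (gwa_poly p * nf z)"
    unfolding nf_def sum_distrib_left
    by (rule reducible_sum) (simp add: mult.assoc[symmetric] gwa_poly_mult[symmetric] reducible_smon)
  with 1 show ?thesis by (rule reducible_cong)
qed

lemma reducible_gen_mult:
  assumes "reducible F" shows "reducible (gwa_gen g * F)"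
proof -
  obtain z where z: "gwa_cong F (nf z)" using assms by (auto simp: reducible_def)
  have XXsimp: "reducible (XX d)" for d
    using reducible_smon[of 1 d] by (simp add: gwa_poly_pCons gwa_poly_0 gwa_scalar_simps one_pCons)
  have step: "reducible (gwa_gen g * (gwa_poly p * XX d))" for p d
  proof -
    have mv: ?thesis if "gwa_cong (gwa_gen g * gwa_poly p) (gwa_poly q * gwa_gen g)"
      "reducible (gwa_gen g * XX d)" for q
    proof -
      have "gwa_cong (gwa_gen g * gwa_poly p * XX d) (gwa_poly q * gwa_gen g * XX d)"
        using that(1) by (rule gwa_cong_mult_right)
      moreover have "reducible (gwa_poly q * gwa_gen g * XX d)"
        unfolding mult.assoc using that(2) by (rule reducible_poly_mult)
      ultimately show ?thesis using reducible_cong by (simp add: mult.assoc)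
    qed
    show ?thesis
    proof (cases g)
      case Gen_h
      have "gwa_gen g = (gwa_poly [:0, 1:] :: 'k gwa_free)"
        by (simp add: Gen_h gwa_poly_pCons gwa_poly_0 gwa_scalar_simps)
      then show ?thesis by (simp add: reducible_poly_mult reducible_smon)
    next
      case Gen_x
      have "reducible (xx * XX d)"
      proof (cases "0 \<le> d")
        case True
        then have "xx * XX d = XX (d + 1)" by (simp add: XX_def nat_add_distrib)
        then show ?thesis by (simp add: XXsimp)
      next
        case False
        then have "nat (- d) = Suc (nat (- (d + 1)))" by simp
        then have "XX d = yy * XX (d + 1)" using False by (auto simp: XX_def)
        then have "gwa_cong (xx * XX d) (gwa_poly (pshift 1 a) * XX (d + 1))"
          using gwa_cong_mult_right[OF gwa_cong_relations(4)] by (simp add: mult.assoc[symmetric])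
        then show ?thesis using reducible_cong reducible_smon by blast
      qed
      moreover have "gwa_cong (xx * hh) ((hh - gwa_scalar (of_int 1)) * xx)"
        using gwa_cong_relations(1) by (simp add: gwa_scalar_simps)
      ultimately show ?thesis using mv[OF gwa_cong_move[of _ 1]] Gen_x by simp
    next
      case Gen_y
      have "reducible (yy * XX d)"
      proof (cases "d \<le> 0")
        case True
        then have "nat (- (d - 1)) = Suc (nat (- d))" by simp
        then have "yy * XX d = XX (d - 1)" using True by (cases "d = 0") (auto simp: XX_def)
        then show ?thesis by (simp add: XXsimp)
      next
        case False
        then have "nat d = Suc (nat (d - 1))" by simp
        then have "XX d = xx * XX (d - 1)" using False by (auto simp: XX_def)
        then have "gwa_cong (yy * XX d) (gwa_poly a * XX (d - 1))"
          using gwa_cong_mult_right[OF gwa_cong_relations(3)] by (simp add: mult.assoc[symmetric])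
        then show ?thesis using reducible_cong reducible_smon by blast
      qed
      moreover have "gwa_scalar (- 1 :: 'k) = - 1"
        using gwa_scalar_simps(1)[of 1 "- 1"] by (simp add: gwa_scalar_simps add_eq_0_iff)
      then have "gwa_cong (yy * hh) ((hh - gwa_scalar (of_int (- 1))) * yy)"
        using gwa_cong_relations(2) by simp
      ultimately show ?thesis using mv[OF gwa_cong_move[of _ "- 1"]] Gen_y by simp
    qed
  qed
  have "gwa_cong (gwa_gen g * F) (gwa_gen g * nf z)" using z by (rule gwa_cong_mult_left)
  moreover have "reducible (gwa_gen g * nf z)"
    unfolding nf_def sum_distrib_left by (intro reducible_sum step)
  ultimately show ?thesis by (rule reducible_cong)
qed

lemma all_reducible: "reducible F"
proof -
  have word: "reducible (Poly_Mapping.single (Word ws) 1)" for ws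
  proof (induction ws)
    case Nil
    have "Poly_Mapping.single (Word []) 1 = gwa_poly 1 * XX 0"
      by (simp add: XX_def one_pCons gwa_poly_pCons gwa_poly_0 gwa_scalar_def zero_gwa_word_def)
    then show ?case by (simp add: reducible_smon)
  next
    case (Cons g ws)
    have "Poly_Mapping.single (Word (g # ws)) 1 = gwa_gen g * Poly_Mapping.single (Word ws) (1 :: 'k)"
      by (simp add: gwa_gen_def mult_single)
    then show ?case using reducible_gen_mult[OF Cons] by simp
  qed
  have "reducible (Poly_Mapping.single w c)" for w c
  proof -
    obtain ws where w: "w = Word ws" by (cases w)
    have "Poly_Mapping.single w c = gwa_poly [:c:] * Poly_Mapping.single w 1"
      by (simp add: gwa_poly_const gwa_scalar_def mult_single)
    then show ?thesis using reducible_poly_mult[OF word] by (simp add: w)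
  qed
  then have "reducible (\<Sum>w\<in>Poly_Mapping.keys F. Poly_Mapping.single w (Poly_Mapping.lookup F w))"
    by (intro reducible_sum)
  then show ?thesis by (simp add: free_decomp[symmetric])
qed

lemma free_val_nf: "free_val a (nf z) = (\<Sum>d\<in>supp z. smon (cf z d * yfac a d) d)"
  by (simp add: nf_def free_val_sum free_val_mult free_val_poly free_val_XX smon_times_smon)

lemma free_val_kernel:
  assumes "a \<noteq> 0" "free_val a F = 0"
  shows "F \<in> gwa_ideal a"
proof -
  obtain z where z: "gwa_cong F (nf z)" using all_reducible[of F] by (auto simp: reducible_def)
  then have "free_val a (F - nf z) = 0" unfolding gwa_cong_def by (rule gwa_ideal_val)
  then have "free_val a (nf z) = 0" using assms(2) by (simp add: free_val_diff)
  then have eq: "cf (\<Sum>d\<in>supp z. smon (cf z d * yfac a d) d) e = 0" for e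
    by (simp add: free_val_nf cf_zero)
  have "cf z e * yfac a e = 0" for e
    using eq[of e] by (cases "e \<in> supp z") (auto simp: cf_sum cf_smon not_supp)
  then have "z = 0" using assms(1) by (intro skew_eqI) (simp add: cf_zero yfac_nonzero)
  then show ?thesis using z by (simp add: gwa_cong_def nf_zero)
qed

lemma free_val_gwa_sub: "free_val a F \<in> gwa_sub a"
proof -
  obtain z where z: "gwa_cong F (nf z)" using all_reducible[of F] by (auto simp: reducible_def)
  then have "free_val a (F - nf z) = 0" unfolding gwa_cong_def by (rule gwa_ideal_val)
  then have "free_val a F = (\<Sum>d\<in>supp z. smon (cf z d * yfac a d) d)"
    by (simp add: free_val_diff free_val_nf)
  moreover have "(\<Sum>d\<in>E. smon (cf z d * yfac a d) d) \<in> gwa_sub a" if "finite E" for E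
    using that by (induction E rule: finite_induct) (auto simp: gwa_sub_closed smon_gwa_sub)
  ultimately show ?thesis by simp
qed

lemma free_val_surj:
  assumes "z \<in> gwa_sub a" obtains F where "free_val a F = z"
proof -
  have "\<forall>d. \<exists>p. cf z d = p * yfac a d"
    using gwa_subD[OF assms] by (metis dvd_def mult.commute)
  then obtain p where p: "\<And>d. cf z d = p d * yfac a d" by metis
  have "free_val a (\<Sum>d\<in>supp z. gwa_poly (p d) * XX d) = (\<Sum>d\<in>supp z. smon (cf z d) d)"
    by (simp add: free_val_sum free_val_mult free_val_poly free_val_XX smon_times_smon p)
  also have "\<dots> = z" by (rule skew_smon_decomp[symmetric]) auto
  finally show ?thesis by (rule that)
qed

definition gwa_val :: "'k gwa_free set \<Rightarrow> 'k skew" where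
  "gwa_val X = free_val a (SOME F. F \<in> X)"

abbreviation "cls \<equiv> (+>\<^bsub>(type_ring :: 'k gwa_free ring)\<^esub>) (gwa_ideal a)"

lemma gwa_val_cls: "gwa_val (cls F) = free_val a F"
proof -
  have *: "cls F = {i + F |i. i \<in> gwa_ideal a}"
    by (auto simp: a_r_coset_def' type_ring_simps)
  have "F \<in> cls F" unfolding * using gwa_ideal_closed(1) by force
  then have "(SOME G. G \<in> cls F) \<in> cls F" by (rule someI)
  then show ?thesis
    unfolding gwa_val_def * by (auto simp: free_val_add gwa_ideal_val)
qed

lemma gwa_simps: "carrier (gwa a) = range cls" "cls F \<otimes>\<^bsub>gwa a\<^esub> cls G = cls (F * G)"
  "cls F \<oplus>\<^bsub>gwa a\<^esub> cls G = cls (F + G)" "\<one>\<^bsub>gwa a\<^esub> = cls 1"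
  "c \<odot>\<^bsub>gwa a\<^esub> cls F = cls (gwa_scalar c * F)"
proof -
  let ?R = "type_ring :: 'k gwa_free ring"
  have hom: "cls \<in> Ring.ring_hom ?R (?R Quot gwa_ideal a)" by (rule I.rcos_ring_hom)
  have G: "carrier (gwa a) = carrier (?R Quot gwa_ideal a)" "monoid.mult (gwa a) = monoid.mult (?R Quot gwa_ideal a)"
    "ring.add (gwa a) = ring.add (?R Quot gwa_ideal a)" "monoid.one (gwa a) = monoid.one (?R Quot gwa_ideal a)"
    "module.smult (gwa a) = (\<lambda>c u. cls (gwa_scalar c) \<otimes>\<^bsub>?R Quot gwa_ideal a\<^esub> u)"
    by (simp_all add: gwa_def Let_def ring.defs module.defs)
  show "carrier (gwa a) = range cls" unfolding G
    by (auto simp: FactRing_def A_RCOSETS_def' type_ring_simps)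
  show "cls F \<otimes>\<^bsub>gwa a\<^esub> cls G = cls (F * G)" "cls F \<oplus>\<^bsub>gwa a\<^esub> cls G = cls (F + G)"
    "\<one>\<^bsub>gwa a\<^esub> = cls 1" "c \<odot>\<^bsub>gwa a\<^esub> cls F = cls (gwa_scalar c * F)"
    unfolding G using ring_hom_mult[OF hom] ring_hom_add[OF hom] ring_hom_one[OF hom]
    by (simp_all add: type_ring_simps)
qed

lemma gwa_val_hom:
  "X \<in> carrier (gwa a) \<Longrightarrow> Y \<in> carrier (gwa a) \<Longrightarrow> gwa_val (X \<oplus>\<^bsub>gwa a\<^esub> Y) = gwa_val X + gwa_val Y"
  "X \<in> carrier (gwa a) \<Longrightarrow> Y \<in> carrier (gwa a) \<Longrightarrow> gwa_val (X \<otimes>\<^bsub>gwa a\<^esub> Y) = gwa_val X * gwa_val Y"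
  "gwa_val \<one>\<^bsub>gwa a\<^esub> = 1" "gwa_val (c \<odot>\<^bsub>gwa a\<^esub> \<one>\<^bsub>gwa a\<^esub>) = smon [:c:] 0"
  by (auto simp: gwa_simps gwa_val_cls free_val_add free_val_mult free_val_one free_val_scalar)

lemma gwa_val_image: "gwa_val ` carrier (gwa a) = gwa_sub a"
proof
  show "gwa_val ` carrier (gwa a) \<subseteq> gwa_sub a"
    by (auto simp: gwa_simps gwa_val_cls free_val_gwa_sub)
  show "gwa_sub a \<subseteq> gwa_val ` carrier (gwa a)"
  proof
    fix z assume "z \<in> gwa_sub a"
    then obtain F where "free_val a F = z" by (rule free_val_surj)
    then show "z \<in> gwa_val ` carrier (gwa a)"
      by (intro image_eqI[of _ _ "cls F"]) (auto simp: gwa_simps gwa_val_cls)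
  qed
qed

lemma inj_gwa_val:
  assumes "a \<noteq> 0" shows "inj_on gwa_val (carrier (gwa a))"
proof (rule inj_onI)
  fix X Y assume "X \<in> carrier (gwa a)" "Y \<in> carrier (gwa a)" and eq: "gwa_val X = gwa_val Y"
  then obtain F G where FG: "X = cls F" "Y = cls G" by (auto simp: gwa_simps)
  have "free_val a (F - G) = 0" using eq by (simp add: FG gwa_val_cls free_val_diff)
  then have 1: "F - G \<in> gwa_ideal a" by (rule free_val_kernel[OF assms])
  have "cls F = cls (F - G + G)" by simp
  also have "\<dots> = cls (F - G) \<oplus>\<^bsub>gwa a\<^esub> cls G" by (simp only: gwa_simps)
  also have "cls (F - G) = cls 0"
    using I.a_rcos_const[of "F - G"] I.a_rcos_const[of 0] 1 gwa_ideal_closed(1) by simp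
  also have "cls 0 \<oplus>\<^bsub>gwa a\<^esub> cls G = cls G" by (simp only: gwa_simps add_0)
  finally show "X = Y" by (simp add: FG)
qed

end

section \<open>Skew Laurent polynomials fit into every type containing the field\<close>

fun pair_up :: "('k \<times> 'k \<Rightarrow> 'k) \<Rightarrow> 'k \<Rightarrow> 'k list \<Rightarrow> 'k" where
  "pair_up f c [] = c"
| "pair_up f c (x # xs) = f (x, pair_up f c xs)"

lemma inj_list_field: "\<exists>f :: 'k::field_char_0 list \<Rightarrow> 'k. inj f"
proof -
  have "\<exists>f. inj_on f (UNIV \<times> UNIV :: ('k \<times> 'k) set) \<and> f ` (UNIV \<times> UNIV) \<subseteq> (UNIV :: 'k set)"
    unfolding card_of_ordLeq
    by (intro ordIso_imp_ordLeq card_of_Times_same_infinite infinite_UNIV_char_0)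
  then obtain f :: "'k \<times> 'k \<Rightarrow> 'k" where f: "inj f" by auto
  have eq: "xs = ys" if "length xs = length ys" "pair_up f 0 xs = pair_up f 0 ys" for xs ys
    using that by (induction xs ys rule: list_induct2) (auto dest: injD[OF f])
  have "inj (\<lambda>xs. f (of_nat (length xs), pair_up f 0 xs))"
    by (rule injI) (auto dest!: injD[OF f] intro: eq)
  then show ?thesis by blast
qed

lemma inj_skew:
  fixes \<iota> :: "'k::field_char_0 \<Rightarrow> 'u"
  assumes "inj \<iota>"
  shows "\<exists>\<kappa> :: 'k skew \<Rightarrow> 'u. inj \<kappa>"
proof -
  obtain f :: "'k list \<Rightarrow> 'k" where f: "inj f" using inj_list_field by blast
  define N where "N z = Max (insert 0 (abs ` supp z))" for z :: "'k skew"
  define code where "code z = map (\<lambda>d. f (coeffs (cf z d))) [- N z..N z]" for z :: "'k skew"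
  have N: "\<bar>d\<bar> \<le> N z" if "d \<in> supp z" for d z
    using that by (auto simp: N_def)
  have "inj code"
  proof (rule injI)
    fix z w :: "'k skew" assume eq: "code z = code w"
    have N0: "0 \<le> N z" "0 \<le> N w" by (auto simp: N_def)
    have "length (code z) = length (code w)" using eq by simp
    then have Neq: "N z = N w" using N0 by (simp add: code_def)
    have "cf z d = cf w d" if "d \<in> {- N z..N z}" for d
    proof -
      have "\<forall>d\<in>{- N z..N z}. f (coeffs (cf z d)) = f (coeffs (cf w d))"
        using eq unfolding code_def Neq[symmetric] by simp
      then have "coeffs (cf z d) = coeffs (cf w d)" using that f by (auto dest: injD)
      then show ?thesis by (simp add: coeffs_eq_iff)
    qed
    moreover have "cf z d = cf w d" if "d \<notin> {- N z..N z}" for d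
      using N[of d z] N[of d w] that Neq by (metis abs_le_D1 abs_le_D2 atLeastAtMost_iff minus_le_iff not_supp)
    ultimately show "z = w" by (intro skew_eqI) blast
  qed
  then have "inj (\<lambda>z. \<iota> (f (code z)))"
    using assms f by (auto simp: inj_def)
  then show ?thesis by blast
qed

section \<open>Comparison of two Morita equivalent generalized Weyl algebras\<close>

lemma (in linear_equivalence) decomposition_transport:
  assumes P: "P \<in> lc_obj C" and Q: "Q \<in> lc_obj D" and qs: "decomposition C (Go Q) P qs"
  obtains ps where "decomposition D Q (Fo P) ps"
proof -
  interpret S: linear_equivalence D C Go Gm Fo Fm \<epsilon> \<eta> by (rule swap)
  obtain r where r: "r \<in> lc_hom D (Fo (Go Q)) Q"
    "lc_comp D (Fo (Go Q)) Q (Fo (Go Q)) (\<epsilon> Q) r = lc_id D (Fo (Go Q))"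
    using S.\<eta>_inverse[OF Q] by metis
  have "decomposition D Q (Fo (Go Q)) [(\<epsilon> Q, r)]"
    using r S.\<eta>_hom[OF Q] S.GF_obj[OF Q]
    by (simp add: decomposition_def D.lc_sum_Cons D.lc_sum_Nil D.add_zero D.id_hom)
  moreover have "decomposition D (Fo (Go Q)) (Fo P) (map (\<lambda>(u, v). (Fm (Go Q) P u, Fm P (Go Q) v)) qs)"
    by (rule decomposition_F[OF S.F_obj[OF Q] P qs])
  ultimately show ?thesis
    using that D.decomposition_trans[OF Q S.GF_obj[OF Q] F_obj[OF P]] by blast
qed

lemma (in linear_category) hs_trace_cong:
  assumes "P \<in> Ob" "X \<in> Ob" "decomposition C P X ps" "f \<in> Hom X X"
    "\<And>h. h \<in> Hom P P \<Longrightarrow> \<phi> h = \<psi> h"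
  shows "hs_trace C P X ps \<phi> f = hs_trace C P X ps \<psi> f"
  unfolding hs_trace_def
proof (intro arg_cong[where f = sum_list] map_cong refl, clarify)
  fix u v assume "(u, v) \<in> set ps"
  then have "u \<in> Hom P X" "v \<in> Hom X P" using assms(3) by (auto simp: decomposition_def)
  then show "\<phi> (lc_comp C P X P v (lc_comp C P X X f u)) = \<psi> (lc_comp C P X P v (lc_comp C P X X f u))"
    using assms by (intro assms(5)) (simp add: comp_hom)
qed

lemma hs_trace_sum:
  "hs_trace C P X ps (\<lambda>h. \<Sum>i\<in>I. c i * \<phi> i h) f = (\<Sum>i\<in>I. c i * hs_trace C P X ps (\<phi> i) f)"
  unfolding hs_trace_def
  by (induction ps) (simp_all add: case_prod_unfold sum.distrib distrib_left)

locale gwa_roots =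
  fixes n :: nat and lam :: "nat \<Rightarrow> 'k::field_char_0" and a :: "'k poly" and \<kappa> :: "'k skew \<Rightarrow> 'u"
  assumes n: "1 \<le> n" and a: "a = (\<Prod>i=1..n. [:- lam i, 1:])" and inj_lam: "inj_on lam {1..n}"
    and inj_\<kappa>: "inj \<kappa>"
begin

lemma a_nonzero: "a \<noteq> 0"
  by (simp add: a)

lemma root: "i \<in> {1..n} \<Longrightarrow> poly a (lam i) = 0"
  unfolding a poly_prod by (rule prod_zero) auto

sublocale embedded_algebra "gwa a" "gwa_val a" \<kappa>
proof (intro embedded_algebra.intro embedded_algebra_axioms.intro)
  show "k_algebra (gwa a)" by (rule k_algebra_gwa)
qed (simp_all add: inj_gwa_val[OF a_nonzero] gwa_val_hom inj_\<kappa>)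

lemma S_gwa: "S = gwa_sub a"
  by (simp add: S_def gwa_val_image)

definition t :: "nat \<Rightarrow> 'k skew \<Rightarrow> 'k" where "t i = tau (lam n) (lam i)"

definition lag :: "nat \<Rightarrow> 'k poly" where
  "lag = (SOME l. \<forall>i\<in>{1..n}. \<forall>j\<in>{1..n}. poly (l j) (lam i) = (if i = j then 1 else 0))"

definition eps :: "nat \<Rightarrow> 'k skew" where "eps j = smon (- bdiff (lag j)) 0"

lemma lag: "i \<in> {1..n} \<Longrightarrow> j \<in> {1..n} \<Longrightarrow> poly (lag j) (lam i) = (if i = j then 1 else 0)"
  using someI_ex[OF lagrange_basis[OF _ inj_lam]] unfolding lag_def by simp

lemma eps_S: "eps j \<in> S"
  by (simp add: eps_def S_gwa smon0_gwa_sub)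

lemma t_eps: "i \<in> {1..<n} \<Longrightarrow> j \<in> {1..<n} \<Longrightarrow> t i (eps j) = (if i = j then 1 else 0)"
  using n by (auto simp: t_def eps_def tau_bdiff lag)

lemma t_one: "t i 1 = lam n - lam i"
  by (simp add: t_def tau_one)

lemma trace_on_t:
  assumes "i \<in> {1..<n}" shows "trace_on (t i)"
  unfolding trace_on_def t_def
  using assms n by (auto simp: tau_add gwa_val_hom tau_scale S_gwa intro!: tau_commute root)

lemma trace_functional_t: "i \<in> {1..<n} \<Longrightarrow> trace_functional lmod reg (\<lambda>f. t i (elt f))"
  by (rule trace_functional_elt[OF trace_on_t])

lemma trace_functional_expand:
  assumes \<Phi>: "trace_functional lmod reg \<Phi>" and f: "f \<in> lc_hom lmod reg reg"
  shows "\<Phi> f = (\<Sum>j\<in>{1..<n}. t j (elt f) * \<Phi> (rmap reg (\<kappa> (eps j))))"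
proof -
  let ?\<phi> = "\<lambda>s. \<Phi> (rmap reg (\<kappa> s))"
  have \<phi>: "trace_on ?\<phi>" by (rule trace_on_rmap[OF \<Phi>])
  have "?\<phi> (elt f) = (\<Sum>j\<in>{1..<n}. tau (lam n) (lam j) (elt f) * ?\<phi> (smon (- bdiff (lag j)) 0))"
  proof (rule trace_spanned_by_tau[OF n a inj_lam])
    fix z w assume "z \<in> gwa_sub a" "w \<in> gwa_sub a"
    then show "?\<phi> (z + w) = ?\<phi> z + ?\<phi> w" "?\<phi> (z * w) = ?\<phi> (w * z)"
      using \<phi> by (auto simp: trace_on_def S_gwa)
  next
    fix c z assume "z \<in> gwa_sub a"
    then have "?\<phi> (gwa_val a (c \<odot>\<^bsub>gwa a\<^esub> \<one>\<^bsub>gwa a\<^esub>) * z) = c * ?\<phi> z"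
      using \<phi> by (simp add: trace_on_def S_gwa)
    then show "?\<phi> (smon [:c:] 0 * z) = c * ?\<phi> z" by (simp add: gwa_val_hom)
  next
    show "elt f \<in> gwa_sub a" using elt_S[OF f] by (simp add: S_gwa)
  qed (use lag in auto)
  moreover have "rmap reg (\<kappa> (elt f)) = f"
    using elt_S[OF f] by (intro elt_inj f rmap_reg_hom) (simp_all add: elt_rmap)
  ultimately show ?thesis by (simp add: t_def eps_def)
qed

lemma trace_uniform_integral:
  assumes X: "X \<in> lc_obj lmod" "uniform lmod reg X" "decomposition lmod reg X ps" and i: "i \<in> {1..<n}"
  shows "hs_trace lmod reg X ps (\<lambda>f. t i (elt f)) (lc_id lmod X) - (lam n - lam i) \<in> \<int>"
proof -
  have dom: "\<And>x y. x \<in> S \<Longrightarrow> y \<in> S \<Longrightarrow> x * y = 0 \<Longrightarrow> x = 0 \<or> y = 0"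
    using skew_no_zero_divisors by blast
  obtain L gws where L: "submod L" "L \<subseteq> S" "L \<noteq> {0}" "dual_basis L gws"
    and tr: "\<And>\<phi>. trace_on \<phi> \<Longrightarrow>
      hs_trace lmod reg X ps (\<lambda>f. \<phi> (elt f)) (lc_id lmod X) = \<phi> (\<Sum>(g, w)\<leftarrow>gws. w g)"
    using uniform_dual_basis[OF dom X(1,2,3)] by blast
  have nth: "(\<Sum>p\<leftarrow>gws. F p) = (\<Sum>j<length gws. F (gws ! j))" for F :: "_ \<Rightarrow> 'k skew"
    by (simp add: sum_list_sum_nth atLeast0LessThan)
  have db: "fst (gws ! j) \<in> L" "z \<in> L \<Longrightarrow> snd (gws ! j) z \<in> S"
      "y \<in> L \<Longrightarrow> z \<in> L \<Longrightarrow> snd (gws ! j) (y + z) = snd (gws ! j) y + snd (gws ! j) z"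
      "r \<in> S \<Longrightarrow> z \<in> L \<Longrightarrow> snd (gws ! j) (r * z) = r * snd (gws ! j) z"
    if "j < length gws" for j y z r
    using L(4) nth_mem[OF that] by (auto simp: dual_basis_def)
  have "tau (lam n) (lam i) (\<Sum>j<length gws. snd (gws ! j) (fst (gws ! j))) - (lam n - lam i) \<in> \<int>"
  proof (rule gwa_sub_dual_basis_trace_integral[where a = a and L = L
        and g = "\<lambda>j. fst (gws ! j)" and w = "\<lambda>j. snd (gws ! j)"])
    show "z = (\<Sum>j<length gws. snd (gws ! j) z * fst (gws ! j))" if "z \<in> L" for z
      using L(4) that nth[of "\<lambda>(g, w). w z * g"] by (simp add: dual_basis_def case_prod_unfold)
    show "poly a (lam n) = 0" "poly a (lam i) = 0" using n i by (auto intro!: root)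
  qed (use a_nonzero L db in \<open>auto simp: submod_def S_gwa\<close>)
  then show ?thesis
    using tr[OF trace_on_t[OF i]] nth[of "\<lambda>(g, w). w g"] by (simp add: t_def case_prod_unfold)
qed

lemma ore: "x \<in> S \<Longrightarrow> y \<in> S \<Longrightarrow> x \<noteq> 0 \<Longrightarrow> y \<noteq> 0 \<Longrightarrow>
    \<exists>r\<in>S. \<exists>s\<in>S. r * x = s * y \<and> r * x \<noteq> 0"
  unfolding S_gwa by (rule gwa_sub_ore[OF a_nonzero])

lemma uniform_reg: "uniform lmod reg reg"
proof (rule uniform_lid[OF ore submod_S])
  show "S \<noteq> {0}" using S_closed(2) by (metis singletonD zero_neq_one)
qed auto

lemma root_ideal:
  assumes j: "j \<in> {1..<n}"
  obtains X ps where "X \<in> lc_obj lmod" "uniform lmod reg X" "decomposition lmod reg X ps"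
    "\<And>\<phi>. trace_on \<phi> \<Longrightarrow>
      hs_trace lmod reg X ps (\<lambda>f. \<phi> (elt f)) (lc_id lmod X) = \<phi> (1 + eps j)"
proof -
  have jn: "j \<in> {1..n}" using j by auto
  have "a dvd [:- lam j, 1:] * lag j"
    unfolding a
  proof (rule prod_linear_dvd[OF _ inj_lam])
    fix i assume "i \<in> {1..n}"
    then show "poly ([:- lam j, 1:] * lag j) (lam i) = 0" using lag[OF _ jn] by simp
  qed simp
  moreover have "poly (lag j) (lam j) = 1" using lag[OF jn jn] by simp
  ultimately obtain L g w where L: "0 \<in> L" "\<And>x y. x \<in> L \<Longrightarrow> y \<in> L \<Longrightarrow> x + y \<in> L"
    "\<And>r x. r \<in> gwa_sub a \<Longrightarrow> x \<in> L \<Longrightarrow> r * x \<in> L" "L \<noteq> {0}" "L \<subseteq> gwa_sub a"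
    and g: "\<And>j :: nat. j < 2 \<Longrightarrow> g j \<in> L" and w: "\<And>j z. j < 2 \<Longrightarrow> z \<in> L \<Longrightarrow> w j z \<in> gwa_sub a"
    "\<And>j y z. j < 2 \<Longrightarrow> w j (y + z) = w j y + w j z" "\<And>j r z. j < 2 \<Longrightarrow> w j (r * z) = r * w j z"
    and dual: "\<And>z. z = (\<Sum>j<2. w j z * g j)" "(\<Sum>j<2. w j (g j)) = 1 + smon (- bdiff (lag j)) 0"
    by (rule gwa_sub_root_ideal) blast
  define gws where "gws = [(g 0, w 0), (g 1, w 1)]"
  have two: "(\<Sum>j<2. F j) = F 0 + F 1" for F :: "nat \<Rightarrow> 'k skew"
    by (simp add: numeral_2_eq_2)
  have sub: "submod L" using L by (simp add: submod_def S_gwa)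
  have "dual_basis L gws"
    unfolding dual_basis_def
  proof (intro conjI ballI)
    fix z assume "z \<in> L"
    show "z = (\<Sum>(g, w)\<leftarrow>gws. w z * g)"
      using dual(1)[of z] unfolding two by (simp add: gws_def)
  next
    fix p assume "p \<in> set gws"
    then have "p = (g 0, w 0) \<or> p = (g 1, w 1)" by (auto simp: gws_def)
    moreover have "(0::nat) < 2" "(1::nat) < 2" by simp_all
    ultimately obtain k where "k < 2" "p = (g k, w k)" by blast
    then show "case p of (g, w) \<Rightarrow> g \<in> L \<and> (\<forall>z\<in>L. w z \<in> S) \<and>
       (\<forall>y\<in>L. \<forall>z\<in>L. w (y + z) = w y + w z) \<and> (\<forall>s\<in>S. \<forall>z\<in>L. w (s * z) = s * w z)"
      using g w by (simp add: S_gwa)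
  qed
  from dual_basis_decomposition[OF sub this] obtain ps where ps: "decomposition lmod reg (lid L) ps"
    "\<And>\<phi>. trace_on \<phi> \<Longrightarrow>
      hs_trace lmod reg (lid L) ps (\<lambda>f. \<phi> (elt f)) (lc_id lmod (lid L)) = \<phi> (\<Sum>(g, w)\<leftarrow>gws. w g)"
    by blast
  have "(\<Sum>(g, w)\<leftarrow>gws. w g) = 1 + eps j"
    using dual(2) unfolding two by (simp add: gws_def eps_def)
  moreover have "uniform lmod reg (lid L)"
    using uniform_lid[OF ore sub] L by (simp add: S_gwa)
  ultimately show ?thesis using that[OF lid_obj[OF sub] _ ps(1)] ps(2) by simp
qed

end

locale gwa_equivalence =
  A: gwa_roots n lam a \<kappa> + B: gwa_roots n mu b \<kappa> +
  linear_equivalence "left_modules TYPE('u) (gwa a)" "left_modules TYPE('u) (gwa b)" Fo Fm Go Gm \<eta> \<epsilon>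
  for n :: nat and lam mu :: "nat \<Rightarrow> 'k::field_char_0" and a b and \<kappa> :: "'k skew \<Rightarrow> 'u"
    and Fo Fm Go Gm \<eta> \<epsilon> +
  fixes ps
  assumes ps: "decomposition B.lmod B.reg (Fo A.reg) ps"
begin

definition pb :: "nat \<Rightarrow> ('u \<Rightarrow> 'u) \<Rightarrow> 'k" where
  "pb i = trace_pullback A.reg B.reg ps (\<lambda>f. B.t i (B.elt f))"

definition Nmat :: "nat \<Rightarrow> nat \<Rightarrow> 'k" where
  "Nmat i j = pb i (A.rmap A.reg (\<kappa> (A.eps j)))"

lemma pb_functional: "i \<in> {1..<n} \<Longrightarrow> trace_functional A.lmod A.reg (pb i)"
  unfolding pb_def
  by (rule trace_pullback_functional[OF A.reg_obj B.reg_obj ps B.trace_functional_t])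

lemma pb_expand:
  "i \<in> {1..<n} \<Longrightarrow> f \<in> lc_hom A.lmod A.reg A.reg \<Longrightarrow> pb i f = (\<Sum>j\<in>{1..<n}. Nmat i j * A.t j (A.elt f))"
  using A.trace_functional_expand[OF pb_functional, of i f] by (simp add: Nmat_def mult.commute)

lemma pb_uniform_integral:
  assumes X: "X \<in> lc_obj A.lmod" "uniform A.lmod A.reg X" "decomposition A.lmod A.reg X qs"
    and i: "i \<in> {1..<n}"
  shows "hs_trace A.lmod A.reg X qs (pb i) (lc_id A.lmod X) - (mu n - mu i) \<in> \<int>"
proof -
  have "uniform B.lmod B.reg (Fo X)"
    by (rule uniform_F[OF A.reg_obj A.separating_reg B.reg_obj B.separating_reg X(1,2)])
  then show ?thesis
    using trace_pullback_hs_trace[OF A.reg_obj B.reg_obj X(1) ps X(3) A.lmod.id_hom[OF X(1)]]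
      B.trace_uniform_integral[OF F_obj[OF X(1)] _ _ i] F_id[OF X(1)]
    unfolding pb_def by simp
qed

lemma pb_id: "i \<in> {1..<n} \<Longrightarrow> pb i (lc_id A.lmod A.reg) - (mu n - mu i) \<in> \<int>"
  using pb_uniform_integral[OF A.reg_obj A.uniform_reg A.lmod.decomposition_self[OF A.reg_obj], of i]
    A.lmod.hs_trace_self[OF A.reg_obj A.lmod.id_hom[OF A.reg_obj]] by simp

lemma elt_id: "A.elt (lc_id A.lmod A.reg) = 1"
  by (simp add: A.elt_def A.lmod_simps(3) A.kappa_one_reg)

lemma Nmat_sum: "i \<in> {1..<n} \<Longrightarrow>
    (\<Sum>j\<in>{1..<n}. Nmat i j * (lam n - lam j)) - (mu n - mu i) \<in> \<int>"
  using pb_id[of i] pb_expand[of i "lc_id A.lmod A.reg"] A.lmod.id_hom[OF A.reg_obj]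
  by (simp add: elt_id A.t_one)

lemma Nmat_Ints:
  assumes i: "i \<in> {1..<n}" and j: "j \<in> {1..<n}"
  shows "Nmat i j \<in> \<int>"
proof -
  obtain X qs where X: "X \<in> lc_obj A.lmod" "uniform A.lmod A.reg X" "decomposition A.lmod A.reg X qs"
    and tr: "\<And>\<phi>. A.trace_on \<phi> \<Longrightarrow>
      hs_trace A.lmod A.reg X qs (\<lambda>f. \<phi> (A.elt f)) (lc_id A.lmod X) = \<phi> (1 + A.eps j)"
    using A.root_ideal[OF j] by blast
  define \<phi> where "\<phi> s = pb i (A.rmap A.reg (\<kappa> s))" for s
  have \<phi>: "A.trace_on \<phi>" unfolding \<phi>_def by (rule A.trace_on_rmap[OF pb_functional[OF i]])
  have \<phi>_elt: "\<phi> (A.elt f) = pb i f" if "f \<in> lc_hom A.lmod A.reg A.reg" for f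
  proof -
    have "A.rmap A.reg (\<kappa> (A.elt f)) = f"
      using A.elt_S[OF that] by (intro A.elt_inj that A.rmap_reg_hom) (simp_all add: A.elt_rmap)
    then show ?thesis by (simp add: \<phi>_def)
  qed
  have "hs_trace A.lmod A.reg X qs (pb i) (lc_id A.lmod X) =
      hs_trace A.lmod A.reg X qs (\<lambda>f. \<phi> (A.elt f)) (lc_id A.lmod X)"
    by (rule A.lmod.hs_trace_cong[OF A.reg_obj X(1,3) A.lmod.id_hom[OF X(1)]]) (simp add: \<phi>_elt)
  also have "\<dots> = \<phi> 1 + \<phi> (A.eps j)"
    unfolding tr[OF \<phi>] using \<phi> A.S_closed(2) A.eps_S by (simp add: A.trace_on_def)
  also have "\<phi> 1 = pb i (lc_id A.lmod A.reg)"
    using \<phi>_elt[OF A.lmod.id_hom[OF A.reg_obj]] by (simp add: elt_id)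
  finally have "hs_trace A.lmod A.reg X qs (pb i) (lc_id A.lmod X) =
      pb i (lc_id A.lmod A.reg) + Nmat i j" by (simp add: \<phi>_def Nmat_def)
  then have "Nmat i j = (hs_trace A.lmod A.reg X qs (pb i) (lc_id A.lmod X) - (mu n - mu i)) -
      (pb i (lc_id A.lmod A.reg) - (mu n - mu i))" by simp
  then show ?thesis using pb_uniform_integral[OF X i] pb_id[OF i] by (metis Ints_diff)
qed

lemma Nmat_inverse:
  assumes qs: "decomposition A.lmod A.reg (Go B.reg) qs" and i: "i \<in> {1..<n}" and j: "j \<in> {1..<n}"
  shows "(\<Sum>l\<in>{1..<n}. gwa_equivalence.Nmat n mu lam b a \<kappa> Go Gm qs j l * Nmat l i) = (if j = i then 1 else 0)"
proof -
  interpret S: gwa_equivalence n mu lam b a \<kappa> Go Gm Fo Fm \<epsilon> \<eta> qs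
    using swap qs B.gwa_roots_axioms A.gwa_roots_axioms
    by (intro gwa_equivalence.intro gwa_equivalence_axioms.intro)
  let ?f = "A.rmap A.reg (\<kappa> (A.eps i))"
  have f: "?f \<in> lc_hom A.lmod A.reg A.reg" by (rule A.rmap_reg_hom[OF A.eps_S])
  have Fc: "Fm A.reg A.reg ?f \<in> lc_hom B.lmod (Fo A.reg) (Fo A.reg)"
    by (rule F_hom[OF A.reg_obj A.reg_obj f])
  have elt: "A.elt ?f = A.eps i" by (rule A.elt_rmap[OF A.eps_S])
  have "A.t j (A.elt ?f) = trace_pullback A.reg B.reg ps (S.pb j) ?f"
    unfolding S.pb_def
    by (rule trace_pullback_inverse[OF A.reg_obj B.reg_obj ps qs A.trace_functional_t[OF j] f, symmetric])
  also have "\<dots> = hs_trace B.lmod B.reg (Fo A.reg) ps (\<lambda>h. \<Sum>l\<in>{1..<n}. S.Nmat j l * B.t l (B.elt h)) (Fm A.reg A.reg ?f)"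
    unfolding trace_pullback_def
    by (rule B.lmod.hs_trace_cong[OF B.reg_obj F_obj[OF A.reg_obj] ps Fc]) (rule S.pb_expand[OF j])
  also have "\<dots> = (\<Sum>l\<in>{1..<n}. S.Nmat j l * pb l ?f)"
    unfolding hs_trace_sum by (simp add: pb_def trace_pullback_def)
  also have "\<dots> = (\<Sum>l\<in>{1..<n}. S.Nmat j l * Nmat l i)"
    by (simp add: Nmat_def)
  finally show ?thesis using A.t_eps[OF j i] by (simp add: elt)
qed

end

theorem theorem2p6p2:
  fixes n :: nat
    and lam mu :: "nat \<Rightarrow> 'k::{alg_closed_field, field_char_0}"
    and a b :: "'k poly"
    and \<Lambda> \<Omega> :: "'k vec"
    and \<iota> :: "'k \<Rightarrow> 'u"
  assumes n: "1 \<le> n"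
    and a: "a = (\<Prod>i=1..n. [:- lam i, 1:])"
    and b: "b = (\<Prod>i=1..n. [:- mu i, 1:])"
    and lam: "\<And>i j. i \<in> {1..n} \<Longrightarrow> j \<in> {1..n} \<Longrightarrow> i \<noteq> j \<Longrightarrow> lam i - lam j \<notin> \<int>"
    and mu: "\<And>i j. i \<in> {1..n} \<Longrightarrow> j \<in> {1..n} \<Longrightarrow> i \<noteq> j \<Longrightarrow> mu i - mu j \<notin> \<int>"
    and \<Lambda>: "\<Lambda> = vec (n - 1) (\<lambda>i. lam n - lam (i + 1))"
    and \<Omega>: "\<Omega> = vec (n - 1) (\<lambda>i. mu n - mu (i + 1))"
    and universe: "inj \<iota>"
    and morita: "morita_equivalent TYPE('u) (gwa a) (gwa b)"
  shows "\<exists>(N :: int mat) (M :: int vec).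
    N \<in> carrier_mat (n - 1) (n - 1) \<and> invertible_mat N \<and> M \<in> carrier_vec (n - 1) \<and>
    map_mat of_int N *\<^sub>v \<Lambda> = \<Omega> + map_vec of_int M"
proof -
  obtain \<kappa> :: "'k skew \<Rightarrow> 'u" where \<kappa>: "inj \<kappa>" using inj_skew[OF universe] by blast
  have inj: "inj_on lam {1..n}" "inj_on mu {1..n}"
    using lam mu by (metis Ints_0 diff_self inj_onI)+
  interpret A: gwa_roots n lam a \<kappa> by unfold_locales (fact n a inj \<kappa>)+
  interpret B: gwa_roots n mu b \<kappa> by unfold_locales (fact n b inj \<kappa>)+
  obtain Fo Fm Go Gm \<eta> \<epsilon> where E: "linear_equivalence A.lmod B.lmod Fo Fm Go Gm \<eta> \<epsilon>"
    using lin_equivalent_linear_equivalence[OF A.lmod.linear_category_axioms B.lmod.linear_category_axioms]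
      morita unfolding morita_equivalent_def by metis
  interpret E: linear_equivalence A.lmod B.lmod Fo Fm Go Gm \<eta> \<epsilon> by (rule E)
  interpret E': linear_equivalence B.lmod A.lmod Go Gm Fo Fm \<epsilon> \<eta> by (rule E.swap)
  obtain ps0 where ps0: "decomposition A.lmod (Go B.reg) A.reg ps0"
    using A.decomposition_reg[OF E'.F_obj[OF B.reg_obj] E'.separating_F[OF B.reg_obj B.separating_reg]] .
  obtain ps where ps: "decomposition B.lmod B.reg (Fo A.reg) ps"
    using E.decomposition_transport[OF A.reg_obj B.reg_obj ps0] .
  obtain qs0 where qs0: "decomposition B.lmod (Fo A.reg) B.reg qs0"
    using B.decomposition_reg[OF E.F_obj[OF A.reg_obj] E.separating_F[OF A.reg_obj A.separating_reg]] .
  obtain qs where qs: "decomposition A.lmod A.reg (Go B.reg) qs"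
    using E'.decomposition_transport[OF B.reg_obj A.reg_obj qs0] .
  interpret M: gwa_equivalence n lam mu a b \<kappa> Fo Fm Go Gm \<eta> \<epsilon> ps
    by unfold_locales (rule ps)
  interpret M': gwa_equivalence n mu lam b a \<kappa> Go Gm Fo Fm \<epsilon> \<eta> qs
    by unfold_locales (rule qs)
  define P where "P i j = (THE m :: int. of_int m = M.Nmat i j)" for i j
  define P' where "P' i j = (THE m :: int. of_int m = M'.Nmat i j)" for i j
  have the: "of_int (THE m :: int. of_int m = x) = x" if "x \<in> \<int>" for x :: 'k
    using that by (auto elim!: Ints_cases)
  have P: "of_int (P i j) = M.Nmat i j" "of_int (P' i j) = M'.Nmat i j"
    if "i \<in> {1..<n}" "j \<in> {1..<n}" for i j
    using that the M.Nmat_Ints M'.Nmat_Ints by (simp_all add: P_def P'_def)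
  have inv: "(\<Sum>l\<in>{1..<n}. P' j l * P l i) = (if j = i then 1 else 0)"
    "(\<Sum>l\<in>{1..<n}. P j l * P' l i) = (if j = i then 1 else 0)"
    if ij: "i \<in> {1..<n}" "j \<in> {1..<n}" for i j
  proof -
    have "of_int (\<Sum>l\<in>{1..<n}. P' j l * P l i) = (\<Sum>l\<in>{1..<n}. M'.Nmat j l * M.Nmat l i)"
      using ij by (simp add: P)
    also have "\<dots> = of_int (if j = i then 1 else 0)" using M.Nmat_inverse[OF qs ij] by simp
    finally show "(\<Sum>l\<in>{1..<n}. P' j l * P l i) = (if j = i then 1 else 0)"
      by (simp only: of_int_eq_iff)
    have "of_int (\<Sum>l\<in>{1..<n}. P j l * P' l i) = (\<Sum>l\<in>{1..<n}. M.Nmat j l * M'.Nmat l i)"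
      using ij by (simp add: P)
    also have "\<dots> = of_int (if j = i then 1 else 0)" using M'.Nmat_inverse[OF ps ij] by simp
    finally show "(\<Sum>l\<in>{1..<n}. P j l * P' l i) = (if j = i then 1 else 0)"
      by (simp only: of_int_eq_iff)
  qed
  have shift: "(\<Sum>l\<in>{0..<n - 1}. F (l + 1)) = (\<Sum>l\<in>{1..<n}. F l)" for F :: "nat \<Rightarrow> 'z::comm_monoid_add"
    using n by (intro sum.reindex_bij_witness[of _ "\<lambda>l. l - 1" "\<lambda>l. l + 1"]) auto
  define N where "N = mat (n - 1) (n - 1) (\<lambda>(i, j). P (i + 1) (j + 1))"
  define N' where "N' = mat (n - 1) (n - 1) (\<lambda>(i, j). P' (i + 1) (j + 1))"
  have N: "N \<in> carrier_mat (n - 1) (n - 1)" "N' \<in> carrier_mat (n - 1) (n - 1)"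
    by (simp_all add: N_def N'_def)
  have "N' * N = 1\<^sub>m (n - 1)"
  proof (rule eq_matI)
    fix i j assume "i < dim_row (1\<^sub>m (n - 1) :: int mat)" "j < dim_col (1\<^sub>m (n - 1) :: int mat)"
    then show "(N' * N) $$ (i, j) = 1\<^sub>m (n - 1) $$ (i, j)"
      using shift[of "\<lambda>l. P' (i + 1) l * P l (j + 1)"] inv(1)[of "j + 1" "i + 1"]
      by (auto simp: N_def N'_def scalar_prod_def)
  qed (simp_all add: N_def N'_def)
  moreover have "N * N' = 1\<^sub>m (n - 1)"
  proof (rule eq_matI)
    fix i j assume "i < dim_row (1\<^sub>m (n - 1) :: int mat)" "j < dim_col (1\<^sub>m (n - 1) :: int mat)"
    then show "(N * N') $$ (i, j) = 1\<^sub>m (n - 1) $$ (i, j)"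
      using shift[of "\<lambda>l. P (i + 1) l * P' l (j + 1)"] inv(2)[of "j + 1" "i + 1"]
      by (auto simp: N_def N'_def scalar_prod_def)
  qed (simp_all add: N_def N'_def)
  ultimately have "invertible_mat N"
    using N unfolding invertible_mat_def inverts_mat_def by (metis carrier_matD square_mat.simps)
  moreover define m where "m i = (THE k :: int. of_int k =
      (\<Sum>j\<in>{1..<n}. M.Nmat i j * (lam n - lam j)) - (mu n - mu i))" for i
  define M where "M = vec (n - 1) (\<lambda>i. m (i + 1))"
  have "map_mat of_int N *\<^sub>v \<Lambda> = \<Omega> + map_vec of_int M"
  proof (rule eq_vecI)
    fix i assume "i < dim_vec (\<Omega> + map_vec of_int M)"
    then have i: "i < n - 1" by (simp add: M_def)
    then have i1: "i + 1 \<in> {1..<n}" by auto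
    have "(map_mat of_int N *\<^sub>v \<Lambda>) $ i = (\<Sum>l\<in>{0..<n - 1}. of_int (P (i + 1) (l + 1)) * (lam n - lam (l + 1)))"
      using i by (simp add: N_def \<Lambda> scalar_prod_def)
    also have "\<dots> = (\<Sum>j\<in>{1..<n}. of_int (P (i + 1) j) * (lam n - lam j))"
      by (rule shift)
    also have "\<dots> = (\<Sum>j\<in>{1..<n}. M.Nmat (i + 1) j * (lam n - lam j))"
      using i1 P(1) by (intro sum.cong) auto
    also have "\<dots> = (mu n - mu (i + 1)) + of_int (m (i + 1))"
      using the[OF M.Nmat_sum[OF i1]] unfolding m_def by simp
    finally show "(map_mat of_int N *\<^sub>v \<Lambda>) $ i = (\<Omega> + map_vec of_int M) $ i"
      using i by (simp add: \<Omega> M_def)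
  qed (simp_all add: N_def \<Omega> M_def)
  moreover have "M \<in> carrier_vec (n - 1)" by (simp add: M_def)
  ultimately show ?thesis using N by blast
qed

end
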